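(* Let $X$ be a centered Gaussian random element with values in a separable Hilbert space $(H,\|\cdot\|_H)$, with infinite-dimensional support and Karhunen-Lo\`eve expansion $X=\sum_{i=1}^\infty\lambda_i^{1/2}\cdot Y_i\cdot e_i$, let $\mu$ denote its distribution, and assume that $\lim_{i\to\infty}\lambda_i\cdot i^\beta\cdot(\ln(i))^\alpha\in{]0,\infty[}$ with $\beta>1$ and $\alpha\in\mathbb{R}$. Let $\varepsilon\in{]0,\exp(-2)]}$. Choose $$L=L(\varepsilon)=\left\lceil\frac{2}{\beta-1}\cdot\log_2(z(\varepsilon))\right\rceil\quad\text{with}\quad z(\varepsilon)=1+\varepsilon^{-1}\cdot(\ln(\varepsilon^{-1}))^{-\alpha/2}$$ as well as $$N_\ell=N_\ell(\varepsilon)=\left\lceil 2^{-\ell\beta/2}\cdot\ell^{-\alpha/2}\cdot K(\varepsilon)\right\rceil$$ for $\ell=1,\dots,L$, where $$K(\varepsilon)=\varepsilon^{-\max(2,\beta/(\beta-1))}\cdot\begin{cases}1,&\text{if }\beta>2,\\(\ln(\varepsilon^{-1}))^{\max(0,1-\alpha/2)},&\text{if }\beta=2\wedge\alpha\neq2,\\\ln(\ln(\varepsilon^{-1})),&\text{if }\beta=2\wedge\alpha=2,\\(\ln(\varepsilon^{-1}))^{\frac{\alpha}{2(1-\beta)}},&\text{if }\beta<2.\end{cases}$$ Then the random bit multilevel algorithm $A^{(\varepsilon)}=A^{L,N_1,\dots,N_L}$ satisfies $$e(A^{(\varepsilon)},\mathrm{Lip}_1,\mu)\preceq\varepsilon$$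 and $$\operatorname{cost}(A^{(\varepsilon)},\mathrm{Lip}_1)\asymp\varepsilon^{-\max(2,2/(\beta-1))}\cdot\begin{cases}1,&\text{if }\beta>2,\\(\ln(\varepsilon^{-1}))^{\max(0,2-\alpha)},&\text{if }\beta=2\wedge\alpha\neq2,\\(\ln(\ln(\varepsilon^{-1})))^2,&\text{if }\beta=2\wedge\alpha=2,\\(\ln(\varepsilon^{-1}))^{\frac{\alpha}{1-\beta}},&\text{if }\beta<2,\end{cases}$$ uniformly in $\varepsilon\in{]0,\exp(-2)]}$.
   Context: $\mathbb{N}=\{1,2,\dots\}$. For functions $f,g\colon M\to[0,\infty]$ on a set $M$, $f(m)\preceq g(m)$ means that there is a constant $c>0$ with $f(m)\le c\,g(m)$ for every $m\in M$; $f\asymp g$ means $f\preceq g$ and $g\preceq f$. In the Karhunen-Lo\`eve expansion, $(e_i)_{i\in\mathbb{N}}$ is an orthonormal system in $H$, $(\lambda_i)_{i\in\mathbb{N}}$ is a non-increasing, summable sequence of strictly positive numbers, $Y_1,Y_2,\dots$ are independent standard normal random variables, and the series converges in mean-square with respect to $\|\cdot\|_H$. $\mathrm{Lip}_1$ is the class of all $f\colon H\to\mathbb{R}$ with $|f(x)-f(y)|\le\|x-y\|_H$ for all $x,y\in H$, and $S(f)=\operatorname{E}(f(X))$. The worst case error of a randomized algorithm $A$ with (random) output $A(f)$ is $e(A,\mathrm{Lip}_1,\mu)=\sup_{f\in\mathrm{Lip}_1}(\operatorname{E}|S(f)-A(f)|^2)^{1/2}$. Cost model (variable subspace sampling): let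 $H_n=\operatorname{span}\{e_1,\dots,e_n\}$ for $n\in\mathbb{N}$, $H_0=\emptyset$. Evaluating $f$ at $x\in H_n\setminus H_{n-1}$ costs $n$; arithmetic operations with real numbers are exact and, like evaluations of elementary functions (including $\Phi^{-1}$), have unit cost; each call to the generator for random bits costs one; the numbers $\lambda_i$ are available. $\operatorname{cost}(A,f)$ is the (random) sum of the costs of all instructions carried out on input $f$, and $\operatorname{cost}(A,\mathrm{Lip}_1)=\sup_{f\in\mathrm{Lip}_1}\operatorname{E}(\operatorname{cost}(A,f))$. Random bit approximation: $\Phi$ is the standard normal distribution function; for $p\in\mathbb{N}$ and $x\in[0,1[$, $T^{(p)}(x)=\lfloor 2^p x\rfloor/2^p+2^{-(p+1)}$, with values in $D^{(p)}=\{k2^{-p}-2^{-(p+1)}\colon k=1,\dots,2^p\}$; for a standard normal $Y$, $Y^{(p)}=\Phi^{-1}\circ T^{(p)}\circ\Phi(Y)$. For $m\in\mathbb{N}$ and $\boldsymbol{p}\in\mathbb{N}^m$, $X^{(m,\boldsymbol{p})}=\sum_{i=1}^m\lambda_i^{1/2}Y_i^{(p_i)}e_i$ and $|\boldsymbol{p}|=\sum_{i=1}^mp_i$. For $m\in\mathbb{N}$ let $\boldsymbol{p}(m)\in\mathbb{N}^m$ be given by $p_i(m)=\lceil\max(\tilde p_i(m),1)\rceil$ with $\tilde p_i(m)=\beta\log_2(m/i)+\max(\alpha,0)\log_2(\log_2(m+1)/\log_2(i+1))$, $i=1,\dots,m$. Multilevel algorithm: for $L,N_1,\dots,N_L\in\mathbb{N}$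 let $X_{\ell,j}$, $\ell=1,\dots,L$, $j=1,\dots,N_\ell$, be independent copies of $X$, and let $X_{\ell,j}^{(m,\boldsymbol{p}(m))}$ be obtained from $X_{\ell,j}$ in the same way as $X^{(m,\boldsymbol{p}(m))}$ from $X$. Then $$A^{L,N_1,\dots,N_L}(f)=\frac1{N_1}\sum_{j=1}^{N_1}f(X_{1,j}^{(2,\boldsymbol{p}(2))})+\sum_{\ell=2}^L\frac1{N_\ell}\sum_{j=1}^{N_\ell}\bigl(f(X_{\ell,j}^{(2^\ell,\boldsymbol{p}(2^\ell))})-f(X_{\ell,j}^{(2^{\ell-1},\boldsymbol{p}(2^{\ell-1}))})\bigr).$$ It is implemented as follows: for each $(\ell,j)$, $|\boldsymbol{p}(2^\ell)|$ random bits are used to generate independent $U_i$, uniformly distributed on $D^{(p_i(2^\ell))}$, $i=1,\dots,2^\ell$; the fine approximation is computed as $\sum_{i=1}^{2^\ell}\lambda_i^{1/2}\Phi^{-1}(U_i)e_i$ and, for $\ell\ge2$, the coarse one as $\sum_{i=1}^{2^{\ell-1}}\lambda_i^{1/2}\Phi^{-1}(T^{(p_i(2^{\ell-1}))}(U_i))e_i$. *)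

theory Defs
  imports "HOL-Probability.Probability"
begin

section \<open>Asymptotic comparison of \<open>[0,\<infinity>]\<close>-valued functions\<close>

definition preceq_on :: "'m set \<Rightarrow> ('m \<Rightarrow> ennreal) \<Rightarrow> ('m \<Rightarrow> ennreal) \<Rightarrow> bool" where
  "preceq_on D f g \<longleftrightarrow> (\<exists>c::real. c > 0 \<and> (\<forall>m\<in>D. f m \<le> ennreal c * g m))"

definition order_equiv_on :: "'m set \<Rightarrow> ('m \<Rightarrow> ennreal) \<Rightarrow> ('m \<Rightarrow> ennreal) \<Rightarrow> bool" where
  "order_equiv_on D f g \<longleftrightarrow> preceq_on D f g \<and> preceq_on D g f"


section \<open>Gaussian random elements\<close>

text \<open>One-dimensional projections may be degenerate, i.e. almost surely zero.\<close>

definition centered_gaussian :: "'w measure \<Rightarrow> ('w \<Rightarrow> 'h::{real_inner, polish_space}) \<Rightarrow> bool" where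
  "centered_gaussian M X \<longleftrightarrow> prob_space M \<and> X \<in> borel_measurable M \<and>
     (\<forall>h. (\<exists>\<sigma>>0. distributed M lborel (\<lambda>\<omega>. X \<omega> \<bullet> h) (normal_density 0 \<sigma>)) \<or>
          (AE \<omega> in M. X \<omega> \<bullet> h = 0))"

definition measure_support :: "'h::topological_space measure \<Rightarrow> 'h set" where
  "measure_support \<mu> = {x. \<forall>U. open U \<and> x \<in> U \<longrightarrow> emeasure \<mu> U > 0}"

definition infinite_dimensional_set :: "'h::real_vector set \<Rightarrow> bool" where
  "infinite_dimensional_set A \<longleftrightarrow> (\<nexists>B. finite B \<and> A \<subseteq> span B)"

text \<open>Sequences are indexed by \<open>1, 2, \<dots>\<close>; the values at \<open>0\<close> play no role.\<close>

definition karhunen_loeve ::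
  "'w measure \<Rightarrow> ('w \<Rightarrow> 'h::{real_inner, polish_space}) \<Rightarrow>
   (nat \<Rightarrow> real) \<Rightarrow> (nat \<Rightarrow> 'w \<Rightarrow> real) \<Rightarrow> (nat \<Rightarrow> 'h) \<Rightarrow> bool" where
  "karhunen_loeve M X lam Y e \<longleftrightarrow>
     (\<forall>i\<ge>1. \<forall>j\<ge>1. e i \<bullet> e j = (if i = j then 1 else 0)) \<and>
     (\<forall>i\<ge>1. lam i > 0) \<and> (\<forall>i\<ge>1. lam (Suc i) \<le> lam i) \<and> summable (\<lambda>i. lam (Suc i)) \<and>
     prob_space.indep_vars M (\<lambda>_. borel) Y {1..} \<and>
     (\<forall>i\<ge>1. distributed M lborel (Y i) std_normal_density) \<and>
     (\<lambda>n. \<integral>\<^sup>+\<omega>. ennreal ((norm (X \<omega> - (\<Sum>i=1..n. (sqrt (lam i) * Y i \<omega>) *\<^sub>R e i)))\<^sup>2) \<partial>M)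
       \<longlonglongrightarrow> 0"


section \<open>Random bit approximation\<close>

definition Phi :: "real \<Rightarrow> real" where
  "Phi = cdf std_normal_distribution"

definition Phi_inv :: "real \<Rightarrow> real" where
  "Phi_inv = inv Phi"

definition bit_round :: "nat \<Rightarrow> real \<Rightarrow> real" where
  "bit_round p x = of_int \<lfloor>2 ^ p * x\<rfloor> / 2 ^ p + 1 / 2 ^ (p + 1)"

definition bit_grid :: "nat \<Rightarrow> real set" where
  "bit_grid p = {real k / 2 ^ p - 1 / 2 ^ (p + 1) | k. 1 \<le> k \<and> k \<le> 2 ^ p}"

definition bit_normal :: "nat \<Rightarrow> real \<Rightarrow> real" where
  "bit_normal p y = Phi_inv (bit_round p (Phi y))"

text \<open>The numbers \<open>Y\<^sub>i\<close> are recovered from \<open>X\<close>, up to null sets, as the normalised coordinates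
  of \<open>X\<close> (see \<open>karhunen_loeve_coordinate\<close> below).  In this way the bit approximation is
  a map on \<open>H\<close>, which is applied to \<open>X\<close> and to each of its copies.\<close>

definition coordinate :: "(nat \<Rightarrow> real) \<Rightarrow> (nat \<Rightarrow> 'h::real_inner) \<Rightarrow> 'h \<Rightarrow> nat \<Rightarrow> real" where
  "coordinate lam e x i = (x \<bullet> e i) / sqrt (lam i)"

definition bit_approx ::
  "(nat \<Rightarrow> real) \<Rightarrow> (nat \<Rightarrow> 'h::real_inner) \<Rightarrow> nat \<Rightarrow> (nat \<Rightarrow> nat) \<Rightarrow> 'h \<Rightarrow> 'h" where
  "bit_approx lam e m p x =
     (\<Sum>i=1..m. (sqrt (lam i) * bit_normal (p i) (coordinate lam e x i)) *\<^sub>R e i)"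

definition bit_number :: "real \<Rightarrow> real \<Rightarrow> nat \<Rightarrow> nat \<Rightarrow> nat" where
  "bit_number \<alpha> \<beta> m i =
     nat \<lceil>max (\<beta> * log 2 (real m / real i) +
               max \<alpha> 0 * log 2 (log 2 (real (m + 1)) / log 2 (real (i + 1)))) 1\<rceil>"


section \<open>The multilevel algorithm and its error\<close>

definition multilevel ::
  "(nat \<Rightarrow> real) \<Rightarrow> (nat \<Rightarrow> 'h::real_inner) \<Rightarrow> (nat \<Rightarrow> nat \<Rightarrow> nat) \<Rightarrow> nat \<Rightarrow> (nat \<Rightarrow> nat) \<Rightarrow>
   (nat \<Rightarrow> nat \<Rightarrow> 'v \<Rightarrow> 'h) \<Rightarrow> ('h \<Rightarrow> real) \<Rightarrow> 'v \<Rightarrow> real" where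
  "multilevel lam e p L N Xc f \<omega> =
     1 / real (N 1) * (\<Sum>j=1..N 1. f (bit_approx lam e 2 (p 2) (Xc 1 j \<omega>))) +
     (\<Sum>l=2..L. 1 / real (N l) * (\<Sum>j=1..N l.
        f (bit_approx lam e (2 ^ l) (p (2 ^ l)) (Xc l j \<omega>)) -
        f (bit_approx lam e (2 ^ (l - 1)) (p (2 ^ (l - 1))) (Xc l j \<omega>))))"

text \<open>Independent copies of \<open>X\<close>, indexed by \<open>l, j = 1, 2, \<dots>\<close>, on a further probability space.\<close>

definition independent_copies ::
  "'w measure \<Rightarrow> ('w \<Rightarrow> 'h::{real_inner, polish_space}) \<Rightarrow>
   'v measure \<Rightarrow> (nat \<Rightarrow> nat \<Rightarrow> 'v \<Rightarrow> 'h) \<Rightarrow> bool" where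
  "independent_copies M X P Xc \<longleftrightarrow> prob_space P \<and>
     prob_space.indep_vars P (\<lambda>_. borel) (\<lambda>(l, j). Xc l j) ({1..} \<times> {1..}) \<and>
     (\<forall>l\<ge>1. \<forall>j\<ge>1. distr P borel (Xc l j) = distr M borel X)"

definition Lip1 :: "('h::metric_space \<Rightarrow> real) set" where
  "Lip1 = {f. 1-lipschitz_on UNIV f}"

definition ennsqrt :: "ennreal \<Rightarrow> ennreal" where
  "ennsqrt x = (if x = \<top> then \<top> else ennreal (sqrt (enn2real x)))"

definition worst_case_error ::
  "'v measure \<Rightarrow> ('i \<Rightarrow> 'v \<Rightarrow> real) \<Rightarrow> ('i \<Rightarrow> real) \<Rightarrow> 'i set \<Rightarrow> ennreal" where
  "worst_case_error P A S F =
     (SUP f\<in>F. ennsqrt (\<integral>\<^sup>+\<omega>. ennreal (\<bar>S f - A f \<omega>\<bar>\<^sup>2) \<partial>P))"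


section \<open>Programs and their cost\<close>

text \<open>A program is a tree of instructions.  Each instruction returns a real number, on which the
  remaining instructions may depend; the input \<open>f\<close> is accessible only through \<open>Evaluate\<close>.\<close>

datatype 'h instr =
    Random_bit
  | Add real real
  | Subtract real real
  | Multiply real real
  | Divide real real
  | Floor real
  | Sqrt real
  | Powr real real
  | Quantile real
  | Evaluate 'h

datatype ('h, 'a) prog =
    Return 'a
  | Step "'h instr" "real \<Rightarrow> ('h, 'a) prog"

primrec bind_prog :: "('h, 'a) prog \<Rightarrow> ('a \<Rightarrow> ('h, 'b) prog) \<Rightarrow> ('h, 'b) prog" where
  "bind_prog (Return x) g = g x"
| "bind_prog (Step I k) g = Step I (\<lambda>r. bind_prog (k r) g)"

adhoc_overloading Monad_Syntax.bind \<rightleftharpoons> bind_prog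

definition exec :: "'h instr \<Rightarrow> ('h, real) prog" where
  "exec I = Step I Return"

definition subspace_H :: "(nat \<Rightarrow> 'h::real_vector) \<Rightarrow> nat \<Rightarrow> 'h set" where
  "subspace_H e n = (if n = 0 then {} else span (e ` {1..n}))"

text \<open>The infimum is \<open>n\<close> for \<open>x \<in> H\<^sub>n - H\<^sub>n\<^sub>-\<^sub>1\<close>, and \<open>\<infinity>\<close> if \<open>x\<close> lies in none of the spaces.\<close>

definition eval_cost :: "(nat \<Rightarrow> 'h::real_vector) \<Rightarrow> 'h \<Rightarrow> ennreal" where
  "eval_cost e x = (INF n\<in>{n. x \<in> subspace_H e n}. of_nat n)"

fun instr_cost :: "(nat \<Rightarrow> 'h::real_vector) \<Rightarrow> 'h instr \<Rightarrow> ennreal" where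
  "instr_cost e (Evaluate x) = eval_cost e x"
| "instr_cost e _ = 1"

fun instr_result :: "('h \<Rightarrow> real) \<Rightarrow> 'h instr \<Rightarrow> real pmf" where
  "instr_result f Random_bit = map_pmf of_bool (bernoulli_pmf (1 / 2))"
| "instr_result f (Add x y) = return_pmf (x + y)"
| "instr_result f (Subtract x y) = return_pmf (x - y)"
| "instr_result f (Multiply x y) = return_pmf (x * y)"
| "instr_result f (Divide x y) = return_pmf (x / y)"
| "instr_result f (Floor x) = return_pmf (of_int \<lfloor>x\<rfloor>)"
| "instr_result f (Sqrt x) = return_pmf (sqrt x)"
| "instr_result f (Powr x y) = return_pmf (x powr y)"
| "instr_result f (Quantile u) = return_pmf (Phi_inv u)"
| "instr_result f (Evaluate x) = return_pmf (f x)"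

text \<open>Joint distribution of the output and of the sum of the costs of all executed
  instructions.\<close>

primrec run ::
  "(nat \<Rightarrow> 'h::real_vector) \<Rightarrow> ('h \<Rightarrow> real) \<Rightarrow> ('h, 'a) prog \<Rightarrow> ('a \<times> ennreal) pmf" where
  "run e f (Return x) = return_pmf (x, 0)"
| "run e f (Step I k) =
     bind_pmf (instr_result f I)
       (\<lambda>r. map_pmf (\<lambda>(x, c). (x, instr_cost e I + c)) (run e f (k r)))"

definition out_law :: "(nat \<Rightarrow> 'h::real_vector) \<Rightarrow> ('h \<Rightarrow> real) \<Rightarrow> ('h, 'a) prog \<Rightarrow> 'a pmf" where
  "out_law e f A = map_pmf fst (run e f A)"

definition cost_law ::
  "(nat \<Rightarrow> 'h::real_vector) \<Rightarrow> ('h \<Rightarrow> real) \<Rightarrow> ('h, 'a) prog \<Rightarrow> ennreal pmf" where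
  "cost_law e f A = map_pmf snd (run e f A)"

definition worst_case_cost ::
  "(nat \<Rightarrow> 'h::real_vector) \<Rightarrow> ('h, 'a) prog \<Rightarrow> ('h \<Rightarrow> real) set \<Rightarrow> ennreal" where
  "worst_case_cost e A F = (SUP f\<in>F. \<integral>\<^sup>+c. c \<partial>measure_pmf (cost_law e f A))"


section \<open>Implementation of the multilevel algorithm\<close>

primrec array_prog :: "nat \<Rightarrow> (nat \<Rightarrow> ('h, real) prog) \<Rightarrow> ('h, nat \<Rightarrow> real) prog" where
  "array_prog 0 g = Return (\<lambda>_. 0)"
| "array_prog (Suc n) g =
     do { v \<leftarrow> array_prog n g; x \<leftarrow> g (Suc n); Return (v(Suc n := x)) }"

primrec sum_prog :: "nat \<Rightarrow> (nat \<Rightarrow> ('h, real) prog) \<Rightarrow> ('h, real) prog" where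
  "sum_prog 0 g = Return 0"
| "sum_prog (Suc n) g =
     do { s \<leftarrow> sum_prog n g; x \<leftarrow> g (Suc n); exec (Add s x) }"

text \<open>Uniform distribution on \<open>bit_grid p\<close> from \<open>p\<close> random bits.\<close>

primrec uniform_grid_prog :: "nat \<Rightarrow> ('h, real) prog" where
  "uniform_grid_prog 0 = Return (1 / 2)"
| "uniform_grid_prog (Suc p) =
     do { u \<leftarrow> uniform_grid_prog p; b \<leftarrow> exec Random_bit; v \<leftarrow> exec (Add b u); exec (Divide v 2) }"

definition bit_round_prog :: "nat \<Rightarrow> real \<Rightarrow> ('h, real) prog" where
  "bit_round_prog p u =
     do { q \<leftarrow> exec (Powr 2 (real p)); v \<leftarrow> exec (Multiply q u); k \<leftarrow> exec (Floor v);
          w \<leftarrow> exec (Add k (1 / 2)); exec (Divide w q) }"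

definition coefficient_prog :: "real \<Rightarrow> real \<Rightarrow> ('h, real) prog" where
  "coefficient_prog a u =
     do { s \<leftarrow> exec (Sqrt a); y \<leftarrow> exec (Quantile u); exec (Multiply s y) }"

definition evaluate_prog ::
  "(nat \<Rightarrow> real) \<Rightarrow> (nat \<Rightarrow> 'h::real_vector) \<Rightarrow> nat \<Rightarrow> (nat \<Rightarrow> real) \<Rightarrow> ('h, real) prog" where
  "evaluate_prog lam e m u =
     do { c \<leftarrow> array_prog m (\<lambda>i. coefficient_prog (lam i) (u i));
          exec (Evaluate (\<Sum>i=1..m. c i *\<^sub>R e i)) }"

definition level_prog ::
  "(nat \<Rightarrow> real) \<Rightarrow> (nat \<Rightarrow> 'h::real_vector) \<Rightarrow> (nat \<Rightarrow> nat \<Rightarrow> nat) \<Rightarrow> nat \<Rightarrow> ('h, real) prog" where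
  "level_prog lam e p l =
     do { u \<leftarrow> array_prog (2 ^ l) (\<lambda>i. uniform_grid_prog (p (2 ^ l) i));
          y \<leftarrow> evaluate_prog lam e (2 ^ l) u;
          if l = 1 then Return y
          else do { v \<leftarrow> array_prog (2 ^ (l - 1)) (\<lambda>i. bit_round_prog (p (2 ^ (l - 1)) i) (u i));
                    z \<leftarrow> evaluate_prog lam e (2 ^ (l - 1)) v;
                    exec (Subtract y z) } }"

text \<open>The numbers \<open>L\<close>, \<open>N l\<close>, \<open>p m i\<close> and \<open>lam i\<close> are constants of the program.  For the agreement
  of its output with \<open>multilevel\<close> in distribution, see \<open>multilevel_prog_law\<close> below.\<close>

definition multilevel_prog ::
  "(nat \<Rightarrow> real) \<Rightarrow> (nat \<Rightarrow> 'h::real_vector) \<Rightarrow> (nat \<Rightarrow> nat \<Rightarrow> nat) \<Rightarrow> nat \<Rightarrow> (nat \<Rightarrow> nat) \<Rightarrow>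
   ('h, real) prog" where
  "multilevel_prog lam e p L N =
     sum_prog L (\<lambda>l. do { s \<leftarrow> sum_prog (N l) (\<lambda>j. level_prog lam e p l);
                          exec (Divide s (real (N l))) })"


section \<open>Choice of the parameters\<close>

definition z_eps :: "real \<Rightarrow> real \<Rightarrow> real" where
  "z_eps \<alpha> \<epsilon> = 1 + 1 / \<epsilon> * ln (1 / \<epsilon>) powr (- \<alpha> / 2)"

definition L_eps :: "real \<Rightarrow> real \<Rightarrow> real \<Rightarrow> nat" where
  "L_eps \<alpha> \<beta> \<epsilon> = nat \<lceil>2 / (\<beta> - 1) * log 2 (z_eps \<alpha> \<epsilon>)\<rceil>"

definition K_eps :: "real \<Rightarrow> real \<Rightarrow> real \<Rightarrow> real" where
  "K_eps \<alpha> \<beta> \<epsilon> = \<epsilon> powr (- max 2 (\<beta> / (\<beta> - 1))) *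
     (if \<beta> > 2 then 1
      else if \<beta> = 2 then
        (if \<alpha> \<noteq> 2 then ln (1 / \<epsilon>) powr (max 0 (1 - \<alpha> / 2)) else ln (ln (1 / \<epsilon>)))
      else ln (1 / \<epsilon>) powr (\<alpha> / (2 * (1 - \<beta>))))"

definition N_eps :: "real \<Rightarrow> real \<Rightarrow> real \<Rightarrow> nat \<Rightarrow> nat" where
  "N_eps \<alpha> \<beta> \<epsilon> l =
     nat \<lceil>2 powr (- real l * \<beta> / 2) * real l powr (- \<alpha> / 2) * K_eps \<alpha> \<beta> \<epsilon>\<rceil>"

definition cost_order :: "real \<Rightarrow> real \<Rightarrow> real \<Rightarrow> real" where
  "cost_order \<alpha> \<beta> \<epsilon> = \<epsilon> powr (- max 2 (2 / (\<beta> - 1))) *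
     (if \<beta> > 2 then 1
      else if \<beta> = 2 then
        (if \<alpha> \<noteq> 2 then ln (1 / \<epsilon>) powr (max 0 (2 - \<alpha>)) else (ln (ln (1 / \<epsilon>)))\<^sup>2)
      else ln (1 / \<epsilon>) powr (\<alpha> / (1 - \<beta>)))"

section \<open>The implementation has the law of the multilevel algorithm\<close>

text \<open>The main result is \<open>multilevel_prog_law\<close> at the end: for every input, the output of the program
  has the same distribution as the random variable given by \<open>multilevel\<close>.\<close>

lemma karhunen_loeve_coordinate:
  assumes "prob_space M" and [measurable]: "X \<in> borel_measurable M"
    and KL: "karhunen_loeve M X lam Y e" and i: "i \<ge> 1"
  shows "AE \<omega> in M. coordinate lam e (X \<omega>) i = Y i \<omega>"
proof -
  interpret prob_space M by fact
  have [measurable]: "Y j \<in> borel_measurable M" if "j \<ge> 1" for j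
    using KL that by (auto simp: karhunen_loeve_def distributed_def)
  have [measurable]: "Y i \<in> borel_measurable M" using i by measurable
  have lam: "lam i > 0" using KL i by (auto simp: karhunen_loeve_def)
  have orth: "e j \<bullet> e i = (if j = i then 1 else 0)" if "j \<ge> 1" for j
    using KL i that by (auto simp: karhunen_loeve_def)
  define Z where "Z \<omega> = X \<omega> \<bullet> e i - sqrt (lam i) * Y i \<omega>" for \<omega>
  have [measurable]: "Z \<in> borel_measurable M" unfolding Z_def by measurable
  define a where "a n = (\<integral>\<^sup>+\<omega>. ennreal ((norm (X \<omega> - (\<Sum>i=1..n. (sqrt (lam i) * Y i \<omega>) *\<^sub>R e i)))\<^sup>2) \<partial>M)" for n
  have a: "a \<longlonglongrightarrow> 0" using KL unfolding karhunen_loeve_def a_def by (elim conjE)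
  have le: "(\<integral>\<^sup>+\<omega>. ennreal ((Z \<omega>)\<^sup>2) \<partial>M) \<le> a n" if n: "n \<ge> i" for n
    unfolding a_def
  proof (intro nn_integral_mono ennreal_leI)
    fix \<omega>
    let ?S = "\<Sum>i=1..n. (sqrt (lam i) * Y i \<omega>) *\<^sub>R e i"
    have "?S \<bullet> e i = (\<Sum>j=1..n. (sqrt (lam j) * Y j \<omega>) * (if j = i then 1 else 0))"
      unfolding inner_sum_left by (intro sum.cong) (auto simp: orth)
    also have "\<dots> = (\<Sum>j=1..n. if j = i then sqrt (lam j) * Y j \<omega> else 0)"
      by (intro sum.cong) auto
    also have "\<dots> = sqrt (lam i) * Y i \<omega>" using i n by (subst sum.delta) auto
    finally have "Z \<omega> = (X \<omega> - ?S) \<bullet> e i" by (simp add: Z_def inner_diff_left)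
    moreover have "norm (e i) = 1" using orth[of i] i by (simp add: norm_eq_sqrt_inner)
    ultimately have "\<bar>Z \<omega>\<bar> \<le> norm (X \<omega> - ?S)"
      using Cauchy_Schwarz_ineq2[of "X \<omega> - ?S" "e i"] by simp
    then show "(Z \<omega>)\<^sup>2 \<le> (norm (X \<omega> - ?S))\<^sup>2" by (simp add: abs_le_square_iff[symmetric])
  qed
  have "(\<integral>\<^sup>+\<omega>. ennreal ((Z \<omega>)\<^sup>2) \<partial>M) \<le> 0"
    by (rule LIMSEQ_le_const[OF a]) (use le in blast)
  then have "(\<integral>\<^sup>+\<omega>. ennreal ((Z \<omega>)\<^sup>2) \<partial>M) = 0" by simp
  then have "AE \<omega> in M. ennreal ((Z \<omega>)\<^sup>2) = 0" by (subst (asm) nn_integral_0_iff_AE) auto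
  then show ?thesis
    by eventually_elim (use lam in \<open>auto simp: Z_def coordinate_def field_simps\<close>)
qed

lemma emeasure_std_normal_singleton: "emeasure std_normal_distribution {x} = 0"
  by (subst emeasure_density) (auto intro!: nn_integral_null_set)

lemma Phi_isCont: "isCont Phi x"
proof -
  interpret real_distribution std_normal_distribution by (rule real_dist_normal_dist)
  show ?thesis unfolding Phi_def isCont_cdf using emeasure_std_normal_singleton[of x]
    by (simp add: measure_def)
qed

lemma Phi_mono: "x \<le> y \<Longrightarrow> Phi x \<le> Phi y"
proof -
  interpret real_distribution std_normal_distribution by (rule real_dist_normal_dist)
  show "x \<le> y \<Longrightarrow> Phi x \<le> Phi y" unfolding Phi_def by (rule cdf_nondecreasing)
qed

lemma Phi_less: assumes "x < y" shows "Phi x < Phi y"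
proof -
  interpret real_distribution std_normal_distribution by (rule real_dist_normal_dist)
  have "measure std_normal_distribution {x<..y} \<noteq> 0"
  proof
    assume "measure std_normal_distribution {x<..y} = 0"
    then have "emeasure std_normal_distribution {x<..y} = 0" by (simp add: emeasure_eq_measure)
    then have "(\<integral>\<^sup>+z. ennreal (std_normal_density z) * indicator {x<..y} z \<partial>lborel) = 0"
      by (simp add: emeasure_density)
    then have "AE z in lborel. ennreal (std_normal_density z) * indicator {x<..y} z = 0"
      by (subst (asm) nn_integral_0_iff_AE) auto
    then have "AE z in lborel. z \<notin> {x<..y}"
      by eventually_elim (auto simp: indicator_def normal_density_def split: if_splits)
    then have "emeasure lborel {x<..y} = 0"
      by (subst (asm) AE_iff_measurable[of "{x<..y}"]) auto
    then show False using assms by simp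
  qed
  then have "measure std_normal_distribution {x<..y} > 0" by (simp add: zero_less_measure_iff)
  with cdf_diff_eq[OF assms] show ?thesis by (simp add: Phi_def)
qed

lemma Phi_bounds: "0 < Phi x" "Phi x < 1"
proof -
  interpret real_distribution std_normal_distribution by (rule real_dist_normal_dist)
  have "0 \<le> Phi y" "Phi y \<le> 1" for y by (simp_all add: Phi_def cdf_nonneg cdf_bounded_prob)
  then show "0 < Phi x" "Phi x < 1" using Phi_less[of "x - 1" x] Phi_less[of x "x + 1"]
    by (metis diff_less_eq less_add_one order_le_less_trans, metis less_add_one order_less_le_trans)
qed

lemma Phi_measurable [measurable]: "Phi \<in> borel_measurable borel"
  by (intro borel_measurable_mono monoI Phi_mono)

lemma Phi_range: assumes "0 < t" "t < 1" shows "\<exists>a. Phi a = t"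
proof -
  interpret real_distribution std_normal_distribution by (rule real_dist_normal_dist)
  have 1: "(Phi \<longlongrightarrow> 1) at_top" unfolding Phi_def by (rule cdf_lim_at_top_prob)
  have 0: "(Phi \<longlongrightarrow> 0) at_bot" unfolding Phi_def by (rule cdf_lim_at_bot)
  from order_tendstoD(1)[OF 1 assms(2)] obtain b where b: "Phi b > t"
    by (auto simp: eventually_at_top_linorder)
  from order_tendstoD(2)[OF 0 assms(1)] obtain a where a: "Phi a < t"
    by (auto simp: eventually_at_bot_linorder)
  have "a \<le> b" using a b Phi_mono[of b a] by linarith
  then show ?thesis using IVT[of Phi a t b] a b Phi_isCont by auto
qed

lemma Phi_uniform:
  assumes "prob_space M" and Y: "distributed M lborel Y std_normal_density"
    and t: "0 \<le> t" "t \<le> 1"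
  shows "measure M {\<omega>\<in>space M. Phi (Y \<omega>) < t} = t"
proof -
  interpret prob_space M by fact
  interpret R: real_distribution std_normal_distribution by (rule real_dist_normal_dist)
  have [measurable]: "Y \<in> borel_measurable M" using Y by (auto simp: distributed_def)
  consider "t = 0" | "t = 1" | "0 < t" "t < 1" using t by linarith
  then show ?thesis
  proof cases
    case 1
    then have "{\<omega>\<in>space M. Phi (Y \<omega>) < t} = {}"
      using Phi_bounds(1) by (auto simp: not_less less_imp_le)
    then show ?thesis using 1 by (metis measure_empty)
  next
    case 2 then show ?thesis using Phi_bounds(2) by (auto simp: prob_space)
  next
    case 3
    then obtain a where a: "Phi a = t" using Phi_range by blast
    have "{\<omega>\<in>space M. Phi (Y \<omega>) < t} = Y -` {..<a} \<inter> space M"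
      using Phi_less Phi_mono a by (auto simp: not_less[symmetric]) (metis linorder_not_le)
    then have "measure M {\<omega>\<in>space M. Phi (Y \<omega>) < t} = measure (distr M lborel Y) {..<a}"
      by (simp add: measure_distr)
    also have "distr M lborel Y = std_normal_distribution" using Y by (simp add: distributed_def)
    also have "measure std_normal_distribution {..<a} = measure std_normal_distribution {..a}"
    proof -
      have "{..a} = {..<a} \<union> {a}" by auto
      moreover have "measure std_normal_distribution {a} = 0"
        using emeasure_std_normal_singleton[of a] by (simp add: measure_def)
      ultimately show ?thesis by (subst \<open>{..a} = _\<close>, subst R.finite_measure_Union) auto
    qed
    also have "\<dots> = t" using a by (simp add: Phi_def cdf_def)
    finally show ?thesis .
  qed
qed

definition grid_point :: "nat \<Rightarrow> nat \<Rightarrow> real" where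
  "grid_point p k = (real k + 1 / 2) / 2 ^ p"

lemma bit_grid_eq: "bit_grid p = grid_point p ` {..<2 ^ p}"
proof -
  have "bit_grid p = (\<lambda>k. real k / 2 ^ p - 1 / 2 ^ (p + 1)) ` {1..2 ^ p}"
    by (auto simp: bit_grid_def)
  also have "{1..2 ^ p} = Suc ` {..<2 ^ p}"
    by (simp add: lessThan_atLeast0 image_Suc_atLeastLessThan atLeastLessThanSuc_atLeastAtMost)
  finally show ?thesis unfolding image_image
    by (auto simp: grid_point_def field_simps intro!: image_cong)
qed

lemma inj_grid_point: "inj (grid_point p)"
  by (auto simp: inj_def grid_point_def)

lemma bit_round_Phi_prob:
  assumes M: "prob_space M" and Y: "distributed M lborel Y std_normal_density"
    and x: "x \<in> bit_grid p"
  shows "measure M {\<omega>\<in>space M. bit_round p (Phi (Y \<omega>)) = x} = 1 / 2 ^ p"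
proof -
  interpret prob_space M by fact
  have [measurable]: "Y \<in> borel_measurable M" using Y by (auto simp: distributed_def)
  from x obtain k where k: "k < 2 ^ p" "x = grid_point p k" by (auto simp: bit_grid_eq)
  have kp: "(real k + 1) / 2 ^ p \<le> 1"
  proof -
    have "real (k + 1) \<le> real (2 ^ p)" using k by (subst of_nat_le_iff) auto
    then show ?thesis by simp
  qed
  let ?A = "\<lambda>t. {\<omega>\<in>space M. Phi (Y \<omega>) < t}"
  have "bit_round p u = x \<longleftrightarrow> u < (real k + 1) / 2 ^ p \<and> \<not> u < real k / 2 ^ p" for u
  proof -
    have "bit_round p u = x \<longleftrightarrow> \<lfloor>2 ^ p * u\<rfloor> = int k"
      by (auto simp: bit_round_def k(2) grid_point_def field_simps)
    also have "\<dots> \<longleftrightarrow> real k \<le> 2 ^ p * u \<and> 2 ^ p * u < real k + 1"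
      by (simp add: floor_eq_iff)
    finally show ?thesis by (auto simp: field_simps)
  qed
  then have "{\<omega>\<in>space M. bit_round p (Phi (Y \<omega>)) = x} = ?A ((real k + 1) / 2 ^ p) - ?A (real k / 2 ^ p)"
    by auto
  also have "measure M \<dots> = measure M (?A ((real k + 1) / 2 ^ p)) - measure M (?A (real k / 2 ^ p))"
    by (intro finite_measure_Diff) (auto simp: field_simps intro: less_le_trans)
  also have "measure M (?A ((real k + 1) / 2 ^ p)) = (real k + 1) / 2 ^ p"
    using kp by (intro Phi_uniform M Y) auto
  also have "measure M (?A (real k / 2 ^ p)) = real k / 2 ^ p"
    using k(1) by (intro Phi_uniform M Y) (auto simp: less_imp_le of_nat_le_numeral_power_cancel_iff)
  finally show ?thesis by (simp add: field_simps)
qed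

lemma bit_round_in_grid:
  assumes "0 \<le> u" "u < 1" shows "bit_round p u \<in> bit_grid p"
proof -
  have "0 \<le> 2 ^ p * u" "2 ^ p * u < 2 ^ p" using assms by auto
  then have 1: "0 \<le> \<lfloor>2 ^ p * u\<rfloor>" "\<lfloor>2 ^ p * u\<rfloor> < 2 ^ p"
    by (simp, metis floor_less_iff of_int_numeral of_int_power)
  define k where "k = nat \<lfloor>2 ^ p * u\<rfloor>"
  have "int k < int (2 ^ p)" "of_int \<lfloor>2 ^ p * u\<rfloor> = real k" using 1 by (simp_all add: k_def)
  then have "k < 2 ^ p" "of_int \<lfloor>2 ^ p * u\<rfloor> = real k" by linarith+
  then show ?thesis unfolding bit_grid_eq
    by (intro image_eqI[of _ _ k]) (auto simp: bit_round_def grid_point_def field_simps)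
qed

lemma bit_round_bit_round:
  assumes "q \<le> p" shows "bit_round q (bit_round p u) = bit_round q u"
proof -
  have pq: "(2::real) ^ p = 2 ^ q * 2 ^ (p - q)" using assms by (simp add: power_add[symmetric])
  let ?d = "2 ^ (p - q) :: int"
  have "2 ^ q * bit_round p u = (of_int \<lfloor>2 ^ p * u\<rfloor> + 1 / 2) / of_int ?d"
    by (simp add: bit_round_def pq field_simps)
  then have "\<lfloor>2 ^ q * bit_round p u\<rfloor> = \<lfloor>of_int \<lfloor>2 ^ p * u\<rfloor> + 1 / 2 :: real\<rfloor> div ?d"
    using floor_divide_real_eq_div[of ?d "of_int \<lfloor>2 ^ p * u\<rfloor> + 1 / 2"] by simp
  also have "\<lfloor>of_int \<lfloor>2 ^ p * u\<rfloor> + 1 / 2 :: real\<rfloor> = \<lfloor>2 ^ p * u\<rfloor>" by linarith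
  also have "\<lfloor>2 ^ p * u\<rfloor> div ?d = \<lfloor>2 ^ p * u / of_int ?d\<rfloor>"
    using floor_divide_real_eq_div[of ?d "2 ^ p * u"] by simp
  also have "2 ^ p * u / of_int ?d = 2 ^ q * u" by (simp add: pq)
  finally show ?thesis by (simp add: bit_round_def)
qed

lemma bit_number_mono:
  assumes "\<beta> > 0" "i \<ge> 1" "0 < m" "m \<le> n"
  shows "bit_number \<alpha> \<beta> m i \<le> bit_number \<alpha> \<beta> n i"
proof -
  have "log 2 (real m / real i) \<le> log 2 (real n / real i)"
    using assms by (simp add: divide_right_mono)
  moreover have "log 2 (log 2 (real (m + 1)) / log 2 (real (i + 1))) \<le>
      log 2 (log 2 (real (n + 1)) / log 2 (real (i + 1)))"
  proof -
    have "log 2 (real (m + 1)) > 0" "log 2 (real (i + 1)) > 0"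
      "log 2 (real (m + 1)) \<le> log 2 (real (n + 1))" using assms by auto
    then show ?thesis by (auto simp: divide_right_mono intro!: log_mono)
  qed
  ultimately show ?thesis unfolding bit_number_def using assms
    by (intro nat_mono ceiling_mono max.mono add_mono mult_left_mono) auto
qed

lemma out_law_bind:
  "out_law e f (bind_prog A g) = bind_pmf (out_law e f A) (\<lambda>x. out_law e f (g x))"
proof (induction A)
  case (Return x)
  then show ?case by (simp add: out_law_def bind_return_pmf)
next
  case (Step I k)
  then show ?case
    by (simp add: out_law_def map_bind_pmf bind_assoc_pmf bind_map_pmf pmf.map_comp o_def
        case_prod_beta' cong: bind_pmf_cong)
qed

lemma out_law_Return [simp]: "out_law e f (Return x) = return_pmf x"
  by (simp add: out_law_def)

lemma out_law_exec [simp]: "out_law e f (exec I) = instr_result f I"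
  by (simp add: out_law_def exec_def map_bind_pmf bind_return_pmf')

lemmas out_law_simps = out_law_bind bind_return_pmf

lemma out_law_array_prog:
  "out_law e f (array_prog n g) = Pi_pmf {1..n} 0 (\<lambda>i. out_law e f (g i))"
proof (induction n)
  case 0 then show ?case by simp
next
  case (Suc n)
  have "{1..Suc n} = insert (Suc n) {1..n}" by auto
  then show ?case using Suc
    by (simp add: out_law_simps Pi_pmf_insert' bind_commute_pmf[of "out_law e f (g (Suc n))"])
qed

lemma out_law_bit_round_prog: "out_law e f (bit_round_prog p u) = return_pmf (bit_round p u)"
  by (simp add: bit_round_prog_def out_law_simps bit_round_def powr_realpow field_simps)

lemma out_law_coefficient_prog:
  "out_law e f (coefficient_prog a u) = return_pmf (sqrt a * Phi_inv u)"
  by (simp add: coefficient_prog_def out_law_simps)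

lemma out_law_evaluate_prog:
  "out_law e f (evaluate_prog lam e m u) =
     return_pmf (f (\<Sum>i=1..m. (sqrt (lam i) * Phi_inv (u i)) *\<^sub>R e i))"
  by (auto simp: evaluate_prog_def out_law_simps out_law_array_prog out_law_coefficient_prog
      intro!: arg_cong[where f = f] sum.cong)

lemma out_law_uniform_grid_prog:
  "out_law e f (uniform_grid_prog p) = pmf_of_set (bit_grid p)"
proof -
  have "out_law e f (uniform_grid_prog p) = map_pmf (grid_point p) (pmf_of_set {..<2 ^ p})"
  proof (induction p)
    case 0
    have "{..<1::nat} = {0}" by auto
    then show ?case by (simp add: grid_point_def pmf_of_set_singleton)
  next
    case (Suc p)
    have bij: "bij_betw (\<lambda>(b, k). of_bool b * 2 ^ p + k) (UNIV \<times> {..<2 ^ p}) {..<2 ^ Suc p :: nat}"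
      by (rule bij_betwI[where g = "\<lambda>n. (n \<ge> 2 ^ p, n mod 2 ^ p)"])
         (auto simp: of_bool_def le_mod_geq not_le split: if_splits)
    have "out_law e f (uniform_grid_prog (Suc p)) =
        bind_pmf (pmf_of_set {..<2 ^ p}) (\<lambda>k. bind_pmf (pmf_of_set UNIV) (\<lambda>b.
          return_pmf ((of_bool b + grid_point p k) / 2)))"
      by (simp add: out_law_simps Suc bind_map_pmf bernoulli_pmf_half_conv_pmf_of_set)
    also have "\<dots> = bind_pmf (pmf_of_set UNIV) (\<lambda>b. bind_pmf (pmf_of_set {..<2 ^ p}) (\<lambda>k.
          return_pmf (grid_point (Suc p) (of_bool b * 2 ^ p + k))))"
      by (subst bind_commute_pmf) (intro bind_pmf_cong refl, auto simp: grid_point_def field_simps)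
    also have "\<dots> = map_pmf (grid_point (Suc p)) (map_pmf (\<lambda>(b, k). of_bool b * 2 ^ p + k)
        (pair_pmf (pmf_of_set UNIV) (pmf_of_set {..<2 ^ p})))"
      by (simp add: pair_pmf_def map_pmf_def bind_assoc_pmf bind_return_pmf)
    also have "pair_pmf (pmf_of_set (UNIV::bool set)) (pmf_of_set {..<2 ^ p}) =
        pmf_of_set (UNIV \<times> {..<2 ^ p :: nat})"
    proof (rule pmf_eqI)
      fix z :: "bool \<times> nat"
      have ne: "{..<2 ^ p :: nat} \<noteq> {}" by (metis empty_iff lessThan_iff zero_less_numeral zero_less_power)
      then have ne': "(UNIV::bool set) \<times> {..<2 ^ p :: nat} \<noteq> {}" by blast
      show "pmf (pair_pmf (pmf_of_set UNIV) (pmf_of_set {..<2 ^ p})) z =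
          pmf (pmf_of_set (UNIV \<times> {..<2 ^ p})) z"
        by (cases z) (simp add: pmf_pair pmf_of_set[OF ne] pmf_of_set[OF ne'] card_cartesian_product indicator_def)
    qed
    also have "map_pmf (\<lambda>(b, k). of_bool b * 2 ^ p + k) \<dots> = pmf_of_set {..<2 ^ Suc p}"
    proof (rule map_pmf_of_set_bij_betw[OF bij])
      have "(True, 0::nat) \<in> UNIV \<times> {..<2 ^ p}" by simp
      then show "(UNIV::bool set) \<times> {..<2 ^ p :: nat} \<noteq> {}" by blast
    qed simp
    finally show ?case .
  qed
  also have "\<dots> = pmf_of_set (bit_grid p)" unfolding bit_grid_eq
  proof (rule map_pmf_of_set_inj)
    show "{..<2 ^ p :: nat} \<noteq> {}" by (metis empty_iff lessThan_iff zero_less_numeral zero_less_power)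
  qed (auto intro: inj_on_subset[OF inj_grid_point])
  finally show ?thesis .
qed

lemma distr_array:
  fixes q :: "nat \<Rightarrow> real pmf"
  assumes "prob_space M" and A: "finite A"
    and [measurable]: "\<And>i. i \<in> A \<Longrightarrow> U i \<in> borel_measurable M"
    and R: "\<And>i. i \<in> A \<Longrightarrow> finite (R i)" "\<And>i \<omega>. i \<in> A \<Longrightarrow> \<omega> \<in> space M \<Longrightarrow> U i \<omega> \<in> R i"
      "\<And>i. i \<in> A \<Longrightarrow> set_pmf (q i) \<subseteq> R i"
    and prob: "\<And>v. measure M {\<omega>\<in>space M. \<forall>i\<in>A. U i \<omega> = v i} = (\<Prod>i\<in>A. pmf (q i) (v i))"
  defines "V \<equiv> \<lambda>\<omega> i. if i \<in> A then U i \<omega> else 0"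
  shows "V \<in> measurable M (count_space UNIV)"
    and "distr M (count_space UNIV) V = measure_pmf (Pi_pmf A 0 q)"
proof -
  interpret prob_space M by fact
  define S where "S = PiE_dflt A 0 R"
  have finS: "finite S" unfolding S_def using A R(1) by (intro finite_PiE_dflt) auto
  have VS: "V \<omega> \<in> S" if "\<omega> \<in> space M" for \<omega>
    using R(2) that by (auto simp: V_def S_def PiE_dflt_def)
  have V_eq: "V -` {v} \<inter> space M = {\<omega>\<in>space M. \<forall>i\<in>A. U i \<omega> = v i}" if "v \<in> S" for v
    using that by (auto simp: V_def S_def PiE_dflt_def fun_eq_iff)
  have V_sets: "V -` {v} \<inter> space M \<in> sets M" if "v \<in> S" for v
    unfolding V_eq[OF that] using A by measurable
  show V [measurable]: "V \<in> measurable M (count_space UNIV)"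
  proof (rule measurableI)
    fix B :: "(nat \<Rightarrow> real) set"
    have "V -` B \<inter> space M = (\<Union>v\<in>B \<inter> S. V -` {v} \<inter> space M)" using VS by auto
    also have "\<dots> \<in> sets M" using finS V_sets by (intro sets.finite_UN) auto
    finally show "V -` B \<inter> space M \<in> sets M" .
  qed simp
  show "distr M (count_space UNIV) V = measure_pmf (Pi_pmf A 0 q)"
  proof (rule measure_eqI_countable_AE[where \<Omega> = S])
    show "AE x in distr M (count_space UNIV) V. x \<in> S"
      using VS by (subst AE_distr_iff) auto
    show "AE x in measure_pmf (Pi_pmf A 0 q). x \<in> S"
      using R(3) A by (auto simp: AE_measure_pmf_iff S_def PiE_dflt_def set_Pi_pmf)
    show "countable S" using finS by (rule countable_finite)
    fix v assume v: "v \<in> S"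
    have "emeasure (distr M (count_space UNIV) V) {v} = ennreal (\<Prod>i\<in>A. pmf (q i) (v i))"
      by (simp add: emeasure_distr V_eq[OF v] emeasure_eq_measure prob)
    also have "\<dots> = emeasure (measure_pmf (Pi_pmf A 0 q)) {v}"
      using v A by (auto simp: emeasure_pmf_single S_def PiE_dflt_def pmf_Pi')
    finally show "emeasure (distr M (count_space UNIV) V) {v} = emeasure (measure_pmf (Pi_pmf A 0 q)) {v}" .
  qed simp_all
qed

definition level_value ::
  "(nat \<Rightarrow> real) \<Rightarrow> (nat \<Rightarrow> 'h::real_inner) \<Rightarrow> (nat \<Rightarrow> nat \<Rightarrow> nat) \<Rightarrow> nat \<Rightarrow> ('h \<Rightarrow> real) \<Rightarrow> 'h \<Rightarrow> real" where
  "level_value lam e p l f x = f (bit_approx lam e (2 ^ l) (p (2 ^ l)) x) -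
     (if l = 1 then 0 else f (bit_approx lam e (2 ^ (l - 1)) (p (2 ^ (l - 1))) x))"

lemma multilevel_eq:
  assumes "L \<ge> 1"
  shows "multilevel lam e p L N Xc f \<omega> =
    (\<Sum>l=1..L. (\<Sum>j=1..N l. level_value lam e p l f (Xc l j \<omega>)) / real (N l))"
proof -
  have "{1..L} = insert 1 {2..L}" using assms by auto
  then show ?thesis by (auto simp: multilevel_def level_value_def intro!: sum.cong)
qed

lemma level_value_law:
  fixes \<alpha> \<beta> :: real
  assumes M: "prob_space M" and X [measurable]: "X \<in> borel_measurable M"
    and KL: "karhunen_loeve M X lam Y e" and \<beta>: "\<beta> > 0" and l: "l \<ge> 1"
  defines "p \<equiv> bit_number \<alpha> \<beta>"
  shows "level_value lam e p l f \<in> borel_measurable (distr M borel X)"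
    and "distr (distr M borel X) borel (level_value lam e p l f) =
      distr (measure_pmf (out_law e f (level_prog lam e p l))) borel (\<lambda>x. x)"
proof -
  interpret prob_space M by fact
  let ?\<mu> = "distr M borel X"
  have \<mu>: "prob_space ?\<mu>" by (rule prob_space_distr) simp
  define m where "m = (2::nat) ^ l"
  define U where "U i x = bit_round (p m i) (Phi (coordinate lam e x i))" for i x
  define V where "V x i = (if i \<in> {1..m} then U i x else 0)" for x i
  define q where "q i = pmf_of_set (bit_grid (p m i))" for i
  define h where "h u = f (\<Sum>i=1..m. (sqrt (lam i) * Phi_inv (u i)) *\<^sub>R e i) -
     (if l = 1 then 0 else f (\<Sum>i=1..2^(l-1). (sqrt (lam i) *
        Phi_inv (bit_round (p (2^(l-1)) i) (u i))) *\<^sub>R e i))" for u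
  have coord [measurable]: "(\<lambda>x. coordinate lam e x i) \<in> borel_measurable borel" for i
    unfolding coordinate_def by measurable
  have round [measurable]: "bit_round n \<in> borel_measurable borel" for n
    unfolding bit_round_def by measurable
  have U [measurable]: "U i \<in> borel_measurable borel" for i
    unfolding U_def by measurable
  have Y [measurable]: "Y i \<in> borel_measurable M" and Yd: "distributed M lborel (Y i) std_normal_density"
    if "i \<ge> 1" for i
    using KL that by (auto simp: karhunen_loeve_def distributed_def)
  have gridfin: "finite (bit_grid n)" "bit_grid n \<noteq> {}" "card (bit_grid n) = 2 ^ n" for n
    unfolding bit_grid_eq
    using card_image[OF inj_on_subset[OF inj_grid_point subset_UNIV], of n "{..<2 ^ n}"] by auto
  have Uin: "U i x \<in> bit_grid (p m i)" for i x
    unfolding U_def using Phi_bounds[of "coordinate lam e x i"] by (intro bit_round_in_grid) auto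
  have m1: "1 \<in> {1..m}" "Suc 0 \<le> m" by (simp_all add: m_def Suc_le_eq)
  have prob: "measure ?\<mu> {x\<in>space ?\<mu>. \<forall>i\<in>{1..m}. U i x = v i} = (\<Prod>i\<in>{1..m}. pmf (q i) (v i))" for v
  proof -
    define W where "W i \<omega> = bit_round (p m i) (Phi (Y i \<omega>))" for i \<omega>
    have W [measurable]: "W i \<in> borel_measurable M" if "i \<ge> 1" for i
      unfolding W_def using Y[OF that] by measurable
    have AE: "AE \<omega> in M. \<forall>i\<in>{1..m}. U i (X \<omega>) = W i \<omega>"
    proof (rule AE_finite_allI)
      fix i assume "i \<in> {1..m}"
      then show "AE \<omega> in M. U i (X \<omega>) = W i \<omega>"
        using karhunen_loeve_coordinate[OF M X KL, of i] by (auto simp: U_def W_def elim: eventually_mono)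
    qed simp
    have "measure ?\<mu> {x\<in>space ?\<mu>. \<forall>i\<in>{1..m}. U i x = v i} =
        prob {\<omega>\<in>space M. \<forall>i\<in>{1..m}. U i (X \<omega>) = v i}"
      by (subst measure_distr) (auto intro!: arg_cong[where f = prob])
    also have "\<dots> = prob {\<omega>\<in>space M. \<forall>i\<in>{1..m}. W i \<omega> = v i}"
    proof (rule finite_measure_eq_AE)
      show "AE \<omega> in M. (\<omega> \<in> {\<omega> \<in> space M. \<forall>i\<in>{1..m}. U i (X \<omega>) = v i}) =
          (\<omega> \<in> {\<omega> \<in> space M. \<forall>i\<in>{1..m}. W i \<omega> = v i})"
        using AE by eventually_elim auto
      show "{\<omega> \<in> space M. \<forall>i\<in>{1..m}. W i \<omega> = v i} \<in> events"
        by (intro sets.sets_Collect_finite_All') (use W m1 in auto)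
    qed measurable
    also have "{\<omega>\<in>space M. \<forall>i\<in>{1..m}. W i \<omega> = v i} = (\<Inter>i\<in>{1..m}. W i -` {v i} \<inter> space M)"
      using m1 by force
    also have "prob \<dots> = (\<Prod>i\<in>{1..m}. prob (W i -` {v i} \<inter> space M))"
    proof (rule indep_varsD)
      have "indep_vars (\<lambda>_. borel) Y {1..}" using KL by (simp add: karhunen_loeve_def)
      then show "indep_vars (\<lambda>_. borel) W {1..}"
        unfolding W_def by (rule indep_vars_compose2) measurable
    qed (use m1 in auto)
    also have "\<dots> = (\<Prod>i\<in>{1..m}. pmf (q i) (v i))"
    proof (intro prod.cong refl)
      fix i assume "i \<in> {1..m}"
      then have i: "i \<ge> 1" by simp
      have eq: "W i -` {v i} \<inter> space M = {\<omega>\<in>space M. bit_round (p m i) (Phi (Y i \<omega>)) = v i}"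
        by (auto simp: W_def)
      show "prob (W i -` {v i} \<inter> space M) = pmf (q i) (v i)"
      proof (cases "v i \<in> bit_grid (p m i)")
        case True
        then show ?thesis unfolding eq
          using bit_round_Phi_prob[OF M Yd[OF i] True] gridfin by (simp add: q_def)
      next
        case False
        have "W i -` {v i} \<inter> space M = {}"
          using False bit_round_in_grid[OF less_imp_le[OF Phi_bounds(1)] Phi_bounds(2)]
          by (auto simp: W_def) metis
        then show ?thesis using False gridfin by (simp add: q_def)
      qed
    qed
    finally show ?thesis .
  qed
  have law: "V \<in> measurable ?\<mu> (count_space UNIV)"
      "distr ?\<mu> (count_space UNIV) V = measure_pmf (Pi_pmf {1..m} 0 q)"
    unfolding V_def
    by (rule distr_array[where R = "\<lambda>i. bit_grid (p m i)" and q = q]; use \<mu> Uin gridfin prob in \<open>simp add: q_def\<close>)+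
  note law(1) [measurable]
  have lv: "level_value lam e p l f x = h (V x)" for x
  proof -
    have "(2::nat) ^ (l - 1) \<le> m" by (simp add: m_def)
    then have "bit_round (p (2 ^ (l - 1)) i) (V x i) = bit_round (p (2 ^ (l - 1)) i) (Phi (coordinate lam e x i))"
      if "i \<in> {1..2 ^ (l - 1)}" for i
      using that \<beta> by (auto simp: V_def U_def p_def intro!: bit_round_bit_round bit_number_mono)
    then show ?thesis
      by (auto simp: level_value_def h_def bit_approx_def bit_normal_def V_def U_def m_def
          intro!: arg_cong2[where f = "(-)"] arg_cong[where f = f] sum.cong)
  qed
  have "level_value lam e p l f = h \<circ> V" using lv by auto
  then show "level_value lam e p l f \<in> borel_measurable (distr M borel X)"
    by (auto intro!: measurable_comp[OF law(1)])
  have coarse: "(\<Sum>i=1..2^(l-1). (sqrt (lam i) * Phi_inv (if i \<in> {1..2^(l-1)}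
        then bit_round (p (2^(l-1)) i) (u i) else 0)) *\<^sub>R e i) =
      (\<Sum>i=1..2^(l-1). (sqrt (lam i) * Phi_inv (bit_round (p (2^(l-1)) i) (u i))) *\<^sub>R e i)" for u
    by (intro sum.cong) auto
  have "out_law e f (level_prog lam e p l) = map_pmf h (Pi_pmf {1..m} 0 q)"
    using coarse by (cases "l = 1") (simp_all add: level_prog_def out_law_simps out_law_array_prog out_law_evaluate_prog
        out_law_uniform_grid_prog out_law_bit_round_prog map_pmf_def h_def[abs_def] m_def q_def[abs_def])
  then have "distr (measure_pmf (out_law e f (level_prog lam e p l))) borel (\<lambda>x. x) =
      distr (measure_pmf (Pi_pmf {1..m} 0 q)) borel h"
    by (simp add: map_pmf_rep_eq distr_distr o_def)
  also have "\<dots> = distr ?\<mu> borel (h \<circ> V)"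
    by (subst law(2)[symmetric], subst distr_distr) auto
  finally show "distr (distr M borel X) borel (level_value lam e p l f) =
      distr (measure_pmf (out_law e f (level_prog lam e p l))) borel (\<lambda>x. x)"
    using \<open>level_value lam e p l f = h \<circ> V\<close> by simp
qed

lemma sum_prog_law:
  assumes "prob_space P"
    and ind: "prob_space.indep_vars P (\<lambda>_. borel) R {1..n}"
    and law: "\<And>j. j \<in> {1..n} \<Longrightarrow> distr P borel (R j) = distr (measure_pmf (out_law e f (g j))) borel (\<lambda>x. x)"
  shows "distr P borel (\<lambda>\<omega>. \<Sum>j=1..n. R j \<omega> :: real) =
      distr (measure_pmf (out_law e f (sum_prog n g))) borel (\<lambda>x. x)"
  using ind law
proof (induction n)
  interpret prob_space P by fact
  case 0
  have "distr P borel (\<lambda>_. 0::real) = return borel 0"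
    by (intro measure_eqI) (auto simp: emeasure_distr emeasure_space_1 indicator_def)
  also have "\<dots> = distr (measure_pmf (return_pmf 0)) borel (\<lambda>x. x)"
    by (intro measure_eqI) (auto simp: emeasure_distr)
  finally show ?case by simp
next
  interpret prob_space P by fact
  case (Suc n)
  let ?S = "\<lambda>\<omega>. \<Sum>j=1..n. R j \<omega>"
  let ?q = "out_law e f (sum_prog n g)" and ?d = "out_law e f (g (Suc n))"
  have eq: "{1..Suc n} = insert (Suc n) {1..n}" by auto
  have ind': "indep_vars (\<lambda>_. borel) R {1..n}"
    by (rule indep_vars_subset[OF Suc.prems(1)]) auto
  have IH: "distr P borel ?S = distr (measure_pmf ?q) borel (\<lambda>x. x)"
    by (rule Suc.IH[OF ind']) (auto intro: Suc.prems)
  have R1: "distr P borel (R (Suc n)) = distr (measure_pmf ?d) borel (\<lambda>x. x)"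
    by (rule Suc.prems) auto
  have iv: "indep_var borel (R (Suc n)) borel ?S"
    using Suc.prems(1) unfolding eq by (intro indep_vars_sum) auto
  have [measurable]: "R (Suc n) \<in> borel_measurable P" "?S \<in> borel_measurable P"
    by (fact indep_var_rv1[OF iv], fact indep_var_rv2[OF iv])
  interpret S: prob_space "distr P borel ?S" by (rule prob_space_distr) measurable
  show ?case
  proof (rule measure_eqI)
    fix B assume "B \<in> sets (distr P borel (\<lambda>\<omega>. \<Sum>j=1..Suc n. R j \<omega>))"
    then have [measurable]: "B \<in> sets borel" by simp
    have "emeasure (distr P borel (\<lambda>\<omega>. \<Sum>j=1..Suc n. R j \<omega>)) B =
        (\<integral>\<^sup>+\<omega>. indicator B (?S \<omega> + R (Suc n) \<omega>) \<partial>P)"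
      by (subst nn_integral_indicator[symmetric], simp, subst nn_integral_distr)
         (auto simp del: One_nat_def)
    also have "\<dots> = (\<integral>\<^sup>+z. indicator B (snd z + fst z) \<partial>(distr P (borel \<Otimes>\<^sub>M borel) (\<lambda>\<omega>. (R (Suc n) \<omega>, ?S \<omega>))))"
      by (subst nn_integral_distr) (auto simp del: One_nat_def)
    also have "distr P (borel \<Otimes>\<^sub>M borel) (\<lambda>\<omega>. (R (Suc n) \<omega>, ?S \<omega>)) =
        distr P borel (R (Suc n)) \<Otimes>\<^sub>M distr P borel ?S"
      using iv unfolding indep_var_distribution_eq by simp
    also have "(\<integral>\<^sup>+z. indicator B (snd z + fst z) \<partial>\<dots>) =
        (\<integral>\<^sup>+x. \<integral>\<^sup>+s. indicator B (s + x) \<partial>distr P borel ?S \<partial>distr P borel (R (Suc n)))"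
      by (subst S.nn_integral_fst[symmetric]) (auto simp del: One_nat_def)
    also have "\<dots> = (\<integral>\<^sup>+x. \<integral>\<^sup>+s. indicator B (s + x) \<partial>measure_pmf ?q \<partial>measure_pmf ?d)"
    proof -
      have [measurable]: "(\<lambda>x. \<integral>\<^sup>+s. indicator B (s + x) \<partial>distr P borel ?S) \<in> borel_measurable borel"
        by (rule S.borel_measurable_nn_integral) measurable
      then have "(\<lambda>x. \<integral>\<^sup>+s. indicator B (s + x) \<partial>measure_pmf ?q) \<in> borel_measurable borel"
        unfolding IH by (simp add: nn_integral_distr)
      note this [measurable]
      show ?thesis unfolding IH by (subst R1, subst nn_integral_distr) (simp_all add: nn_integral_distr)
    qed
    also have "\<dots> = emeasure (measure_pmf (out_law e f (sum_prog (Suc n) g))) B"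
      by (simp add: out_law_simps bind_commute_pmf[of ?q] emeasure_bind_pmf indicator_def
          del: measure_pmf.emeasure_eq_measure)
    finally show "emeasure (distr P borel (\<lambda>\<omega>. \<Sum>j=1..Suc n. R j \<omega>)) B =
        emeasure (distr (measure_pmf (out_law e f (sum_prog (Suc n) g))) borel (\<lambda>x. x)) B"
      by (simp add: emeasure_distr)
  qed simp
qed

lemma multilevel_prog_law:
  assumes M: "prob_space M" and X [measurable]: "X \<in> borel_measurable M"
    and KL: "karhunen_loeve M X lam Y e" and copies: "independent_copies M X P Xc"
    and \<beta>: "\<beta> > 0" and L: "L \<ge> 1"
  shows "distr P borel (multilevel lam e (bit_number \<alpha> \<beta>) L N Xc f) =
    distr (measure_pmf (out_law e f (multilevel_prog lam e (bit_number \<alpha> \<beta>) L N))) borel (\<lambda>x. x)"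
proof -
  interpret P: prob_space P using copies by (simp add: independent_copies_def)
  let ?p = "bit_number \<alpha> \<beta>"
  let ?h = "\<lambda>l. level_value lam e ?p l f"
  define I where "I l = {l} \<times> {1..N l}" for l :: nat
  define R where "R l \<omega> = (\<Sum>j=1..N l. ?h l (Xc l j \<omega>)) / real (N l)" for l \<omega>
  have Xc [measurable]: "Xc l j \<in> borel_measurable P" if "l \<ge> 1" "j \<ge> 1" for l j
    using copies that by (auto simp: independent_copies_def P.indep_vars_def)
  have Xd: "distr P borel (Xc l j) = distr M borel X" if "l \<ge> 1" "j \<ge> 1" for l j
    using copies that by (auto simp: independent_copies_def)
  have h [measurable]: "?h l \<in> borel_measurable borel" if "l \<ge> 1" for l
    using level_value_law(1)[OF M X KL \<beta> that] by simp
  have ind0: "P.indep_vars (\<lambda>_. borel) (\<lambda>(l, j). Xc l j) ({1..} \<times> {1..})"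
    using copies by (simp add: independent_copies_def)
  have ind1: "P.indep_vars (\<lambda>_. borel) (\<lambda>z \<omega>. ?h (fst z) (Xc (fst z) (snd z) \<omega>)) ({1..} \<times> {1..})"
    using P.indep_vars_compose2[OF ind0, of "\<lambda>z. ?h (fst z)" "\<lambda>_. borel"] h
    by (auto simp: case_prod_beta')
  have "P.indep_vars (\<lambda>l. PiM (I l) (\<lambda>_. borel))
      (\<lambda>l \<omega>. restrict (\<lambda>z. ?h (fst z) (Xc (fst z) (snd z) \<omega>)) (I l)) {1..L}"
    by (rule P.indep_vars_restrict[OF ind1]) (auto simp: I_def disjoint_family_on_def)
  then have "P.indep_vars (\<lambda>_. borel) (\<lambda>l \<omega>. (\<Sum>j=1..N l.
      restrict (\<lambda>z. ?h (fst z) (Xc (fst z) (snd z) \<omega>)) (I l) (l, j)) / real (N l)) {1..L}"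
    by (rule P.indep_vars_compose2[where Y = "\<lambda>l u. (\<Sum>j=1..N l. u (l, j)) / real (N l)"])
       (auto simp: I_def intro!: borel_measurable_divide borel_measurable_sum measurable_component_singleton)
  then have indR: "P.indep_vars (\<lambda>_. borel) R {1..L}"
    by (simp add: R_def[abs_def] I_def)
  have lawR: "distr P borel (R l) = distr (measure_pmf (out_law e f
      (bind_prog (sum_prog (N l) (\<lambda>j. level_prog lam e ?p l)) (\<lambda>s. exec (Divide s (real (N l))))))) borel (\<lambda>x. x)"
    if l: "l \<in> {1..L}" for l
  proof -
    have l1: "l \<ge> 1" using l by simp
    note [measurable] = h[OF l1]
    have "P.indep_vars (\<lambda>_. borel) (\<lambda>j \<omega>. ?h l (Xc l j \<omega>)) {1..N l}"
    proof -
      have "P.indep_vars (\<lambda>j. PiM {(l, j)} (\<lambda>_. borel))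
          (\<lambda>j \<omega>. restrict (\<lambda>z. ?h (fst z) (Xc (fst z) (snd z) \<omega>)) {(l, j)}) {1..N l}"
        using l by (intro P.indep_vars_restrict[OF ind1]) (auto simp: disjoint_family_on_def)
      then have "P.indep_vars (\<lambda>_. borel)
          (\<lambda>j \<omega>. restrict (\<lambda>z. ?h (fst z) (Xc (fst z) (snd z) \<omega>)) {(l, j)} (l, j)) {1..N l}"
        by (rule P.indep_vars_compose2[where Y = "\<lambda>j u. u (l, j)"])
           (auto intro!: measurable_component_singleton)
      then show ?thesis by simp
    qed
    moreover have "distr P borel (\<lambda>\<omega>. ?h l (Xc l j \<omega>)) =
        distr (measure_pmf (out_law e f (level_prog lam e ?p l))) borel (\<lambda>x. x)" if "j \<in> {1..N l}" for j
    proof -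
      have j: "j \<ge> 1" using that by simp
      have "distr P borel (\<lambda>\<omega>. ?h l (Xc l j \<omega>)) = distr (distr P borel (Xc l j)) borel (?h l)"
        using Xc[OF l1 j] by (subst distr_distr) (auto simp: o_def)
      then show ?thesis using Xd[OF l1 j] level_value_law(2)[OF M X KL \<beta> l1] by simp
    qed
    ultimately have *: "distr P borel (\<lambda>\<omega>. \<Sum>j=1..N l. ?h l (Xc l j \<omega>)) =
        distr (measure_pmf (out_law e f (sum_prog (N l) (\<lambda>j. level_prog lam e ?p l)))) borel (\<lambda>x. x)"
      by (intro sum_prog_law P.prob_space_axioms)
    have [measurable]: "(\<lambda>\<omega>. \<Sum>j=1..N l. ?h l (Xc l j \<omega>)) \<in> borel_measurable P"
      by (intro borel_measurable_sum measurable_compose[OF Xc h]) (use l1 in auto)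
    have "distr P borel (R l) =
        distr (distr P borel (\<lambda>\<omega>. \<Sum>j=1..N l. ?h l (Xc l j \<omega>))) borel (\<lambda>s. s / real (N l))"
      by (subst distr_distr) (auto simp: R_def[abs_def] o_def simp del: One_nat_def)
    then show ?thesis unfolding *
      by (simp add: distr_distr o_def out_law_simps map_pmf_def[symmetric] map_pmf_rep_eq)
  qed
  have "multilevel lam e ?p L N Xc f = (\<lambda>\<omega>. \<Sum>l=1..L. R l \<omega>)"
    using L by (auto simp: multilevel_eq R_def)
  then show ?thesis unfolding multilevel_prog_def
    using sum_prog_law[OF P.prob_space_axioms indR lawR] by simp
qed

end

theory Submission
  imports Defs "HOL-Real_Asymp.Real_Asymp"
begin

text \<open>
  Everything rests on one estimate for the approximation \<open>X\<^sub>l\<close> of \<open>X\<close> with \<open>m = 2\<^sup>l\<close> coordinates and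
  \<open>p\<^sub>i = bit_number \<alpha> \<beta> m i\<close> random bits for the \<open>i\<close>-th one: the mean square of \<open>X - X\<^sub>l\<close> is at most
  a constant times \<open>\<delta>\<^sub>l = 2 powr ((1 - \<beta>) l) * l powr (- \<alpha>)\<close> (\<open>approximation_error\<close>).  The truncation
  error is a tail of the eigenvalue series and is summed over dyadic blocks.  As to the rounding error,
  the mean square error of one normal variable with \<open>p\<close> bits is at most a constant times
  \<open>2 powr (- p)\<close> (\<open>bit_normal_error\<close>), and the bit numbers are such that every
  \<open>\<lambda>\<^sub>i * 2 powr (- p\<^sub>i)\<close> is at most of the order \<open>m powr (- \<beta>) * (ln m) powr (- \<alpha>)\<close>, so that the \<open>m\<close>
  coordinates together give \<open>\<delta>\<^sub>l\<close> again.

  Since \<open>f\<close> is Lipschitz, the squared bias of the algorithm is at most of order \<open>\<delta>\<^sub>L\<close>, and by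
  independence its variance is at most of order \<open>\<Sum>l\<le>L. \<delta>\<^sub>l / N\<^sub>l\<close> (\<open>multilevel_error_le\<close>).  One sample on
  level \<open>l\<close> costs between \<open>2\<^sup>l\<close> and a constant times \<open>2\<^sup>l\<close>, because the bit numbers of a level add up
  to at most a constant times \<open>2\<^sup>l\<close>; hence the cost is of the order \<open>\<Sum>l\<le>L. N\<^sub>l 2\<^sup>l\<close>.

  The sample sizes \<open>N\<^sub>l\<close> are proportional to \<open>(\<delta>\<^sub>l / 2\<^sup>l) powr (1 / 2)\<close>, up to rounding.  With
  \<open>g\<^sub>l = (2\<^sup>l \<delta>\<^sub>l) powr (1 / 2) = 2 powr ((1 - \<beta> / 2) l) * l powr (- \<alpha> / 2)\<close> and \<open>G = \<Sum>l\<le>L. g\<^sub>l\<close>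
  the variance bound is \<open>G / K\<close>, and the cost lies between \<open>K G\<close> and \<open>K G + 2 * 2\<^sup>L\<close>, up to constants.
  The definitions of \<open>L\<close> and \<open>K\<close> give \<open>\<delta>\<^sub>L \<asymp> \<epsilon>\<^sup>2\<close> (\<open>bias_comparable\<close>) and \<open>G \<asymp> \<epsilon>\<^sup>2 K\<close>
  (\<open>level_sum_comparable\<close>), and the claimed order of the cost is \<open>(\<epsilon> K)\<^sup>2\<close> in all cases
  (\<open>cost_order_eq\<close>).  So the error is of order \<open>\<epsilon>\<close> and \<open>K G\<close> has the claimed order.  The term \<open>2\<^sup>L\<close>,
  which stems from rounding up \<open>N\<^sub>l\<close>, does not exceed this order:
  \<open>2\<^sup>L = g\<^sub>L\<^sup>2 / \<delta>\<^sub>L\<close>, where \<open>g\<^sub>L \<le> G\<close>, and \<open>G\<^sup>2 / \<epsilon>\<^sup>2 \<asymp> (\<epsilon> K)\<^sup>2\<close>.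
\<close>

section \<open>Comparability up to constants\<close>

text \<open>Positivity is part of the relation, so that it is closed under products and real powers without
  side conditions.\<close>

definition comparable_on :: "'a set \<Rightarrow> ('a \<Rightarrow> real) \<Rightarrow> ('a \<Rightarrow> real) \<Rightarrow> bool" where
  "comparable_on D f g \<longleftrightarrow>
     (\<exists>C>0. \<forall>x\<in>D. 0 < f x \<and> 0 < g x \<and> f x \<le> C * g x \<and> g x \<le> C * f x)"

text \<open>The bound holds for exponents of either sign, since the ratio of \<open>a\<close> and \<open>b\<close> lies
  in \<open>[1 / c, c]\<close>.\<close>

lemma powr_le_of_ratio:
  fixes a b c r :: real
  assumes "0 < a" "0 < b" "a \<le> c * b" "b \<le> c * a"
  shows "a powr r \<le> c powr \<bar>r\<bar> * b powr r"
proof -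
  have c: "c > 0" using assms by (smt (verit) mult_nonpos_nonneg)
  show ?thesis
  proof (cases "r \<ge> 0")
    case True
    have "a powr r \<le> (c * b) powr r" using assms True by (intro powr_mono2) auto
    then show ?thesis using True by (simp add: powr_mult)
  next
    case False
    have "a powr r \<le> (b / c) powr r" using assms False c
      by (intro powr_mono2') (auto simp: field_simps)
    also have "\<dots> = c powr \<bar>r\<bar> * b powr r" using False c assms
      by (simp add: powr_divide powr_minus_divide)
    finally show ?thesis .
  qed
qed

lemma comparable_onI:
  assumes "\<And>x. x \<in> D \<Longrightarrow> 0 < f x" "\<And>x. x \<in> D \<Longrightarrow> 0 < g x"
    "\<And>x. x \<in> D \<Longrightarrow> f x \<le> A * g x" "\<And>x. x \<in> D \<Longrightarrow> g x \<le> B * f x"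
  shows "comparable_on D f g"
  unfolding comparable_on_def
proof (intro exI[of _ "max 1 (max A B)"] conjI ballI)
  fix x assume x: "x \<in> D"
  have "A * g x \<le> max 1 (max A B) * g x" "B * f x \<le> max 1 (max A B) * f x"
    using assms(1,2)[OF x] by (auto intro!: mult_right_mono)
  then show "f x \<le> max 1 (max A B) * g x" "g x \<le> max 1 (max A B) * f x"
    using assms(3,4)[OF x] by linarith+
qed (use assms in auto)

lemma comparable_on_trans:
  assumes "comparable_on D f g" "comparable_on D g h"
  shows "comparable_on D f h"
proof -
  obtain A where A: "A > 0" "\<And>x. x \<in> D \<Longrightarrow> 0 < f x \<and> 0 < g x \<and> f x \<le> A * g x \<and> g x \<le> A * f x"
    using assms(1) unfolding comparable_on_def by blast
  obtain B where B: "B > 0" "\<And>x. x \<in> D \<Longrightarrow> 0 < g x \<and> 0 < h x \<and> g x \<le> B * h x \<and> h x \<le> B * g x"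
    using assms(2) unfolding comparable_on_def by blast
  show ?thesis
  proof (rule comparable_onI[where A = "A * B" and B = "B * A"])
    fix x assume x: "x \<in> D"
    have "A * g x \<le> A * (B * h x)" "B * g x \<le> B * (A * f x)"
      using A B x by (auto intro!: mult_left_mono)
    then show "f x \<le> A * B * h x" "h x \<le> B * A * f x"
      using A(2)[OF x] B(2)[OF x] by (auto simp: mult.assoc)
  qed (use A B in auto)
qed

lemma comparable_on_mult:
  assumes "comparable_on D f g" "comparable_on D f' g'"
  shows "comparable_on D (\<lambda>x. f x * f' x) (\<lambda>x. g x * g' x)"
proof -
  obtain A where A: "A > 0" "\<And>x. x \<in> D \<Longrightarrow> 0 < f x \<and> 0 < g x \<and> f x \<le> A * g x \<and> g x \<le> A * f x"
    using assms(1) unfolding comparable_on_def by blast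
  obtain B where B: "B > 0" "\<And>x. x \<in> D \<Longrightarrow> 0 < f' x \<and> 0 < g' x \<and> f' x \<le> B * g' x \<and> g' x \<le> B * f' x"
    using assms(2) unfolding comparable_on_def by blast
  show ?thesis
  proof (rule comparable_onI[where A = "A * B" and B = "A * B"])
    fix x assume x: "x \<in> D"
    have "f x * f' x \<le> (A * g x) * (B * g' x)" "g x * g' x \<le> (A * f x) * (B * f' x)"
      using A(2)[OF x] B(2)[OF x] A(1) B(1) by (auto intro!: mult_mono)
    then show "f x * f' x \<le> A * B * (g x * g' x)" "g x * g' x \<le> A * B * (f x * f' x)"
      by (simp_all add: mult_ac)
  qed (use A B in auto)
qed

lemma comparable_on_powr:
  assumes "comparable_on D f g"
  shows "comparable_on D (\<lambda>x. f x powr r) (\<lambda>x. g x powr r)"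
proof -
  obtain A where A: "A > 0" "\<And>x. x \<in> D \<Longrightarrow> 0 < f x \<and> 0 < g x \<and> f x \<le> A * g x \<and> g x \<le> A * f x"
    using assms(1) unfolding comparable_on_def by blast
  show ?thesis
    by (rule comparable_onI[where A = "A powr \<bar>r\<bar>" and B = "A powr \<bar>r\<bar>"])
       (use A(2) in \<open>auto intro!: powr_le_of_ratio\<close>, force+)
qed

lemma comparable_on_compose:
  assumes "comparable_on D f g" "\<And>x. x \<in> E \<Longrightarrow> u x \<in> D"
  shows "comparable_on E (\<lambda>x. f (u x)) (\<lambda>x. g (u x))"
  using assms unfolding comparable_on_def by blast

lemma comparable_on_cong:
  assumes "comparable_on D f g" "\<And>x. x \<in> D \<Longrightarrow> f x = f' x" "\<And>x. x \<in> D \<Longrightarrow> g x = g' x"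
  shows "comparable_on D f' g'"
  using assms unfolding comparable_on_def by simp

text \<open>A positive limit at infinity controls \<open>h\<close> on some ray, and compactness takes care of the rest.
  This turns limits into estimates that are uniform on the whole range of accuracies.\<close>

lemma comparable_on_tendsto:
  fixes h :: "real \<Rightarrow> real"
  assumes cont: "continuous_on {a..} h" and pos: "\<And>x. x \<ge> a \<Longrightarrow> h x > 0"
    and lim: "(h \<longlongrightarrow> l) at_top" and l: "l > 0"
  shows "comparable_on {a..} h (\<lambda>_. 1)"
proof -
  have "\<forall>\<^sub>F x in at_top. h x > l / 2 \<and> h x < 2 * l"
    using order_tendstoD(1)[OF lim, of "l / 2"] order_tendstoD(2)[OF lim, of "2 * l"] l
    by (auto intro: eventually_conj)
  then obtain b where b: "\<And>x. x \<ge> b \<Longrightarrow> h x > l / 2 \<and> h x < 2 * l"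
    by (auto simp: eventually_at_top_linorder)
  \<comment> \<open>the maximum makes the compact interval \<open>{a..b'}\<close> nonempty\<close>
  define b' where "b' = max a b"
  have c: "continuous_on {a..b'} h" by (rule continuous_on_subset[OF cont]) auto
  have ne: "{a..b'} \<noteq> {}" by (simp add: b'_def)
  obtain s where s: "s \<in> {a..b'}" "\<And>x. x \<in> {a..b'} \<Longrightarrow> h x \<le> h s"
    using continuous_attains_sup[OF _ ne c] by auto
  obtain t where t: "t \<in> {a..b'}" "\<And>x. x \<in> {a..b'} \<Longrightarrow> h t \<le> h x"
    using continuous_attains_inf[OF _ ne c] by auto
  define m where "m = min (h t) (l / 2)"
  have m: "m > 0" using pos[of t] t l by (simp add: m_def)
  have hm: "m \<le> h x \<and> h x \<le> max (h s) (2 * l)" if "x \<ge> a" for x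
  proof (cases "x \<le> b'")
    case True
    then show ?thesis using s(2)[of x] t(2)[of x] that by (auto simp: m_def)
  next
    case False
    then have "l / 2 < h x \<and> h x < 2 * l" using b[of x] by (simp add: b'_def)
    then show ?thesis unfolding m_def by linarith
  qed
  show ?thesis
    by (rule comparable_onI[where A = "max (h s) (2 * l)" and B = "1 / m"])
       (use hm m pos in \<open>auto simp: field_simps\<close>)
qed

section \<open>Sums over the levels\<close>

text \<open>A shift of the level by \<open>d\<close> changes powers of the level only by a power of \<open>d + 1\<close>,
  because \<open>l + d \<le> (d + 1) l\<close>.  Such a factor is absorbed by any geometric decay in \<open>d\<close>.\<close>

lemma powr_shift_le:
  fixes l d :: nat and r :: real
  assumes "l \<ge> 1"
  shows "real (l + d) powr r \<le> real (Suc d) powr \<bar>r\<bar> * real l powr r"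
    and "real l powr r \<le> real (Suc d) powr \<bar>r\<bar> * real (l + d) powr r"
proof -
  have "l + d \<le> Suc d * l" using assms by (cases l) auto
  then have 1: "real (l + d) \<le> real (Suc d) * real l" by (metis of_nat_le_iff of_nat_mult)
  have "l \<le> Suc d * (l + d)" by auto
  then have 2: "real l \<le> real (Suc d) * real (l + d)" by (metis of_nat_le_iff of_nat_mult)
  show "real (l + d) powr r \<le> real (Suc d) powr \<bar>r\<bar> * real l powr r"
    and "real l powr r \<le> real (Suc d) powr \<bar>r\<bar> * real (l + d) powr r"
    by (rule powr_le_of_ratio; use assms 1 2 in simp)+
qed

lemma summable_geometric_powr:
  fixes s r :: real
  assumes "s < 0"
  shows "summable (\<lambda>k::nat. 2 powr (s * real k) * real (Suc k) powr r)"
proof -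
  define q :: real where "q = 2 powr (s / 2)"
  have q: "0 < q" "q < 1" using assms by (auto simp: q_def powr_less_one)
  have "summable (\<lambda>k. q ^ (2 * k) * real (Suc k) powr r)"
  proof (rule summable_comparison_test_bigo)
    show "summable (\<lambda>k. norm (q ^ k))" using q by (simp add: summable_geometric)
    show "(\<lambda>k. q ^ (2 * k) * real (Suc k) powr r) \<in> O(\<lambda>k. q ^ k)" using q by real_asymp
  qed
  moreover have "q ^ (2 * k) = 2 powr (s * real k)" for k
    by (simp add: q_def powr_powr flip: powr_realpow)
  ultimately show ?thesis by simp
qed

text \<open>With \<open>s = 1 - \<beta> / 2\<close> and \<open>r = - \<alpha> / 2\<close> this sum governs the multilevel algorithm: up to constants
  and rounding, \<open>K\<close> times the sum is the cost, and the sum divided by \<open>K\<close> bounds the variance.\<close>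

definition level_sum :: "real \<Rightarrow> real \<Rightarrow> nat \<Rightarrow> real" where
  "level_sum s r L = (\<Sum>l=1..L. 2 powr (s * real l) * real l powr r)"

lemma level_sum_last_le:
  assumes "L \<ge> 1" shows "2 powr (s * real L) * real L powr r \<le> level_sum s r L"
  unfolding level_sum_def using assms by (intro member_le_sum) auto

lemma level_sum_first_le:
  assumes "L \<ge> 1" shows "2 powr s \<le> level_sum s r L"
proof -
  have "2 powr (s * real 1) * real 1 powr r \<le> level_sum s r L"
    unfolding level_sum_def using assms by (intro member_le_sum) auto
  then show ?thesis by simp
qed

lemma level_sum_pos: "L \<ge> 1 \<Longrightarrow> level_sum s r L > 0"
  using level_sum_first_le[of L s r] by (smt (verit) powr_gt_zero)

text \<open>For \<open>s > 0\<close> the last level dominates: backwards from \<open>L\<close> the summands decay geometrically.\<close>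

lemma level_sum_growing:
  assumes s: "s > 0"
  shows "comparable_on {1..} (level_sum s r) (\<lambda>L. 2 powr (s * real L) * real L powr r)"
proof (rule comparable_onI[where B = 1 and A = "\<Sum>k. 2 powr (- s * real k) * real (Suc k) powr \<bar>r\<bar>"])
  fix L :: nat assume "L \<in> {1..}"
  then have L: "L \<ge> 1" by simp
  show "0 < level_sum s r L" by (rule level_sum_pos[OF L])
  show "0 < 2 powr (s * real L) * real L powr r" using L by simp
  show "2 powr (s * real L) * real L powr r \<le> 1 * level_sum s r L"
    using level_sum_last_le[OF L] by simp
  let ?t = "\<lambda>k. 2 powr (- s * real k) * real (Suc k) powr \<bar>r\<bar>"
  have "level_sum s r L = (\<Sum>k<L. 2 powr (s * real (L - k)) * real (L - k) powr r)"
    unfolding level_sum_def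
    by (rule sum.reindex_bij_witness[of _ "\<lambda>k. L - k" "\<lambda>l. L - l"]) auto
  also have "\<dots> \<le> (\<Sum>k<L. ?t k * (2 powr (s * real L) * real L powr r))"
  proof (rule sum_mono)
    fix k assume "k \<in> {..<L}"
    then have k: "k < L" by simp
    have "real (L - k) powr r \<le> real (Suc k) powr \<bar>r\<bar> * real L powr r"
      using powr_shift_le(2)[of "L - k" r k] k by simp
    moreover have "2 powr (s * real (L - k)) = 2 powr (- s * real k) * 2 powr (s * real L)"
      using k by (simp add: powr_add[symmetric] of_nat_diff algebra_simps)
    ultimately show "2 powr (s * real (L - k)) * real (L - k) powr r
        \<le> ?t k * (2 powr (s * real L) * real L powr r)"
      by (simp add: mult_ac mult_left_mono)
  qed
  also have "\<dots> = (\<Sum>k<L. ?t k) * (2 powr (s * real L) * real L powr r)"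
    by (simp add: sum_distrib_right)
  also have "\<dots> \<le> (\<Sum>k. ?t k) * (2 powr (s * real L) * real L powr r)"
    using summable_geometric_powr[of "- s"] s
    by (intro mult_right_mono sum_le_suminf) auto
  finally show "level_sum s r L \<le> (\<Sum>k. ?t k) * (2 powr (s * real L) * real L powr r)" .
qed

lemma level_sum_bounded:
  assumes "summable (\<lambda>k. 2 powr (s * real (Suc k)) * real (Suc k) powr r)"
  shows "comparable_on {1..} (level_sum s r) (\<lambda>_. 1)"
proof (rule comparable_onI[where B = "2 powr (- s)"
      and A = "\<Sum>k. 2 powr (s * real (Suc k)) * real (Suc k) powr r"])
  fix L :: nat assume "L \<in> {1..}"
  then have L: "L \<ge> 1" by simp
  show "0 < level_sum s r L" by (rule level_sum_pos[OF L])
  have "2 powr (- s) * 2 powr s \<le> 2 powr (- s) * level_sum s r L"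
    using level_sum_first_le[OF L] by (intro mult_left_mono) auto
  then show "1 \<le> 2 powr (- s) * level_sum s r L" by (simp add: powr_add[symmetric])
  have "level_sum s r L = (\<Sum>k<L. 2 powr (s * real (Suc k)) * real (Suc k) powr r)"
    unfolding level_sum_def
    by (rule sum.reindex_bij_witness[of _ Suc "\<lambda>l. l - 1"]) auto
  also have "\<dots> \<le> (\<Sum>k. 2 powr (s * real (Suc k)) * real (Suc k) powr r)"
    using assms by (intro sum_le_suminf) auto
  finally show "level_sum s r L \<le> (\<Sum>k. 2 powr (s * real (Suc k)) * real (Suc k) powr r) * 1" by simp
qed auto

lemma level_sum_decaying:
  assumes "s < 0" shows "comparable_on {1..} (level_sum s r) (\<lambda>_. 1)"
proof (rule level_sum_bounded)
  have "summable (\<lambda>k. 2 powr s * (2 powr (s * real k) * real (Suc k) powr r))"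
    by (rule summable_mult[OF summable_geometric_powr[OF assms]])
  then show "summable (\<lambda>k. 2 powr (s * real (Suc k)) * real (Suc k) powr r)"
    by (simp add: algebra_simps powr_add)
qed

lemma level_sum_zeta:
  assumes "r < -1" shows "comparable_on {1..} (level_sum 0 r) (\<lambda>_. 1)"
proof (rule level_sum_bounded)
  have "summable (\<lambda>k. real k powr r)" using assms by (simp add: summable_real_powr_iff)
  then show "summable (\<lambda>k. 2 powr (0 * real (Suc k)) * real (Suc k) powr r)"
    by (subst (asm) summable_Suc_iff[symmetric]) simp
qed

text \<open>By the mean value theorem the summand \<open>l powr r\<close> is comparable to the increment
  of \<open>l powr (r + 1)\<close>, and the increments telescope.\<close>

lemma level_sum_power:
  assumes r: "r > -1" shows "comparable_on {1..} (level_sum 0 r) (\<lambda>L. real L powr (r + 1))"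
proof -
  define C where "C = 2 powr \<bar>r\<bar> * max (r + 1) (1 / (r + 1)) + 1"
  have C: "C \<ge> 2 powr \<bar>r\<bar> * (r + 1)" "C \<ge> 2 powr \<bar>r\<bar> / (r + 1)" "C \<ge> 1"
  proof -
    have "2 powr \<bar>r\<bar> * (r + 1) \<le> 2 powr \<bar>r\<bar> * max (r + 1) (1 / (r + 1))"
      "2 powr \<bar>r\<bar> * (1 / (r + 1)) \<le> 2 powr \<bar>r\<bar> * max (r + 1) (1 / (r + 1))"
      by (intro mult_left_mono; simp)+
    moreover have "2 powr \<bar>r\<bar> * max (r + 1) (1 / (r + 1)) \<ge> 0" using r by (simp add: le_max_iff_disj)
    ultimately show "C \<ge> 2 powr \<bar>r\<bar> * (r + 1)" "C \<ge> 2 powr \<bar>r\<bar> / (r + 1)" "C \<ge> 1"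
      unfolding C_def by (simp_all only: mult_1_right times_divide_eq_right)
  qed
  have inc: "real (Suc k) powr r \<le> C * (real (Suc k) powr (r + 1) - real k powr (r + 1)) \<and>
      real (Suc k) powr (r + 1) - real k powr (r + 1) \<le> C * real (Suc k) powr r" for k :: nat
  proof (cases "k = 0")
    case True then show ?thesis using C by simp
  next
    case False
    then have k: "k \<ge> 1" by simp
    obtain \<xi> where \<xi>: "real k < \<xi>" "\<xi> < real (Suc k)"
      "real (Suc k) powr (r + 1) - real k powr (r + 1) = (real (Suc k) - real k) * ((r + 1) * \<xi> powr r)"
    proof (rule MVT2[of "real k" "real (Suc k)" "\<lambda>x. x powr (r + 1)" "\<lambda>x. (r + 1) * x powr r", THEN exE])
      fix x :: real assume "real k \<le> x"
      then have "x > 0" using k by linarith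
      then show "((\<lambda>x. x powr (r + 1)) has_real_derivative (r + 1) * x powr r) (at x)"
        by (auto intro!: derivative_eq_intros)
    qed (auto intro: that)
    have "\<xi> \<le> 2 * real (Suc k)" "real (Suc k) \<le> 2 * \<xi>" "\<xi> > 0" using \<xi>(1,2) k by auto
    then have le: "real (Suc k) powr r \<le> 2 powr \<bar>r\<bar> * \<xi> powr r" "\<xi> powr r \<le> 2 powr \<bar>r\<bar> * real (Suc k) powr r"
      by (auto intro!: powr_le_of_ratio)
    have 1: "real (Suc k) powr r \<le> (2 powr \<bar>r\<bar> / (r + 1)) * ((r + 1) * \<xi> powr r)"
      using le r by simp
    have 2: "(r + 1) * \<xi> powr r \<le> (2 powr \<bar>r\<bar> * (r + 1)) * real (Suc k) powr r"
      using mult_left_mono[OF le(2), of "r + 1"] r by (simp add: mult_ac)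
    have "(2 powr \<bar>r\<bar> / (r + 1)) * ((r + 1) * \<xi> powr r) \<le> C * ((r + 1) * \<xi> powr r)"
      "(2 powr \<bar>r\<bar> * (r + 1)) * real (Suc k) powr r \<le> C * real (Suc k) powr r"
      using C r by (intro mult_right_mono; simp)+
    note 3 = order_trans[OF 1 this(1)] order_trans[OF 2 this(2)]
    have "real (Suc k) powr (r + 1) - real k powr (r + 1) = (r + 1) * \<xi> powr r"
      using \<xi>(3) by simp
    then show ?thesis using 3 by (simp only: conj_absorb)
  qed
  have eq: "level_sum 0 r L = (\<Sum>k<L. real (Suc k) powr r)" for L
    unfolding level_sum_def
    by (rule sum.reindex_bij_witness[of _ Suc "\<lambda>l. l - 1"]) auto
  have tele: "(\<Sum>k<L. real (Suc k) powr (r + 1) - real k powr (r + 1)) = real L powr (r + 1)" for L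
    by (subst sum_lessThan_telescope) simp
  show ?thesis
  proof (rule comparable_onI[where A = C and B = C])
    fix L :: nat assume L: "L \<in> {1..}"
    then show "0 < level_sum 0 r L" "0 < real L powr (r + 1)" using level_sum_pos by auto
    have "level_sum 0 r L \<le> C * (\<Sum>k<L. real (Suc k) powr (r + 1) - real k powr (r + 1))"
      unfolding eq sum_distrib_left using inc by (intro sum_mono) blast
    then show "level_sum 0 r L \<le> C * real L powr (r + 1)" by (simp only: tele)
    have "(\<Sum>k<L. real (Suc k) powr (r + 1) - real k powr (r + 1)) \<le> C * level_sum 0 r L"
      unfolding eq sum_distrib_left using inc by (intro sum_mono) blast
    then show "real L powr (r + 1) \<le> C * level_sum 0 r L" by (simp only: tele)
  qed
qed

lemma level_sum_harmonic: "comparable_on {1..} (level_sum 0 (-1)) (\<lambda>L. ln (1 + real L))"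
proof (rule comparable_onI[where B = 1 and A = 3])
  fix L :: nat assume "L \<in> {1..}"
  then have L: "L \<ge> 1" by simp
  have eq: "level_sum 0 (-1) L = harm L"
    unfolding level_sum_def harm_def by (intro sum.cong) (auto simp: powr_minus)
  show "0 < level_sum 0 (-1) L" using level_sum_pos[OF L] .
  show pos: "0 < ln (1 + real L)" using L by simp
  show "ln (1 + real L) \<le> 1 * level_sum 0 (-1) L" using ln_le_harm[of L] by (simp add: eq add.commute)
  have "harm L \<le> ln (real L) + (1::real)"
    using decseqD[OF decseq_harm_diff_ln, of 0 "L - 1"] L by (simp add: harm_expand)
  moreover have "ln (real L) \<le> ln (1 + real L)" using L by simp
  moreover have "1 \<le> 2 * ln (1 + real L)"
  proof -
    have "ln 2 \<le> ln (1 + real L)" using L by simp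
    then show ?thesis using ln2_ge_two_thirds by linarith
  qed
  ultimately show "level_sum 0 (-1) L \<le> 3 * ln (1 + real L)" unfolding eq by linarith
qed

section \<open>Asymptotics of the parameters\<close>

abbreviation accuracies :: "real set" where "accuracies \<equiv> {0<..exp (- 2)}"

text \<open>Up to a constant factor, \<open>weight \<alpha> \<epsilon> powr (2 / (\<beta> - 1))\<close> is the number \<open>2\<^sup>L\<close> of coordinates on the
  finest level (\<open>powr_L_eps_comparable\<close>).\<close>

definition weight :: "real \<Rightarrow> real \<Rightarrow> real" where
  "weight \<alpha> \<epsilon> = 1 / \<epsilon> * ln (1 / \<epsilon>) powr (- \<alpha> / 2)"

lemma ln_inverse_ge: assumes "\<epsilon> \<in> accuracies" shows "ln (1 / \<epsilon>) \<ge> 2" "\<epsilon> = exp (- ln (1 / \<epsilon>))" 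
proof -
  have e: "0 < \<epsilon>" "\<epsilon> \<le> exp (- 2)" using assms by auto
  then have "ln \<epsilon> \<le> ln (exp (- 2))" by (subst ln_le_cancel_iff) auto
  then show "ln (1 / \<epsilon>) \<ge> 2" using e by (simp add: ln_div)
  show "\<epsilon> = exp (- ln (1 / \<epsilon>))" using e by (simp add: ln_div)
qed

lemma ln_inverse_pos: assumes "\<epsilon> \<in> accuracies" shows "ln (1 / \<epsilon>) powr r > 0"
  using ln_inverse_ge(1)[OF assms] by (metis not_numeral_le_zero powr_gt_zero)

lemma weight_pos: assumes "\<epsilon> \<in> accuracies" shows "weight \<alpha> \<epsilon> > 0"
  using assms ln_inverse_pos[OF assms] by (auto simp: weight_def simp del: powr_gt_zero)

lemma z_eps_eq: "z_eps \<alpha> \<epsilon> = 1 + weight \<alpha> \<epsilon>"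
  by (simp add: z_eps_def weight_def)

lemma comparable_on_accuracies:
  assumes "comparable_on {2..} f g"
  shows "comparable_on accuracies (\<lambda>\<epsilon>. f (ln (1 / \<epsilon>))) (\<lambda>\<epsilon>. g (ln (1 / \<epsilon>)))"
  by (rule comparable_on_compose[OF assms]) (use ln_inverse_ge in auto)

lemma z_eps_comparable: "comparable_on accuracies (z_eps \<alpha>) (weight \<alpha>)"
proof -
  have "comparable_on {2..} (\<lambda>x. 1 + exp (- x) * x powr (\<alpha> / 2)) (\<lambda>_. 1)"
  proof (rule comparable_on_tendsto[where l = 1])
    show "continuous_on {2..} (\<lambda>x. 1 + exp (- x) * x powr (\<alpha> / 2))"
      by (intro continuous_intros) auto
    show "((\<lambda>x. 1 + exp (- x) * x powr (\<alpha> / 2)) \<longlongrightarrow> 1) at_top" by real_asymp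
  qed (auto intro: add_pos_nonneg)
  then have "comparable_on accuracies (\<lambda>\<epsilon>. 1 + exp (- ln (1 / \<epsilon>)) * ln (1 / \<epsilon>) powr (\<alpha> / 2)) (\<lambda>_. 1)"
    by (rule comparable_on_accuracies)
  moreover have "comparable_on accuracies (weight \<alpha>) (weight \<alpha>)"
  proof (rule comparable_onI[where A = 1 and B = 1])
    fix \<epsilon> :: real assume "\<epsilon> \<in> accuracies"
    then show "0 < weight \<alpha> \<epsilon>" by (rule weight_pos)
    then show "0 < weight \<alpha> \<epsilon>" .
  qed auto
  ultimately have "comparable_on accuracies
      (\<lambda>\<epsilon>. (1 + exp (- ln (1 / \<epsilon>)) * ln (1 / \<epsilon>) powr (\<alpha> / 2)) * weight \<alpha> \<epsilon>) (\<lambda>\<epsilon>. 1 * weight \<alpha> \<epsilon>)"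
    by (rule comparable_on_mult)
  then show ?thesis
  proof (rule comparable_on_cong)
    fix \<epsilon> :: real assume "\<epsilon> \<in> accuracies"
    note e = ln_inverse_ge[OF this]
    have "\<epsilon> > 0" using \<open>\<epsilon> \<in> accuracies\<close> by simp
    have "ln (1 / \<epsilon>) powr (\<alpha> / 2) * ln (1 / \<epsilon>) powr (- \<alpha> / 2) = 1"
      using e by (simp add: powr_add[symmetric])
    then have "(1 + \<epsilon> * ln (1 / \<epsilon>) powr (\<alpha> / 2)) * weight \<alpha> \<epsilon> = z_eps \<alpha> \<epsilon>"
      using \<open>\<epsilon> > 0\<close> by (simp add: weight_def z_eps_def algebra_simps)
    then show "(1 + exp (- ln (1 / \<epsilon>)) * ln (1 / \<epsilon>) powr (\<alpha> / 2)) * weight \<alpha> \<epsilon> = z_eps \<alpha> \<epsilon>"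
      using e by simp
  qed simp
qed

lemma L_eps_bounds:
  assumes "\<beta> > 1" "\<epsilon> \<in> accuracies"
  shows "2 / (\<beta> - 1) * log 2 (z_eps \<alpha> \<epsilon>) \<le> real (L_eps \<alpha> \<beta> \<epsilon>)"
    and "real (L_eps \<alpha> \<beta> \<epsilon>) \<le> 2 / (\<beta> - 1) * log 2 (z_eps \<alpha> \<epsilon>) + 1"
    and "L_eps \<alpha> \<beta> \<epsilon> \<ge> 1"
proof -
  have "z_eps \<alpha> \<epsilon> > 1" using weight_pos[OF assms(2)] by (simp add: z_eps_eq)
  then have pos: "2 / (\<beta> - 1) * log 2 (z_eps \<alpha> \<epsilon>) > 0" using assms by auto
  then show "2 / (\<beta> - 1) * log 2 (z_eps \<alpha> \<epsilon>) \<le> real (L_eps \<alpha> \<beta> \<epsilon>)"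
    and "real (L_eps \<alpha> \<beta> \<epsilon>) \<le> 2 / (\<beta> - 1) * log 2 (z_eps \<alpha> \<epsilon>) + 1"
    unfolding L_eps_def by linarith+
  then show "L_eps \<alpha> \<beta> \<epsilon> \<ge> 1" using pos by linarith
qed

lemma powr_L_eps_comparable:
  assumes "\<beta> > 1"
  shows "comparable_on accuracies (\<lambda>\<epsilon>. 2 powr (r * real (L_eps \<alpha> \<beta> \<epsilon>)))
           (\<lambda>\<epsilon>. weight \<alpha> \<epsilon> powr (2 * r / (\<beta> - 1)))"
proof -
  have "comparable_on accuracies (\<lambda>\<epsilon>. 2 powr real (L_eps \<alpha> \<beta> \<epsilon>)) (\<lambda>\<epsilon>. z_eps \<alpha> \<epsilon> powr (2 / (\<beta> - 1)))"
  proof (rule comparable_onI[where A = 2 and B = 1])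
    fix \<epsilon> :: real assume e: "\<epsilon> \<in> accuracies"
    have z: "z_eps \<alpha> \<epsilon> > 1" using weight_pos[OF e] by (simp add: z_eps_eq)
    then show "0 < z_eps \<alpha> \<epsilon> powr (2 / (\<beta> - 1))" by simp
    have eq: "2 powr (2 / (\<beta> - 1) * log 2 (z_eps \<alpha> \<epsilon>)) = z_eps \<alpha> \<epsilon> powr (2 / (\<beta> - 1))"
    proof -
      have "2 powr (log 2 (z_eps \<alpha> \<epsilon>) * (2 / (\<beta> - 1))) = (2 powr log 2 (z_eps \<alpha> \<epsilon>)) powr (2 / (\<beta> - 1))"
        by (simp only: powr_powr)
      also have "2 powr log 2 (z_eps \<alpha> \<epsilon>) = z_eps \<alpha> \<epsilon>" using z by simp
      finally show ?thesis by (simp only: mult.commute)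
    qed
    show "z_eps \<alpha> \<epsilon> powr (2 / (\<beta> - 1)) \<le> 1 * 2 powr real (L_eps \<alpha> \<beta> \<epsilon>)"
      unfolding eq[symmetric] using L_eps_bounds(1)[OF assms e] by simp
    have "2 powr real (L_eps \<alpha> \<beta> \<epsilon>) \<le> 2 powr (2 / (\<beta> - 1) * log 2 (z_eps \<alpha> \<epsilon>) + 1)"
      using L_eps_bounds(2)[OF assms e] by simp
    then show "2 powr real (L_eps \<alpha> \<beta> \<epsilon>) \<le> 2 * z_eps \<alpha> \<epsilon> powr (2 / (\<beta> - 1))"
      by (simp only: powr_add eq) simp
  qed auto
  also note comparable_on_powr[OF z_eps_comparable]
  finally (comparable_on_trans)
  have "comparable_on accuracies (\<lambda>\<epsilon>. (2 powr real (L_eps \<alpha> \<beta> \<epsilon>)) powr r)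
      (\<lambda>\<epsilon>. (weight \<alpha> \<epsilon> powr (2 / (\<beta> - 1))) powr r)"
    by (rule comparable_on_powr)
  then show ?thesis by (simp add: powr_powr mult.commute)
qed

text \<open>The number of levels is logarithmic in the accuracy; the factor
  \<open>ln (1 / \<epsilon>) powr (- \<alpha> / 2)\<close> in \<open>z_eps\<close> only contributes a lower order term to \<open>log 2 (z_eps \<alpha> \<epsilon>)\<close>.\<close>

lemma L_eps_comparable:
  assumes "\<beta> > 1"
  shows "comparable_on accuracies (\<lambda>\<epsilon>. real (L_eps \<alpha> \<beta> \<epsilon>)) (\<lambda>\<epsilon>. ln (1 / \<epsilon>))"
proof -
  have pos: "1 < 1 + exp x * x powr (- \<alpha> / 2)" if "x \<ge> 2" for x :: real
    using that by auto
  have "comparable_on {2..} (\<lambda>x. ln (1 + exp x * x powr (- \<alpha> / 2)) / x) (\<lambda>_. 1)"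
  proof (rule comparable_on_tendsto[where l = 1])
    show "continuous_on {2..} (\<lambda>x. ln (1 + exp x * x powr (- \<alpha> / 2)) / x)"
      using pos by (intro continuous_intros ballI) (force dest: pos)+
    show "((\<lambda>x. ln (1 + exp x * x powr (- \<alpha> / 2)) / x) \<longlongrightarrow> 1) at_top" by real_asymp
    show "0 < ln (1 + exp x * x powr (- \<alpha> / 2)) / x" if "x \<ge> 2" for x :: real
      using pos[OF that] that by (intro divide_pos_pos) (simp_all add: ln_gt_zero)
  qed auto
  from comparable_on_accuracies[OF this]
  obtain C where C: "C > 0" "\<And>\<epsilon>. \<epsilon> \<in> accuracies \<Longrightarrow>
      0 < ln (z_eps \<alpha> \<epsilon>) / ln (1 / \<epsilon>) \<and> ln (z_eps \<alpha> \<epsilon>) / ln (1 / \<epsilon>) \<le> C \<and> 1 \<le> C * (ln (z_eps \<alpha> \<epsilon>) / ln (1 / \<epsilon>))"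
    unfolding comparable_on_def z_eps_def by (auto simp: exp_minus[symmetric] simp flip: exp_minus)
  define k where "k = 2 / ((\<beta> - 1) * ln 2)"
  have k: "k > 0" "2 / (\<beta> - 1) * log 2 z = k * ln z" for z
    using assms by (auto simp: k_def log_def)
  show ?thesis
  proof (rule comparable_onI[where A = "k * C + 1" and B = "C / k"])
    fix \<epsilon> :: real assume e: "\<epsilon> \<in> accuracies"
    have x: "ln (1 / \<epsilon>) \<ge> 2" using ln_inverse_ge[OF e] by simp
    have z: "ln (z_eps \<alpha> \<epsilon>) \<le> C * ln (1 / \<epsilon>)" "ln (1 / \<epsilon>) \<le> C * ln (z_eps \<alpha> \<epsilon>)"
      using C(2)[OF e] x by (auto simp: field_simps)
    note L = L_eps_bounds[OF assms e, unfolded k(2)]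
    show "0 < real (L_eps \<alpha> \<beta> \<epsilon>)" using L(3)[of \<alpha>] by simp
    show "0 < ln (1 / \<epsilon>)" using x by simp
    have "real (L_eps \<alpha> \<beta> \<epsilon>) \<le> k * (C * ln (1 / \<epsilon>)) + ln (1 / \<epsilon>)"
      using L(2)[of \<alpha>] mult_left_mono[OF z(1), of k] k(1) x by linarith
    then show "real (L_eps \<alpha> \<beta> \<epsilon>) \<le> (k * C + 1) * ln (1 / \<epsilon>)" by (simp add: algebra_simps)
    have "ln (1 / \<epsilon>) \<le> C / k * (k * ln (z_eps \<alpha> \<epsilon>))" using z(2) k(1) by simp
    also have "\<dots> \<le> C / k * real (L_eps \<alpha> \<beta> \<epsilon>)"
      using L(1)[of \<alpha>] k(1) C(1) by (intro mult_left_mono) auto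
    finally show "ln (1 / \<epsilon>) \<le> C / k * real (L_eps \<alpha> \<beta> \<epsilon>)" .
  qed
qed

text \<open>The number of levels is chosen such that the order of the squared bias on the finest level is
  exactly \<open>\<epsilon>\<^sup>2\<close>: the logarithmic factor in \<open>z_eps\<close> compensates \<open>L powr (- \<alpha>)\<close>.\<close>

lemma bias_comparable:
  assumes "\<beta> > 1"
  shows "comparable_on accuracies
    (\<lambda>\<epsilon>. 2 powr ((1 - \<beta>) * real (L_eps \<alpha> \<beta> \<epsilon>)) * real (L_eps \<alpha> \<beta> \<epsilon>) powr (- \<alpha>)) (\<lambda>\<epsilon>. \<epsilon>\<^sup>2)"
proof -
  have "comparable_on accuracies
      (\<lambda>\<epsilon>. 2 powr ((1 - \<beta>) * real (L_eps \<alpha> \<beta> \<epsilon>)) * real (L_eps \<alpha> \<beta> \<epsilon>) powr (- \<alpha>))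
      (\<lambda>\<epsilon>. weight \<alpha> \<epsilon> powr (2 * (1 - \<beta>) / (\<beta> - 1)) * ln (1 / \<epsilon>) powr (- \<alpha>))"
    by (intro comparable_on_mult powr_L_eps_comparable comparable_on_powr L_eps_comparable assms)
  then show ?thesis
  proof (rule comparable_on_cong)
    fix \<epsilon> :: real assume e: "\<epsilon> \<in> accuracies"
    have ee: "\<epsilon> > 0" using e by simp
    note x = ln_inverse_ge[OF e]
    have "2 * (1 - \<beta>) / (\<beta> - 1) = - 2" using assms by (simp add: field_simps)
    moreover have "weight \<alpha> \<epsilon> powr (- 2) = \<epsilon>\<^sup>2 * ln (1 / \<epsilon>) powr \<alpha>"
      using x ee by (simp add: weight_def powr_mult powr_divide powr_powr powr_minus_divide powr_numeral)
    ultimately show "weight \<alpha> \<epsilon> powr (2 * (1 - \<beta>) / (\<beta> - 1)) * ln (1 / \<epsilon>) powr (- \<alpha>) = \<epsilon>\<^sup>2"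
      using x by (simp add: powr_add[symmetric])
  qed simp
qed

lemma K_eps_pos:
  assumes "\<epsilon> \<in> accuracies" shows "K_eps \<alpha> \<beta> \<epsilon> > 0"
proof -
  have e: "\<epsilon> powr r > 0" for r using assms by simp
  have l: "ln (ln (1 / \<epsilon>)) > 0" using ln_inverse_ge(1)[OF assms] by (intro ln_gt_zero) linarith
  note p = e ln_inverse_pos[OF assms] l
  show ?thesis unfolding K_eps_def
    by (intro mult_pos_pos e) (simp add: p del: powr_gt_zero)
qed

text \<open>All cases in the order of the cost come from those in \<open>K_eps\<close>; this identity makes further
  case distinctions superfluous.\<close>

lemma cost_order_eq:
  assumes "\<beta> > 1" "\<epsilon> \<in> accuracies"
  shows "cost_order \<alpha> \<beta> \<epsilon> = (\<epsilon> * K_eps \<alpha> \<beta> \<epsilon>)\<^sup>2"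
proof -
  note x = ln_inverse_ge[OF assms(2)]
  have e: "\<epsilon> > 0" using assms by simp
  have sq: "(a powr r)\<^sup>2 = a powr (2 * r)" for a r :: real
    by (simp add: power2_eq_square powr_add[symmetric])
  have e1: "\<epsilon> * \<epsilon> powr r = \<epsilon> powr (1 + r)" for r using e by (simp add: powr_add)
  consider "\<beta> > 2" | "\<beta> = 2" | "\<beta> < 2" by linarith
  then show ?thesis
  proof cases
    case 1
    then have "max 2 (\<beta> / (\<beta> - 1)) = 2" "max 2 (2 / (\<beta> - 1)) = 2"
      using assms by (auto simp: field_simps max_def)
    moreover have "\<epsilon> powr (- 2) = 1 / \<epsilon>\<^sup>2" using e by (simp add: powr_minus_divide powr_numeral)
    ultimately show ?thesis using 1 e by (simp add: K_eps_def cost_order_def power2_eq_square)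
  next
    case 2
    moreover have "\<epsilon> powr (- 2) = 1 / \<epsilon>\<^sup>2" using e by (simp add: powr_minus_divide powr_numeral)
    moreover have "(ln (1 / \<epsilon>) powr max 0 (1 - \<alpha> / 2))\<^sup>2 = ln (1 / \<epsilon>) powr max 0 (2 - \<alpha>)"
      unfolding sq by (simp add: max_def)
    ultimately show ?thesis using e
      by (auto simp: K_eps_def cost_order_def power_mult_distrib power_divide)
         (simp_all add: power2_eq_square power4_eq_xxxx)
  next
    case 3
    then have *: "max 2 (\<beta> / (\<beta> - 1)) = \<beta> / (\<beta> - 1)" "max 2 (2 / (\<beta> - 1)) = 2 / (\<beta> - 1)"
      using assms by (auto simp: field_simps max_def)
    have "2 * (1 - \<beta> / (\<beta> - 1)) = - (2 / (\<beta> - 1))" using assms by (simp add: field_simps)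
    moreover have "2 * (\<alpha> / (2 * (1 - \<beta>))) = \<alpha> / (1 - \<beta>)" using assms by (simp add: field_simps)
    ultimately show ?thesis using 3
      unfolding K_eps_def cost_order_def * mult.assoc[symmetric] e1 power_mult_distrib
      by (simp add: e1 sq)
  qed
qed

lemma ln_comparable_of_comparable:
  assumes "comparable_on D f g" and f: "\<And>x. x \<in> D \<Longrightarrow> f x \<ge> 1" and g: "\<And>x. x \<in> D \<Longrightarrow> g x \<ge> 2"
  shows "comparable_on D (\<lambda>x. ln (1 + f x)) (\<lambda>x. ln (g x))"
proof -
  obtain A where A: "A > 0" "\<And>x. x \<in> D \<Longrightarrow> 0 < f x \<and> 0 < g x \<and> f x \<le> A * g x \<and> g x \<le> A * f x"
    using assms(1) unfolding comparable_on_def by blast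
  define A' where "A' = max 1 A"
  have A': "A' \<ge> 1" "A' \<ge> A" by (auto simp: A'_def)
  show ?thesis
  proof (rule comparable_onI[where A = "ln (2 * A') / ln 2 + 1" and B = "ln A' / ln 2 + 1"])
    fix x assume x: "x \<in> D"
    note A2 = A(2)[OF x] and f = f[OF x] and g = g[OF x]
    show "0 < ln (1 + f x)" "0 < ln (g x)" using f g by auto
    have l2: "ln 2 \<le> ln (1 + f x)" "ln 2 \<le> ln (g x)" using f g by auto
    have "A * g x \<le> A' * g x" "A * f x \<le> A' * f x" using A' A2 by (auto intro!: mult_right_mono)
    moreover have "1 * g x \<le> A' * g x" using A' A2 by (intro mult_right_mono) auto
    moreover have "A' * f x \<le> A' * (1 + f x)" using A' by (intro mult_left_mono) auto
    ultimately have le: "1 + f x \<le> (2 * A') * g x" "g x \<le> A' * (1 + f x)" using A2 g by linarith+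
    have "ln (1 + f x) \<le> ln ((2 * A') * g x)" using le A2 by (intro ln_mono) auto
    also have "\<dots> = ln (2 * A') / ln 2 * ln 2 + ln (g x)" using A' A2 by (subst ln_mult) auto
    also have "\<dots> \<le> ln (2 * A') / ln 2 * ln (g x) + ln (g x)"
      using l2 A' by (intro add_right_mono mult_left_mono) auto
    finally show "ln (1 + f x) \<le> (ln (2 * A') / ln 2 + 1) * ln (g x)" by (simp add: algebra_simps)
    have "ln (g x) \<le> ln (A' * (1 + f x))" using le A2 by (intro ln_mono) auto
    also have "\<dots> = ln A' / ln 2 * ln 2 + ln (1 + f x)" using A' A2 by (subst ln_mult) auto
    also have "\<dots> \<le> ln A' / ln 2 * ln (1 + f x) + ln (1 + f x)"
      using l2 A' by (intro add_right_mono mult_left_mono) auto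
    finally show "ln (g x) \<le> (ln A' / ln 2 + 1) * ln (1 + f x)" by (simp add: algebra_simps)
  qed
qed

text \<open>The cases of \<open>K_eps\<close> reflect the behaviour of the sum over the levels: bounded for \<open>\<beta> > 2\<close>,
  dominated by the last level for \<open>\<beta> < 2\<close>, and for \<open>\<beta> = 2\<close> a sum of powers, which is
  polynomial, logarithmic or bounded in \<open>L\<close>, according to \<open>\<alpha>\<close>.\<close>

lemma level_sum_comparable:
  assumes "\<beta> > 1"
  shows "comparable_on accuracies (\<lambda>\<epsilon>. level_sum (1 - \<beta> / 2) (- \<alpha> / 2) (L_eps \<alpha> \<beta> \<epsilon>))
    (\<lambda>\<epsilon>. \<epsilon>\<^sup>2 * K_eps \<alpha> \<beta> \<epsilon>)"
proof -
  have L1: "L_eps \<alpha> \<beta> \<epsilon> \<in> {1..}" if "\<epsilon> \<in> accuracies" for \<epsilon>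
    using L_eps_bounds(3)[OF assms that] by simp
  have cancel: "\<epsilon>\<^sup>2 * (\<epsilon> powr (- 2) * y) = y" if "\<epsilon> \<in> accuracies" for \<epsilon> y :: real
    using that by (simp add: powr_minus_divide powr_numeral)
  note LC = L_eps_comparable[OF assms, of \<alpha>]
  have *: "comparable_on accuracies (\<lambda>\<epsilon>. level_sum (1 - \<beta> / 2) (- \<alpha> / 2) (L_eps \<alpha> \<beta> \<epsilon>)) (\<lambda>\<epsilon>. g (L_eps \<alpha> \<beta> \<epsilon>))"
    if "comparable_on {1..} (level_sum (1 - \<beta> / 2) (- \<alpha> / 2)) g" for g
    by (rule comparable_on_compose[OF that L1])
  consider "\<beta> > 2" | "\<beta> = 2" "\<alpha> < 2" | "\<beta> = 2" "\<alpha> = 2" | "\<beta> = 2" "\<alpha> > 2" | "\<beta> < 2" by linarith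
  then show ?thesis
  proof cases
    case 1
    then have m: "max 2 (\<beta> / (\<beta> - 1)) = 2" using assms by (auto simp: field_simps max_def)
    show ?thesis
      by (rule comparable_on_cong[OF *[OF level_sum_decaying]])
         (use 1 cancel in \<open>auto simp: K_eps_def m\<close>)
  next
    case 2
    have "comparable_on {1..} (level_sum (1 - \<beta> / 2) (- \<alpha> / 2)) (\<lambda>L. real L powr (- \<alpha> / 2 + 1))"
      using level_sum_power[of "- \<alpha> / 2"] 2 by simp
    from comparable_on_trans[OF *[OF this] comparable_on_powr[OF LC]]
    show ?thesis
      by (rule comparable_on_cong) (use 2 cancel in \<open>auto simp: K_eps_def algebra_simps\<close>)
  next
    case 3
    have "comparable_on {1..} (level_sum (1 - \<beta> / 2) (- \<alpha> / 2)) (\<lambda>L. ln (1 + real L))"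
      using level_sum_harmonic 3 by simp
    note *[OF this]
    also have "comparable_on accuracies (\<lambda>\<epsilon>. ln (1 + real (L_eps \<alpha> \<beta> \<epsilon>))) (\<lambda>\<epsilon>. ln (ln (1 / \<epsilon>)))"
      by (rule ln_comparable_of_comparable[OF LC]) (use L1 ln_inverse_ge in \<open>auto simp: Suc_le_eq\<close>)
    finally (comparable_on_trans) show ?thesis
      by (rule comparable_on_cong) (use 3 cancel in \<open>auto simp: K_eps_def\<close>)
  next
    case 4
    have "comparable_on {1..} (level_sum (1 - \<beta> / 2) (- \<alpha> / 2)) (\<lambda>_. 1)"
      using level_sum_zeta[of "- \<alpha> / 2"] 4 by simp
    then show ?thesis
      by (rule comparable_on_cong[OF *]) (use 4 cancel ln_inverse_ge in \<open>force simp: K_eps_def\<close>)+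
  next
    case 5
    then have m: "max 2 (\<beta> / (\<beta> - 1)) = \<beta> / (\<beta> - 1)" using assms by (auto simp: field_simps max_def)
    have "1 - \<beta> / 2 > 0" using 5 by simp
    note *[OF level_sum_growing[OF this]]
    also have "comparable_on accuracies
        (\<lambda>\<epsilon>. 2 powr ((1 - \<beta> / 2) * real (L_eps \<alpha> \<beta> \<epsilon>)) * real (L_eps \<alpha> \<beta> \<epsilon>) powr (- \<alpha> / 2))
        (\<lambda>\<epsilon>. weight \<alpha> \<epsilon> powr (2 * (1 - \<beta> / 2) / (\<beta> - 1)) * ln (1 / \<epsilon>) powr (- \<alpha> / 2))"
      by (intro comparable_on_mult powr_L_eps_comparable comparable_on_powr L_eps_comparable assms)
    finally (comparable_on_trans) show ?thesis
    proof (rule comparable_on_cong)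
      fix \<epsilon> :: real assume e: "\<epsilon> \<in> accuracies"
      have ee: "\<epsilon> > 0" using e by simp
      note x = ln_inverse_ge[OF e]
      let ?r = "2 * (1 - \<beta> / 2) / (\<beta> - 1)"
      have r: "?r = \<beta> / (\<beta> - 1) - 2" using assms by (simp add: field_simps)
      have "weight \<alpha> \<epsilon> powr ?r * ln (1 / \<epsilon>) powr (- \<alpha> / 2) =
          \<epsilon> powr (- ?r) * ln (1 / \<epsilon>) powr (- \<alpha> / 2 * ?r - \<alpha> / 2)"
      proof -
        have "weight \<alpha> \<epsilon> powr ?r = (1 / \<epsilon>) powr ?r * ln (1 / \<epsilon>) powr (- \<alpha> / 2 * ?r)"
          by (simp only: weight_def powr_mult powr_powr)
        moreover have "(1 / \<epsilon>) powr ?r = \<epsilon> powr (- ?r)"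
          using ee by (simp add: powr_divide powr_minus_divide)
        moreover have "ln (1 / \<epsilon>) powr (- \<alpha> / 2 * ?r - \<alpha> / 2) =
            ln (1 / \<epsilon>) powr (- \<alpha> / 2 * ?r) * ln (1 / \<epsilon>) powr (- \<alpha> / 2)"
          by (simp only: powr_add[symmetric]) simp
        ultimately show ?thesis by (simp only: mult.assoc)
      qed
      also have "- \<alpha> / 2 * ?r - \<alpha> / 2 = \<alpha> / (2 * (1 - \<beta>))"
        using assms by (simp add: field_simps)
      also have "\<epsilon> powr (- ?r) = \<epsilon>\<^sup>2 * \<epsilon> powr (- (\<beta> / (\<beta> - 1)))"
        using ee unfolding r by (simp add: powr_diff powr_minus_divide powr_numeral)
      finally show "weight \<alpha> \<epsilon> powr ?r * ln (1 / \<epsilon>) powr (- \<alpha> / 2) = \<epsilon>\<^sup>2 * K_eps \<alpha> \<beta> \<epsilon>"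
        using 5 by (simp add: K_eps_def m)
    qed simp
  qed
qed

text \<open>The last summand \<open>g\<close> of the level sum satisfies \<open>g\<^sup>2 = 2\<^sup>L * b\<close>, where \<open>b \<asymp> \<epsilon>\<^sup>2\<close> is the squared
  bias.  Hence \<open>2\<^sup>L \<preceq> g\<^sup>2 / \<epsilon>\<^sup>2 \<preceq> (\<epsilon>\<^sup>2 K)\<^sup>2 / \<epsilon>\<^sup>2 = (\<epsilon> K)\<^sup>2\<close>.\<close>

lemma two_power_L_eps_le:
  assumes "\<beta> > 1"
  shows "\<exists>C>0. \<forall>\<epsilon>\<in>accuracies. 2 ^ L_eps \<alpha> \<beta> \<epsilon> \<le> C * cost_order \<alpha> \<beta> \<epsilon>"
proof -
  obtain A where A: "A > 0" "\<And>\<epsilon>. \<epsilon> \<in> accuracies \<Longrightarrow>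
      level_sum (1 - \<beta> / 2) (- \<alpha> / 2) (L_eps \<alpha> \<beta> \<epsilon>) \<le> A * (\<epsilon>\<^sup>2 * K_eps \<alpha> \<beta> \<epsilon>)"
    using level_sum_comparable[OF assms, of \<alpha>] unfolding comparable_on_def by blast
  obtain B where B: "B > 0" "\<And>\<epsilon>. \<epsilon> \<in> accuracies \<Longrightarrow>
      \<epsilon>\<^sup>2 \<le> B * (2 powr ((1 - \<beta>) * real (L_eps \<alpha> \<beta> \<epsilon>)) * real (L_eps \<alpha> \<beta> \<epsilon>) powr (- \<alpha>))"
    using bias_comparable[OF assms, of \<alpha>] unfolding comparable_on_def by blast
  show ?thesis
  proof (intro exI[of _ "A\<^sup>2 * B"] conjI ballI)
    fix \<epsilon> :: real assume e: "\<epsilon> \<in> accuracies"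
    let ?L = "L_eps \<alpha> \<beta> \<epsilon>" and ?K = "K_eps \<alpha> \<beta> \<epsilon>"
    have ee: "\<epsilon> > 0" using e by simp
    have L: "?L \<ge> 1" by (rule L_eps_bounds(3)[OF assms e])
    let ?b = "2 powr ((1 - \<beta>) * real ?L) * real ?L powr (- \<alpha>)"
    let ?g = "2 powr ((1 - \<beta> / 2) * real ?L) * real ?L powr (- \<alpha> / 2)"
    have bpos: "?b > 0" using L by simp
    have sq: "(a powr r)\<^sup>2 = a powr (2 * r)" for a r :: real
      by (simp add: power2_eq_square powr_add[symmetric])
    have "?g\<^sup>2 = 2 powr (2 * ((1 - \<beta> / 2) * real ?L)) * real ?L powr (- \<alpha>)"
      by (simp add: power_mult_distrib sq)
    also have "2 powr (2 * ((1 - \<beta> / 2) * real ?L)) = 2 powr real ?L * 2 powr ((1 - \<beta>) * real ?L)"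
      by (simp add: powr_add[symmetric] algebra_simps)
    finally have g2: "?g\<^sup>2 = 2 ^ ?L * ?b" by (simp add: powr_realpow)
    have "?g \<le> A * (\<epsilon>\<^sup>2 * ?K)" using level_sum_last_le[OF L] A(2)[OF e] by (rule order_trans)
    then have "?g\<^sup>2 \<le> (A * (\<epsilon>\<^sup>2 * ?K))\<^sup>2" by (intro power_mono) auto
    also have "\<dots> = A\<^sup>2 * cost_order \<alpha> \<beta> \<epsilon> * \<epsilon>\<^sup>2"
      by (simp add: cost_order_eq[OF assms e] power2_eq_square algebra_simps)
    also have "\<dots> \<le> A\<^sup>2 * cost_order \<alpha> \<beta> \<epsilon> * (B * ?b)"
      using B(2)[OF e] by (intro mult_left_mono) (auto simp: cost_order_eq[OF assms e])
    finally have "2 ^ ?L * ?b \<le> (A\<^sup>2 * B * cost_order \<alpha> \<beta> \<epsilon>) * ?b" unfolding g2 by (simp add: mult_ac)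
    then show "2 ^ ?L \<le> A\<^sup>2 * B * cost_order \<alpha> \<beta> \<epsilon>"
      using bpos by (rule mult_right_le_imp_le)
  qed (use A B in auto)
qed

lemma N_eps_bounds:
  assumes "\<epsilon> \<in> accuracies"
  shows "2 powr (- real l * \<beta> / 2) * real l powr (- \<alpha> / 2) * K_eps \<alpha> \<beta> \<epsilon> \<le> real (N_eps \<alpha> \<beta> \<epsilon> l)"
    and "real (N_eps \<alpha> \<beta> \<epsilon> l) \<le> 2 powr (- real l * \<beta> / 2) * real l powr (- \<alpha> / 2) * K_eps \<alpha> \<beta> \<epsilon> + 1"
    and "l \<ge> 1 \<Longrightarrow> N_eps \<alpha> \<beta> \<epsilon> l \<ge> 1"
proof -
  let ?x = "2 powr (- real l * \<beta> / 2) * real l powr (- \<alpha> / 2) * K_eps \<alpha> \<beta> \<epsilon>"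
  have K: "K_eps \<alpha> \<beta> \<epsilon> > 0" by (rule K_eps_pos[OF assms])
  then have "?x \<ge> 0" by simp
  then show "?x \<le> real (N_eps \<alpha> \<beta> \<epsilon> l)" "real (N_eps \<alpha> \<beta> \<epsilon> l) \<le> ?x + 1"
    unfolding N_eps_def by linarith+
  assume "l \<ge> 1"
  then have "?x > 0" using K by simp
  then show "N_eps \<alpha> \<beta> \<epsilon> l \<ge> 1" unfolding N_eps_def by linarith
qed

section \<open>Rounding a normal random variable to random bits\<close>

lemma std_normal_density_has_derivative:
  "(std_normal_density has_real_derivative - y * std_normal_density y) (at y)"
proof -
  have "((\<lambda>y. 1 / sqrt (2 * pi) * exp (- y\<^sup>2 / 2)) has_real_derivative
      - y * (1 / sqrt (2 * pi) * exp (- y\<^sup>2 / 2))) (at y)"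
    by (rule DERIV_cmult[THEN DERIV_cong]) (auto intro!: derivative_eq_intros)
  then show ?thesis by (simp add: std_normal_density_def[abs_def])
qed

lemma Phi_has_derivative: "(Phi has_real_derivative std_normal_density y) (at y)"
proof -
  interpret real_distribution std_normal_distribution by (rule real_dist_normal_dist)
  have cont: "continuous_on A std_normal_density" for A
    using std_normal_density_has_derivative by (meson DERIV_isCont continuous_at_imp_continuous_on)
  define a where "a = y - 1"
  have eq: "Phi x = Phi a + integral {a..x} std_normal_density" if "a \<le> x" for x
  proof (cases "a = x")
    case False
    then have ax: "a < x" using that by simp
    have "Phi x - Phi a = measure std_normal_distribution {a<..x}"
      unfolding Phi_def by (rule cdf_diff_eq[OF ax])
    also have "\<dots> = (\<integral>t. indicator {a<..x} t \<partial>std_normal_distribution)" by simp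
    also have "\<dots> = (\<integral>t. std_normal_density t * indicator {a<..x} t \<partial>lborel)"
      by (subst integral_density) auto
    also have "\<dots> = (\<integral>t. indicator {a..x} t *\<^sub>R std_normal_density t \<partial>lborel)"
    proof (rule integral_cong_AE)
      have "AE t in lborel. t \<noteq> a" by (rule AE_lborel_singleton)
      then show "AE t in lborel. std_normal_density t * indicator {a<..x} t =
          indicator {a..x} t *\<^sub>R std_normal_density t"
        by eventually_elim (auto simp: indicator_def)
    qed auto
    also have "\<dots> = integral {a..x} std_normal_density"
    proof -
      have "set_integrable lborel {a..x} std_normal_density"
        by (rule borel_integrable_atLeastAtMost') (rule cont)
      from set_borel_integral_eq_integral(2)[OF this] show ?thesis
        by (simp add: set_lebesgue_integral_def)
    qed
    finally show ?thesis by simp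
  qed simp
  have "((\<lambda>x. integral {a..x} std_normal_density) has_real_derivative std_normal_density y)
      (at y within {a..y + 1})"
    by (rule integral_has_real_derivative[OF cont]) (auto simp: a_def)
  then have "((\<lambda>x. integral {a..x} std_normal_density) has_real_derivative std_normal_density y) (at y)"
    by (subst (asm) at_within_interior) (auto simp: a_def)
  then have "((\<lambda>x. Phi a + integral {a..x} std_normal_density) has_real_derivative std_normal_density y) (at y)"
    by (auto intro!: derivative_eq_intros)
  then show ?thesis
  proof (rule DERIV_cong_ev[THEN iffD1, rotated -1])
    have "\<forall>\<^sub>F x in nhds y. x \<in> {a<..}" by (rule eventually_nhds_in_open) (auto simp: a_def)
    then show "\<forall>\<^sub>F x in nhds y. Phi a + integral {a..x} std_normal_density = Phi x"
      by eventually_elim (rule eq[symmetric], simp)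
  qed auto
qed

lemma Phi_at_top: "(Phi \<longlongrightarrow> 1) at_top" and Phi_at_bot: "(Phi \<longlongrightarrow> 0) at_bot"
proof -
  interpret real_distribution std_normal_distribution by (rule real_dist_normal_dist)
  show "(Phi \<longlongrightarrow> 1) at_top" "(Phi \<longlongrightarrow> 0) at_bot"
    unfolding Phi_def by (rule cdf_lim_at_top_prob, rule cdf_lim_at_bot)
qed

lemma std_normal_density_tendsto:
  "(std_normal_density \<longlongrightarrow> 0) at_top" "(std_normal_density \<longlongrightarrow> 0) at_bot"
  unfolding std_normal_density_def[abs_def] by real_asymp+

text \<open>In the tails this is Mills' inequality (\<open>1 - \<Phi>(y) \<le> \<phi>(y)\<close> for \<open>y \<ge> 1\<close>), obtained by
  monotonicity of the difference, which vanishes at infinity; in between \<open>\<phi>\<close> is at least \<open>\<phi>(1)\<close>.\<close>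

lemma std_normal_density_ge:
  "std_normal_density 1 * (Phi y * (1 - Phi y)) \<le> std_normal_density y"
proof -
  have b: "0 < Phi y" "Phi y < 1" by (rule Phi_bounds)+
  have one: "std_normal_density 1 \<le> 1"
  proof -
    have "sqrt (2 * pi) \<ge> 1" using pi_gt3 by (simp add: real_le_rsqrt)
    moreover have "exp (- (1 / 2)) \<le> (1::real)" by simp
    ultimately have "exp (- (1 / 2)) \<le> sqrt (2 * pi)" by linarith
    then show ?thesis by (simp add: std_normal_density_def divide_le_eq)
  qed
  have pos: "std_normal_density x > 0" for x by (simp add: normal_density_def)
  consider "y \<le> -1" | "y \<ge> 1" | "\<bar>y\<bar> \<le> 1" by linarith
  then show ?thesis
  proof cases
    case 1
    have "Phi y \<le> std_normal_density y"
    proof -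
      let ?D = "\<lambda>x. std_normal_density x - Phi x"
      have "((\<lambda>x. ?D x) \<longlongrightarrow> 0 - 0) at_bot"
        by (intro tendsto_diff std_normal_density_tendsto Phi_at_bot)
      moreover have "\<forall>\<^sub>F x in at_bot. ?D x \<le> ?D y"
        unfolding eventually_at_bot_linorder
      proof (intro exI allI impI)
        fix x assume x: "x \<le> y"
        show "?D x \<le> ?D y"
        proof (rule DERIV_nonneg_imp_nondecreasing[OF x])
          fix t assume t: "x \<le> t" "t \<le> y"
          have "(?D has_real_derivative (- t * std_normal_density t - std_normal_density t)) (at t)"
            by (intro DERIV_diff std_normal_density_has_derivative Phi_has_derivative)
          moreover have "0 \<le> (- t - 1) * std_normal_density t" using t 1 pos[of t] by auto
          then have "0 \<le> - t * std_normal_density t - std_normal_density t" by (simp add: algebra_simps)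
          ultimately show "\<exists>d. (?D has_real_derivative d) (at t) \<and> 0 \<le> d" by blast
        qed
      qed
      ultimately have "0 - 0 \<le> ?D y" by (rule tendsto_upperbound) simp
      then show ?thesis by simp
    qed
    moreover have "std_normal_density 1 * (Phi y * (1 - Phi y)) \<le> 1 * (Phi y * 1)"
      using one b by (intro mult_mono) auto
    ultimately show ?thesis by simp
  next
    case 2
    have "1 - Phi y \<le> std_normal_density y"
    proof -
      let ?D = "\<lambda>x. std_normal_density x - (1 - Phi x)"
      have "((\<lambda>x. ?D x) \<longlongrightarrow> 0 - (1 - 1)) at_top"
        by (intro tendsto_diff std_normal_density_tendsto Phi_at_top tendsto_const)
      moreover have "\<forall>\<^sub>F x in at_top. ?D x \<le> ?D y"
        unfolding eventually_at_top_linorder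
      proof (intro exI allI impI)
        fix x assume x: "y \<le> x"
        show "?D x \<le> ?D y"
        proof (rule DERIV_nonpos_imp_nonincreasing[OF x])
          fix t assume t: "y \<le> t" "t \<le> x"
          have "(?D has_real_derivative (- t * std_normal_density t - (0 - std_normal_density t))) (at t)"
            by (intro DERIV_diff std_normal_density_has_derivative Phi_has_derivative DERIV_const)
          moreover have "0 \<le> (t - 1) * std_normal_density t" using t 2 pos[of t] by auto
          then have "- t * std_normal_density t - (0 - std_normal_density t) \<le> 0" by (simp add: algebra_simps)
          ultimately show "\<exists>d. (?D has_real_derivative d) (at t) \<and> d \<le> 0" by blast
        qed
      qed
      ultimately have "0 - (1 - 1) \<le> ?D y" by (rule tendsto_upperbound) simp
      then show ?thesis by simp
    qed
    moreover have "std_normal_density 1 * (Phi y * (1 - Phi y)) \<le> 1 * (1 * (1 - Phi y))"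
      using one b by (intro mult_mono) auto
    ultimately show ?thesis by simp
  next
    case 3
    have "Phi y * (1 - Phi y) \<le> 1 * 1" using b by (intro mult_mono) auto
    then have "std_normal_density 1 * (Phi y * (1 - Phi y)) \<le> std_normal_density 1 * 1"
      using pos[of 1] by (intro mult_left_mono) auto
    also have "\<dots> \<le> std_normal_density y"
    proof -
      have "y\<^sup>2 \<le> 1" using 3 by (simp add: abs_square_le_1)
      then show ?thesis by (simp add: std_normal_density_def divide_right_mono)
    qed
    finally show ?thesis .
  qed
qed

text \<open>The derivative of the logit of \<open>\<Phi>\<close> is \<open>\<phi> / (\<Phi> (1 - \<Phi>))\<close>, which is bounded below by the
  previous lemma.  So differences of quantiles are controlled by the logarithms of \<open>\<Phi>\<close> and
  \<open>1 - \<Phi>\<close>, without inverting \<open>\<Phi>\<close>.\<close>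

lemma abs_diff_le_logit:
  "std_normal_density 1 * \<bar>x - y\<bar> \<le>
     \<bar>ln (Phi x) - ln (Phi y)\<bar> + \<bar>ln (1 - Phi x) - ln (1 - Phi y)\<bar>"
proof -
  let ?c = "std_normal_density 1"
  \<comment> \<open>nondecreasing by the lower bound for the density\<close>
  let ?G = "\<lambda>t. ln (Phi t) - ln (1 - Phi t) - ?c * t"
  have mono: "?G x \<le> ?G y" if "x \<le> y" for x y
  proof (rule DERIV_nonneg_imp_nondecreasing[OF that])
    fix t
    note b = Phi_bounds[of t]
    have "(?G has_real_derivative std_normal_density t / Phi t + std_normal_density t / (1 - Phi t) - ?c) (at t)"
      using b by (auto intro!: derivative_eq_intros Phi_has_derivative)
    moreover have "std_normal_density t / Phi t + std_normal_density t / (1 - Phi t)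
        = std_normal_density t / (Phi t * (1 - Phi t))"
      using b by (simp add: field_simps)
    moreover have "?c \<le> std_normal_density t / (Phi t * (1 - Phi t))"
      using b std_normal_density_ge[of t] by (simp add: pos_le_divide_eq)
    ultimately show "\<exists>d. (?G has_real_derivative d) (at t) \<and> 0 \<le> d" by auto
  qed
  have "?c > 0" by (simp add: normal_density_def)
  show ?thesis
  proof (cases "x \<le> y")
    case True
    then show ?thesis using mono[OF True] by (simp add: algebra_simps)
  next
    case False
    then show ?thesis using mono[of y x] by (simp add: algebra_simps)
  qed
qed

text \<open>Here \<open>v\<close> is the midpoint of a grid interval of length \<open>h\<close> in \<open>]0, 1[\<close> that contains \<open>u\<close>.  The
  bound holds uniformly over all intervals, including the first one, where \<open>u / v\<close> is
  arbitrarily close to zero.\<close>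

lemma abs_ln_diff_le:
  fixes u v h :: real
  assumes "u > 0" "h > 0" "v \<ge> h / 2" "\<bar>u - v\<bar> \<le> h / 2"
  shows "\<bar>ln u - ln v\<bar> \<le> ln (1 + h / u)"
proof -
  have "v \<le> u + h" "u \<le> 2 * v" using assms by linarith+
  moreover have "u * u \<le> u * v + h * v"
  proof (cases "u \<le> v")
    case True
    have "u * u \<le> u * v" "0 \<le> h * v" using True assms by auto
    then show ?thesis by linarith
  next
    case False
    have "u * (u - v) \<le> (2 * v) * (h / 2)" using assms False by (intro mult_mono) auto
    then show ?thesis by (simp add: algebra_simps)
  qed
  moreover have "u * (1 + h / u) = u + h" using assms by (simp add: field_simps)
  moreover have "v * (1 + h / u) = (u * v + h * v) / u" using assms by (simp add: field_simps)
  ultimately have "v \<le> u * (1 + h / u)" "u \<le> v * (1 + h / u)"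
    using assms by (simp_all add: pos_le_divide_eq)
  then have "ln v \<le> ln (u * (1 + h / u))" "ln u \<le> ln (v * (1 + h / u))"
    using assms by (auto intro!: ln_mono)
  moreover have "1 + h / u > 0" using assms by (simp add: add_pos_pos)
  ultimately show ?thesis using assms by (simp add: ln_mult)
qed

text \<open>The right-hand side decays quadratically in \<open>u / h\<close> at infinity and has an integrable
  singularity at zero; as a function of \<open>u\<close> it is the derivative of \<open>32 h * sqrt (u / (h + u))\<close>.
  The inequality is \<open>ln y \<le> y - 1 \<le> y - 1 / y ^ 3\<close> for the fourth root \<open>y\<close> of \<open>1 + h / u\<close>.\<close>

lemma ln_square_le:
  fixes u h :: real
  assumes "u > 0" "h > 0"
  shows "(ln (1 + h / u))\<^sup>2 \<le> 16 * (sqrt ((h + u) / u) * h\<^sup>2 / (h + u)\<^sup>2)"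
proof -
  define r where "r = sqrt ((h + u) / u)"
  define y where "y = sqrt r"
  have r1: "r \<ge> 1" using assms by (simp add: r_def)
  then have y1: "y \<ge> 1" by (simp add: y_def)
  have y2: "y\<^sup>2 = r" and r2: "r\<^sup>2 = (h + u) / u" using r1 assms by (auto simp: y_def r_def)
  have y4: "y ^ 4 = (h + u) / u" by (metis y2 r2 power_mult numeral_Bit0 mult_2_right) 
  have hu: "1 + h / u = y ^ 4" using y4 assms by (simp add: field_simps)
  have "ln (1 + h / u) = 4 * ln y" using y1 by (simp add: hu ln_realpow)
  also have "ln y \<le> y - 1" using y1 by (intro ln_le_minus_one) simp
  also have "4 * (y - 1) \<le> 4 * (y - 1 / y ^ 3)"
  proof -
    have "1 \<le> y ^ 3" using y1 by (rule one_le_power)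
    then have "1 / y ^ 3 \<le> 1" using y1 by (subst divide_le_eq) auto
    then show ?thesis by simp
  qed
  also have "y - 1 / y ^ 3 = (y ^ 4 - 1) / y ^ 3" using y1 by (simp add: field_simps power_eq_if)
  also have "\<dots> = (h / u) / y ^ 3" by (simp flip: hu)
  finally have le: "ln (1 + h / u) \<le> 4 * ((h / u) / y ^ 3)" by simp
  have "(ln (1 + h / u))\<^sup>2 \<le> (4 * ((h / u) / y ^ 3))\<^sup>2"
    using le assms by (intro power_mono) auto
  also have "\<dots> = 16 * ((h / u)\<^sup>2 / y ^ 6)" by (simp add: power_mult_distrib power_divide flip: power_mult)
  also have "(h / u)\<^sup>2 / y ^ 6 = y\<^sup>2 * (h / u)\<^sup>2 / (y ^ 4)\<^sup>2"
  proof -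
    have "(y ^ 4)\<^sup>2 = y\<^sup>2 * y ^ 6" by (simp flip: power_mult power_add)
    then show ?thesis unfolding \<open>(y ^ 4)\<^sup>2 = _\<close> using y1
      by (subst mult_divide_mult_cancel_left) auto
  qed
  also have "\<dots> = r * h\<^sup>2 / (h + u)\<^sup>2"
    using assms unfolding y4 y2 by (simp add: field_simps)
  finally show ?thesis by (simp add: r_def)
qed

text \<open>The function \<open>Q\<close> stands for \<open>\<Phi>\<close> (with \<open>s = 1\<close>) or \<open>1 - \<Phi>\<close> (with \<open>s = -1\<close>).  By the chain rule the
  explicit antiderivative of the bound in \<open>ln_square_le\<close> can be used with respect to the normal
  density, and it takes values in \<open>[0, 32 h]\<close> up to the sign.\<close>

lemma nn_integral_ln_square_le:
  fixes Q :: "real \<Rightarrow> real" and h s :: real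
  assumes h: "h > 0" and s: "\<bar>s\<bar> = 1"
    and Q: "\<And>y. 0 < Q y" "\<And>y. Q y < 1"
    and deriv: "\<And>y. (Q has_real_derivative s * std_normal_density y) (at y)"
    and lim: "(Q \<longlongrightarrow> a) at_bot" "(Q \<longlongrightarrow> b) at_top"
  shows "(\<integral>\<^sup>+y. ennreal (std_normal_density y) * ennreal ((ln (1 + h / Q y))\<^sup>2) \<partial>lborel) \<le> ennreal (32 * h)"
proof -
  let ?F = "\<lambda>y. s * 32 * h * sqrt (Q y / (h + Q y))"
  let ?f = "\<lambda>y. std_normal_density y * (16 * (sqrt ((h + Q y) / Q y) * h\<^sup>2 / (h + Q y)\<^sup>2))"
  have hQ: "h + Q y > 0" for y using h Q(1)[of y] by simp
  have a: "0 \<le> a" by (rule tendsto_lowerbound[OF lim(1)]) (use Q(1) in \<open>auto simp: less_imp_le\<close>)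
  have b: "0 \<le> b" by (rule tendsto_lowerbound[OF lim(2)]) (use Q(1) in \<open>auto simp: less_imp_le\<close>)
  have contQ: "isCont Q y" for y by (rule DERIV_isCont[OF deriv])
  have contphi: "isCont std_normal_density y" for y by (rule DERIV_isCont[OF std_normal_density_has_derivative])
  have cont: "isCont ?f y" for y
    using hQ[of y] Q(1)[of y] by (intro continuous_intros contQ contphi) auto
  have ss: "s * s = 1" using s by (metis abs_mult_self_eq mult_1)
  have dF: "(?F has_real_derivative ?f y) (at y)" for y
  proof -
    define w where "w = sqrt (Q y / (h + Q y))"
    have w: "w > 0" using hQ[of y] Q(1)[of y] by (simp add: w_def)
    have dq: "((\<lambda>y. Q y / (h + Q y)) has_real_derivative
        (s * std_normal_density y * h / (h + Q y)\<^sup>2)) (at y)"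
      using hQ[of y] by (auto intro!: derivative_eq_intros deriv simp: power2_eq_square algebra_simps)
    have "(?F has_real_derivative s * 32 * h * ((s * std_normal_density y * h / (h + Q y)\<^sup>2) * (inverse w / 2))) (at y)"
      unfolding w_def
      by (intro DERIV_cmult DERIV_chain2[OF DERIV_real_sqrt dq, THEN DERIV_cong])
         (use hQ[of y] Q(1)[of y] in \<open>auto simp: field_simps\<close>)
    moreover have "sqrt ((h + Q y) / Q y) = inverse w"
      by (simp add: w_def real_sqrt_divide)
    moreover have "s * 32 * h * ((s * std_normal_density y * h / (h + Q y)\<^sup>2) * (inverse w / 2)) =
        (s * s) * (std_normal_density y * (16 * (inverse w * h\<^sup>2 / (h + Q y)\<^sup>2)))"
      by (simp add: power2_eq_square)
    ultimately show ?thesis by (simp only: ss mult_1)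
  qed
  have f0: "0 \<le> ?f y" for y using hQ[of y] Q(1)[of y] by simp
  have F_bot: "((?F \<circ> real_of_ereal) \<longlongrightarrow> s * 32 * h * sqrt (a / (h + a))) (at_right (-\<infinity>))"
    unfolding ereal_tendsto_simps using h a by (intro tendsto_intros lim) auto
  have F_top: "((?F \<circ> real_of_ereal) \<longlongrightarrow> s * 32 * h * sqrt (b / (h + b))) (at_left \<infinity>)"
    unfolding ereal_tendsto_simps using h b by (intro tendsto_intros lim) auto
  note FTC = interval_integral_FTC_nonneg[OF _ dF cont _ F_bot F_top]
  have int: "set_integrable lborel (einterval (-\<infinity>) \<infinity>) ?f"
    by (rule FTC(1)) (simp, intro AE_I2 impI f0)
  have eq: "(LBINT x=-\<infinity>..\<infinity>. ?f x) = s * 32 * h * sqrt (b / (h + b)) - s * 32 * h * sqrt (a / (h + a))"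
    by (rule FTC(2)) (simp, intro AE_I2 impI f0)
  have "(\<integral>\<^sup>+y. ennreal (std_normal_density y) * ennreal ((ln (1 + h / Q y))\<^sup>2) \<partial>lborel) \<le> (\<integral>\<^sup>+y. ennreal (?f y) \<partial>lborel)"
  proof (intro nn_integral_mono)
    fix y
    have "std_normal_density y * (ln (1 + h / Q y))\<^sup>2 \<le> ?f y"
      by (intro mult_left_mono ln_square_le Q h) simp
    then show "ennreal (std_normal_density y) * ennreal ((ln (1 + h / Q y))\<^sup>2) \<le> ennreal (?f y)"
      by (subst ennreal_mult[symmetric]) (simp_all only: ennreal_leI normal_density_nonneg zero_le_power2)
  qed
  also have "\<dots> = ennreal (LBINT x=-\<infinity>..\<infinity>. ?f x)"
  proof -
    have "integrable lborel ?f" using int by (simp add: set_integrable_def)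
    then have "(\<integral>\<^sup>+y. ennreal (?f y) \<partial>lborel) = ennreal (integral\<^sup>L lborel ?f)"
      by (rule nn_integral_eq_integral) (intro AE_I2 f0)
    then show ?thesis by (simp add: interval_lebesgue_integral_def set_lebesgue_integral_def)
  qed
  also have "(LBINT x=-\<infinity>..\<infinity>. ?f x) \<le> 32 * h"
  proof -
    have rng: "0 \<le> sqrt (t / (h + t)) \<and> sqrt (t / (h + t)) \<le> 1" if "t \<ge> 0" for t
      using that h by (auto simp: divide_le_eq)
    have "s * x - s * y \<le> 1" if "0 \<le> x \<and> x \<le> 1" "0 \<le> y \<and> y \<le> 1" for x y
    proof -
      have "s = 1 \<or> s = -1" using s by linarith
      then show ?thesis using that by auto
    qed
    from this[OF rng[OF b] rng[OF a]]
    have "s * sqrt (b / (h + b)) - s * sqrt (a / (h + a)) \<le> 1" .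
    then have "32 * h * (s * sqrt (b / (h + b)) - s * sqrt (a / (h + a))) \<le> 32 * h * 1"
      using h by (intro mult_left_mono) auto
    then show ?thesis unfolding eq by (simp add: algebra_simps)
  qed
  finally show ?thesis by (simp add: ennreal_leI)
qed

lemma Phi_Phi_inv: "0 < t \<Longrightarrow> t < 1 \<Longrightarrow> Phi (Phi_inv t) = t"
  unfolding Phi_inv_def using Phi_range[of t] by (intro f_inv_into_f) auto

lemma bit_round_bounds:
  assumes "0 \<le> u" "u < 1"
  shows "\<bar>u - bit_round p u\<bar> \<le> 1 / 2 ^ p / 2" "1 / 2 ^ p / 2 \<le> bit_round p u" "bit_round p u \<le> 1 - 1 / 2 ^ p / 2"
proof -
  let ?k = "\<lfloor>2 ^ p * u\<rfloor>"
  have eq: "bit_round p u = (of_int ?k + 1 / 2) / 2 ^ p" by (simp add: bit_round_def field_simps)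
  have k: "of_int ?k \<le> 2 ^ p * u" "2 ^ p * u < of_int ?k + 1" by linarith+
  have "2 ^ p * u < 2 ^ p" using assms by simp
  then have "?k < 2 ^ p" by (metis floor_less_iff of_int_numeral of_int_power)
  then have "of_int (?k + 1) \<le> (of_int (2 ^ p) :: real)" by (subst of_int_le_iff) simp
  then have k1: "of_int ?k + 1 \<le> (2::real) ^ p" by simp
  have "0 \<le> 2 ^ p * u" using assms by simp
  then have "0 \<le> ?k" by (simp only: zero_le_floor)
  then have k0: "(0::real) \<le> of_int ?k" by simp
  show "\<bar>u - bit_round p u\<bar> \<le> 1 / 2 ^ p / 2" unfolding eq using k by (simp add: abs_le_iff field_simps)
  show "1 / 2 ^ p / 2 \<le> bit_round p u" unfolding eq using k0 by (simp add: field_simps)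
  have "bit_round p u \<le> (2 ^ p - 1 / 2) / 2 ^ p" unfolding eq using k1 by (intro divide_right_mono) auto
  then show "bit_round p u \<le> 1 - 1 / 2 ^ p / 2" by (simp add: diff_divide_distrib)
qed

lemma bit_normal_measurable [measurable]: "bit_normal p \<in> borel_measurable borel"
proof -
  have "(\<lambda>y. (\<lambda>k::int. Phi_inv (of_int k / 2 ^ p + 1 / 2 ^ (p + 1))) \<lfloor>2 ^ p * Phi y\<rfloor>) \<in> borel_measurable borel"
    by measurable
  then show ?thesis by (simp add: bit_normal_def[abs_def] bit_round_def)
qed

text \<open>The factor \<open>2 / \<phi>(1)\<^sup>2\<close> comes from squaring the bound in \<open>abs_diff_le_logit\<close>, and \<open>64 = 32 + 32\<close>
  from applying \<open>nn_integral_ln_square_le\<close> to both summands.\<close>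

definition quantisation_constant :: real where
  "quantisation_constant = 128 / (std_normal_density 1)\<^sup>2"

lemma quantisation_constant_pos: "quantisation_constant > 0"
  by (simp add: quantisation_constant_def normal_density_def)

text \<open>Rounding moves \<open>u = \<Phi>(y)\<close> to the midpoint of an interval of length \<open>h = 2 powr (- p)\<close>, so the logit
  bound applies with \<open>abs_ln_diff_le\<close> at both ends of \<open>]0, 1[\<close>; each end contributes a multiple of \<open>h\<close>.\<close>

lemma bit_normal_error:
  assumes M: "prob_space M" and Y: "distributed M lborel Y std_normal_density"
  shows "(\<integral>\<^sup>+\<omega>. ennreal ((Y \<omega> - bit_normal p (Y \<omega>))\<^sup>2) \<partial>M) \<le> ennreal (quantisation_constant / 2 ^ p)"
proof -
  define h :: real where "h = 1 / 2 ^ p"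
  have h: "h > 0" by (simp add: h_def)
  let ?c = "std_normal_density 1"
  let ?a = "\<lambda>y. (ln (1 + h / Phi y))\<^sup>2" and ?b = "\<lambda>y. (ln (1 + h / (1 - Phi y)))\<^sup>2"
  have c: "?c > 0" by (simp add: normal_density_def)
  have pt: "(y - bit_normal p y)\<^sup>2 \<le> 2 / ?c\<^sup>2 * (?a y + ?b y)" for y
  proof -
    note b = Phi_bounds[of y]
    let ?u = "Phi y" and ?v = "bit_round p (Phi y)"
    note r = bit_round_bounds[of ?u p, folded h_def, OF less_imp_le[OF b(1)] b(2)]
    have "Phi (bit_normal p y) = ?v" unfolding bit_normal_def
      using r h by (intro Phi_Phi_inv) linarith+
    then have "?c * \<bar>y - bit_normal p y\<bar> \<le> \<bar>ln ?u - ln ?v\<bar> + \<bar>ln (1 - ?u) - ln (1 - ?v)\<bar>"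
      using abs_diff_le_logit[of y "bit_normal p y"] by simp
    also have "\<bar>ln ?u - ln ?v\<bar> \<le> ln (1 + h / ?u)" by (intro abs_ln_diff_le) (use r h b in linarith)+
    also have "\<bar>ln (1 - ?u) - ln (1 - ?v)\<bar> \<le> ln (1 + h / (1 - ?u))" by (intro abs_ln_diff_le) (use r h b in linarith)+
    finally have "(?c * \<bar>y - bit_normal p y\<bar>)\<^sup>2 \<le> (ln (1 + h / ?u) + ln (1 + h / (1 - ?u)))\<^sup>2"
      using c by (intro power_mono) auto
    also have "\<dots> \<le> 2 * (?a y + ?b y)"
      using sum_squares_bound[of "ln (1 + h / ?u)" "ln (1 + h / (1 - ?u))"] by (simp add: power2_sum)
    finally show ?thesis using c by (simp add: power_mult_distrib field_simps)
  qed
  have "(\<integral>\<^sup>+\<omega>. ennreal ((Y \<omega> - bit_normal p (Y \<omega>))\<^sup>2) \<partial>M) =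
      (\<integral>\<^sup>+y. ennreal (std_normal_density y) * ennreal ((y - bit_normal p y)\<^sup>2) \<partial>lborel)"
    by (rule distributed_nn_integral[OF Y, symmetric]) simp
  also have "\<dots> \<le> (\<integral>\<^sup>+y. ennreal (2 / ?c\<^sup>2) * (ennreal (std_normal_density y) * ennreal (?a y) +
      ennreal (std_normal_density y) * ennreal (?b y)) \<partial>lborel)"
  proof (intro nn_integral_mono)
    fix y
    have "std_normal_density y * (y - bit_normal p y)\<^sup>2 \<le> std_normal_density y * (2 / ?c\<^sup>2 * (?a y + ?b y))"
      by (intro mult_left_mono pt) simp
    also have "\<dots> = 2 / ?c\<^sup>2 * (std_normal_density y * ?a y + std_normal_density y * ?b y)"
      by (simp add: algebra_simps)
    finally show "ennreal (std_normal_density y) * ennreal ((y - bit_normal p y)\<^sup>2) \<le>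
        ennreal (2 / ?c\<^sup>2) * (ennreal (std_normal_density y) * ennreal (?a y) +
          ennreal (std_normal_density y) * ennreal (?b y))"
    proof -
      assume le: "std_normal_density y * (y - bit_normal p y)\<^sup>2 \<le>
          2 / ?c\<^sup>2 * (std_normal_density y * ?a y + std_normal_density y * ?b y)"
      have "ennreal (std_normal_density y) * ennreal ((y - bit_normal p y)\<^sup>2) =
          ennreal (std_normal_density y * (y - bit_normal p y)\<^sup>2)"
        by (intro ennreal_mult[symmetric]) auto
      also have "\<dots> \<le> ennreal (2 / ?c\<^sup>2 * (std_normal_density y * ?a y + std_normal_density y * ?b y))"
        by (rule ennreal_leI[OF le])
      also have "\<dots> = ennreal (2 / ?c\<^sup>2) * ennreal (std_normal_density y * ?a y + std_normal_density y * ?b y)"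
        by (intro ennreal_mult) auto
      also have "ennreal (std_normal_density y * ?a y + std_normal_density y * ?b y) =
          ennreal (std_normal_density y) * ennreal (?a y) + ennreal (std_normal_density y) * ennreal (?b y)"
        by (subst ennreal_plus) (auto simp: ennreal_mult)
      finally show ?thesis .
    qed
  qed
  also have "\<dots> = ennreal (2 / ?c\<^sup>2) * ((\<integral>\<^sup>+y. ennreal (std_normal_density y) * ennreal (?a y) \<partial>lborel) +
      (\<integral>\<^sup>+y. ennreal (std_normal_density y) * ennreal (?b y) \<partial>lborel))"
    by (simp add: nn_integral_cmult nn_integral_add)
  also have "\<dots> \<le> ennreal (2 / ?c\<^sup>2) * (ennreal (32 * h) + ennreal (32 * h))"
  proof (intro mult_left_mono add_mono)
    show "(\<integral>\<^sup>+y. ennreal (std_normal_density y) * ennreal (?a y) \<partial>lborel) \<le> ennreal (32 * h)"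
      by (rule nn_integral_ln_square_le[where s = 1, OF h _ _ _ _ Phi_at_bot Phi_at_top])
         (auto simp: Phi_bounds intro: Phi_has_derivative)
    show "(\<integral>\<^sup>+y. ennreal (std_normal_density y) * ennreal (?b y) \<partial>lborel) \<le> ennreal (32 * h)"
    proof (rule nn_integral_ln_square_le[where s = "-1", OF h])
      show "((\<lambda>y. 1 - Phi y) \<longlongrightarrow> 1 - 0) at_bot" "((\<lambda>y. 1 - Phi y) \<longlongrightarrow> 1 - 1) at_top"
        by (intro tendsto_intros Phi_at_bot Phi_at_top)+
      show "((\<lambda>y. 1 - Phi y) has_real_derivative - 1 * std_normal_density y) (at y)" for y
        by (auto intro!: derivative_eq_intros Phi_has_derivative)
    qed (auto simp: Phi_bounds)
  qed auto
  also have "\<dots> = ennreal (2 / ?c\<^sup>2 * (64 * h))"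
  proof -
    have "ennreal (32 * h) + ennreal (32 * h) = ennreal (64 * h)"
      using h by (subst ennreal_plus[symmetric]) auto
    moreover have "ennreal (2 / ?c\<^sup>2) * ennreal (64 * h) = ennreal (2 / ?c\<^sup>2 * (64 * h))"
      using h by (intro ennreal_mult[symmetric]) auto
    ultimately show ?thesis by (simp only:)
  qed
  also have "2 / ?c\<^sup>2 * (64 * h) = quantisation_constant / 2 ^ p"
    unfolding quantisation_constant_def h_def by simp
  finally show ?thesis .
qed

section \<open>Eigenvalue sums\<close>

text \<open>The order of the mean square error of the approximation with \<open>2 ^ l\<close> coordinates.\<close>

definition level_error :: "real \<Rightarrow> real \<Rightarrow> nat \<Rightarrow> real" where
  "level_error \<alpha> \<beta> l = 2 powr ((1 - \<beta>) * real l) * real l powr (- \<alpha>)"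

lemma level_error_pos: "l \<ge> 1 \<Longrightarrow> level_error \<alpha> \<beta> l > 0"
  by (simp add: level_error_def)

lemma log_dyadic_powr_le:
  assumes "k \<ge> 1"
  shows "log 2 (real (2 ^ k + 1)) powr r \<le> 2 powr \<bar>r\<bar> * real k powr r"
proof -
  have "log 2 (2 ^ k) \<le> log 2 (real (2 ^ k + 1))" by (intro log_mono) auto
  then have 1: "real k \<le> log 2 (real (2 ^ k + 1))" by simp
  have "(1::real) \<le> 2 ^ k" by simp
  then have "real (2 ^ k + 1) \<le> 2 ^ (k + 1)" by simp
  moreover have "0 < real (2 ^ k + 1)" by (simp only: of_nat_0_less_iff)
  ultimately have "log 2 (real (2 ^ k + 1)) \<le> log 2 (2 ^ (k + 1))" by (intro log_mono) auto
  then have 2: "log 2 (real (2 ^ k + 1)) \<le> real (k + 1)" by (simp only: log_pow_cancel)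
  show ?thesis by (rule powr_le_of_ratio) (use 1 2 assms in auto)
qed

locale eigenvalue_decay =
  fixes lam :: "nat \<Rightarrow> real" and \<alpha> \<beta> :: real
  assumes lam_pos: "i \<ge> 1 \<Longrightarrow> lam i > 0"
    and lam_Suc: "i \<ge> 1 \<Longrightarrow> lam (Suc i) \<le> lam i"
    and beta: "\<beta> > 1"
    and lam_lim: "\<exists>c>0. (\<lambda>i. lam i * real i powr \<beta> * ln (real i) powr \<alpha>) \<longlonglongrightarrow> c"
begin

lemma lam_antimono: assumes "1 \<le> i" "i \<le> j" shows "lam j \<le> lam i"
  using assms(2)
proof (induction j rule: dec_induct)
  case (step n)
  then show ?case using lam_Suc[of n] assms(1) by force
qed simp

text \<open>The convergent sequence is bounded.  Replacing \<open>ln i\<close> by \<open>log 2 (i + 1)\<close> changes it by a bounded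
  factor and gives an estimate that is meaningful for \<open>i = 1\<close>, too.\<close>

lemma lam_le: "\<exists>C>0. \<forall>i\<ge>1. lam i \<le> C * real i powr (- \<beta>) * log 2 (real (i + 1)) powr (- \<alpha>)"
proof -
  obtain c where "(\<lambda>i. lam i * real i powr \<beta> * ln (real i) powr \<alpha>) \<longlonglongrightarrow> c" using lam_lim by blast
  then have "Bseq (\<lambda>i. lam i * real i powr \<beta> * ln (real i) powr \<alpha>)"
    by (intro convergent_imp_Bseq convergentI)
  then obtain K where K: "K > 0" "\<And>i. \<bar>lam i * real i powr \<beta> * ln (real i) powr \<alpha>\<bar> \<le> K"
    by (auto simp: Bseq_def)
  define C where "C = lam 1 + 3 powr \<bar>\<alpha>\<bar> * K"
  have lam1: "lam 1 > 0" by (rule lam_pos) simp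
  have C: "C > 0" "lam 1 \<le> C" "3 powr \<bar>\<alpha>\<bar> * K \<le> C"
    using lam1 K(1) by (auto simp: C_def add_pos_pos)
  show ?thesis
  proof (intro exI[of _ C] conjI allI impI)
    fix i :: nat assume i: "1 \<le> i"
    let ?g = "log 2 (real (i + 1))"
    have g: "?g > 0" using i by simp
    have le: "lam i * real i powr \<beta> * ?g powr \<alpha> \<le> C"
    proof (cases "i = 1")
      case True then show ?thesis using C by simp
    next
      case False
      then have i2: "i \<ge> 2" using i by simp
      have l2: "2 / 3 \<le> ln (2::real)" "ln (2::real) \<le> 1"
        using ln2_ge_two_thirds ln_le_minus_one[of "2::real"] by auto
      have pos: "ln (real i) > 0" using i2 by simp
      have "real (i + 1) \<le> real i ^ 2"
      proof -
        have "2 * i \<le> i * i" using i2 by (intro mult_right_mono) auto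
        then have "i + 1 \<le> i ^ 2" using i2 unfolding power2_eq_square by linarith
        then show ?thesis by (simp only: of_nat_power[symmetric] of_nat_le_iff)
      qed
      then have "ln (real (i + 1)) \<le> ln (real i ^ 2)" by (intro ln_mono) auto
      then have "ln (real (i + 1)) \<le> 2 * ln (real i)" using i2 by (simp add: ln_realpow)
      also have "\<dots> \<le> 3 * ln (real i) * ln 2" using l2 pos by (simp add: algebra_simps)
      finally have 1: "?g \<le> 3 * ln (real i)" by (simp add: log_def divide_le_eq)
      have "ln (real i) * ln 2 \<le> ln (real i) * 1" using l2 pos by (intro mult_left_mono) auto
      also have "\<dots> \<le> ln (real (i + 1))" using i2 by simp
      finally have "ln (real i) \<le> ?g" by (simp add: log_def le_divide_eq)
      then have 2: "ln (real i) \<le> 3 * ?g" using g by linarith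
      have "?g powr \<alpha> \<le> 3 powr \<bar>\<alpha>\<bar> * ln (real i) powr \<alpha>"
        by (rule powr_le_of_ratio[OF g pos 1 2])
      then have "lam i * real i powr \<beta> * ?g powr \<alpha> \<le>
          lam i * real i powr \<beta> * (3 powr \<bar>\<alpha>\<bar> * ln (real i) powr \<alpha>)"
        using lam_pos[OF i] by (intro mult_left_mono) auto
      also have "\<dots> = 3 powr \<bar>\<alpha>\<bar> * (lam i * real i powr \<beta> * ln (real i) powr \<alpha>)" by simp
      also have "\<dots> \<le> 3 powr \<bar>\<alpha>\<bar> * K" using K(2)[of i] by (intro mult_left_mono) auto
      finally show ?thesis using C by simp
    qed
    have "lam i = (lam i * real i powr \<beta> * ?g powr \<alpha>) * real i powr (- \<beta>) * ?g powr (- \<alpha>)"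
    proof -
      have "real i powr \<beta> * real i powr (- \<beta>) = 1" "?g powr \<alpha> * ?g powr (- \<alpha>) = 1"
      proof -
        have "x powr r * x powr (- r) = 1" if "x > 0" for x r :: real
          using that by (simp add: powr_add[symmetric])
        then show "real i powr \<beta> * real i powr (- \<beta>) = 1" "?g powr \<alpha> * ?g powr (- \<alpha>) = 1"
          using i by (simp, intro \<open>\<And>x r. x > 0 \<Longrightarrow> x powr r * x powr (- r) = 1\<close> g)
      qed
      then have "lam i = lam i * (real i powr \<beta> * real i powr (- \<beta>)) * (?g powr \<alpha> * ?g powr (- \<alpha>))"
        by (simp only: mult_1_right)
      then show ?thesis by (simp only: mult_ac)
    qed
    also have "\<dots> \<le> C * real i powr (- \<beta>) * ?g powr (- \<alpha>)"
      using le by (intro mult_right_mono) auto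
    finally show "lam i \<le> C * real i powr (- \<beta>) * ?g powr (- \<alpha>)" .
  qed (rule C)
qed

text \<open>Monotonicity bounds the block \<open>2 ^ k < i \<le> 2 ^ (k + 1)\<close> by \<open>2 ^ k * lam (2 ^ k)\<close>, which is of the
  order \<open>level_error \<alpha> \<beta> k\<close>, and these orders decay geometrically since \<open>\<beta> > 1\<close>.\<close>

lemma tail_sum_le:
  "\<exists>C>0. \<forall>l\<ge>1. \<forall>n. (\<Sum>i\<in>{2 ^ l<..n}. lam i) \<le> C * level_error \<alpha> \<beta> l"
proof -
  obtain C where C: "C > 0" "\<And>i. i \<ge> 1 \<Longrightarrow> lam i \<le> C * real i powr (- \<beta>) * log 2 (real (i + 1)) powr (- \<alpha>)"
    using lam_le by blast
  let ?t = "\<lambda>d. 2 powr ((1 - \<beta>) * real d) * real (Suc d) powr \<bar>\<alpha>\<bar>"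
  have summ: "summable ?t" by (rule summable_geometric_powr) (use beta in simp)
  have t0: "0 \<le> ?t d" for d by simp
  have sumpos: "0 < (\<Sum>d. ?t d)" by (rule suminf_pos[OF summ]) simp
  define A where "A = C * 2 powr \<bar>\<alpha>\<bar> * (\<Sum>d. ?t d)"
  have block: "(\<Sum>i\<in>{2 ^ (l + d)<..2 ^ Suc (l + d)}. lam i) \<le> C * 2 powr \<bar>\<alpha>\<bar> * level_error \<alpha> \<beta> l * ?t d"
    if l: "l \<ge> 1" for l d
  proof -
    define k where "k = l + d"
    have k: "k \<ge> 1" using l by (simp add: k_def)
    have k1: "(1::nat) \<le> 2 ^ k" by simp
    have "(\<Sum>i\<in>{2 ^ k<..2 ^ Suc k}. lam i) \<le> (\<Sum>i\<in>{2 ^ k<..2 ^ Suc k::nat}. lam (2 ^ k))"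
      by (intro sum_mono lam_antimono) auto
    also have "\<dots> = 2 ^ k * lam (2 ^ k)" by simp
    also have "\<dots> \<le> 2 ^ k * (C * real (2 ^ k) powr (- \<beta>) * log 2 (real (2 ^ k + 1)) powr (- \<alpha>))"
      using C(2)[OF k1] by (intro mult_left_mono) auto
    also have "\<dots> \<le> 2 ^ k * (C * real (2 ^ k) powr (- \<beta>) * (2 powr \<bar>\<alpha>\<bar> * real k powr (- \<alpha>)))"
      using log_dyadic_powr_le[OF k, of "- \<alpha>"] C(1) by (intro mult_left_mono) auto
    also have "\<dots> = C * 2 powr \<bar>\<alpha>\<bar> * (2 ^ k * real (2 ^ k) powr (- \<beta>)) * real k powr (- \<alpha>)" by simp
    also have "2 ^ k * real (2 ^ k) powr (- \<beta>) = 2 powr ((1 - \<beta>) * real l) * 2 powr ((1 - \<beta>) * real d)"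
    proof -
      have "2 ^ k * real (2 ^ k) powr (- \<beta>) = 2 powr real k * (2 powr real k) powr (- \<beta>)"
        by (simp add: powr_realpow)
      also have "\<dots> = 2 powr (real k + real k * (- \<beta>))" by (simp only: powr_powr powr_add)
      also have "real k + real k * (- \<beta>) = (1 - \<beta>) * real l + (1 - \<beta>) * real d"
        by (simp add: k_def algebra_simps)
      finally show ?thesis by (simp only: powr_add)
    qed
    also have "C * 2 powr \<bar>\<alpha>\<bar> * (2 powr ((1 - \<beta>) * real l) * 2 powr ((1 - \<beta>) * real d)) * real k powr (- \<alpha>)
      \<le> C * 2 powr \<bar>\<alpha>\<bar> * (2 powr ((1 - \<beta>) * real l) * 2 powr ((1 - \<beta>) * real d)) * (real (Suc d) powr \<bar>\<alpha>\<bar> * real l powr (- \<alpha>))"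
      using powr_shift_le(1)[OF l, of d "- \<alpha>"] C(1) unfolding k_def by (intro mult_left_mono) auto
    finally show ?thesis by (simp add: level_error_def k_def mult_ac)
  qed
  have dyadic: "(\<Sum>i\<in>{2 ^ l<..2 ^ (l + n)}. lam i) \<le> C * 2 powr \<bar>\<alpha>\<bar> * level_error \<alpha> \<beta> l * (\<Sum>d<n. ?t d)"
    if l: "l \<ge> 1" for l n
  proof (induction n)
    case (Suc n)
    have "{a<..c} = {a<..b} \<union> {b<..c}" if "a \<le> b" "b \<le> c" for a b c :: nat using that by auto
    from this[of "2 ^ l" "2 ^ (l + n)" "2 ^ Suc (l + n)"]
    have "{2 ^ l<..2 ^ (l + Suc n)} = {2 ^ l<..2 ^ (l + n)} \<union> {2 ^ (l + n)<..2 ^ Suc (l + n) :: nat}"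
      by simp
    then have "(\<Sum>i\<in>{2 ^ l<..2 ^ (l + Suc n)}. lam i) =
        (\<Sum>i\<in>{2 ^ l<..2 ^ (l + n)}. lam i) + (\<Sum>i\<in>{2 ^ (l + n)<..2 ^ Suc (l + n)}. lam i)"
      by (simp only:) (rule sum.union_disjoint, auto)
    then show ?case using Suc block[OF l, of n] by (simp add: distrib_left)
  qed simp
  show ?thesis
  proof (intro exI[of _ A] conjI allI impI)
    show "A > 0" using C(1) sumpos by (simp add: A_def)
    fix l n :: nat assume l: "1 \<le> l"
    have "n \<le> 2 ^ (l + n)" by (rule order_trans[OF less_imp_le[OF less_exp]]) simp
    then have "(\<Sum>i\<in>{2 ^ l<..n}. lam i) \<le> (\<Sum>i\<in>{2 ^ l<..2 ^ (l + n)}. lam i)"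
    proof (intro sum_mono2)
      fix i :: nat assume "i \<in> {2 ^ l<..2 ^ (l + n)} - {2 ^ l<..n}"
      then have "i \<noteq> 0" by auto
      then have "1 \<le> i" by simp
      then show "0 \<le> lam i" by (rule less_imp_le[OF lam_pos])
    qed auto
    also note dyadic[OF l]
    also have "C * 2 powr \<bar>\<alpha>\<bar> * level_error \<alpha> \<beta> l * (\<Sum>d<n. ?t d) \<le>
        C * 2 powr \<bar>\<alpha>\<bar> * level_error \<alpha> \<beta> l * (\<Sum>d. ?t d)"
      using C(1) level_error_pos[OF l, of \<alpha> \<beta>] by (intro mult_left_mono sum_le_suminf summ t0) auto
    finally show "(\<Sum>i\<in>{2 ^ l<..n}. lam i) \<le> A * level_error \<alpha> \<beta> l" by (simp add: A_def mult_ac)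
  qed
qed

text \<open>The bit numbers balance the coordinates: the factor \<open>2 powr (- p\<^sub>i)\<close> turns the bound for \<open>\<lambda>\<^sub>i\<close> into
  the corresponding bound for \<open>\<lambda>\<^sub>m\<close>.  For negative \<open>\<alpha>\<close> the logarithmic factor is increasing in \<open>i\<close>,
  so that no bits have to be spent on it.\<close>

lemma bit_number_weight_le:
  assumes i: "1 \<le> i" "i \<le> m" and C: "C > 0"
    and lam: "lam i \<le> C * real i powr (- \<beta>) * log 2 (real (i + 1)) powr (- \<alpha>)"
  shows "lam i / 2 ^ bit_number \<alpha> \<beta> m i \<le> C * (real m powr (- \<beta>) * log 2 (real (m + 1)) powr (- \<alpha>))"
proof -
  define a where "a = max \<alpha> 0"
  define g where "g k = log 2 (real (k + 1))" for k
  have a: "a \<ge> 0" "a \<ge> \<alpha>" by (auto simp: a_def)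
  have g: "g i > 0" "g m > 0" "g i \<le> g m" using i by (auto simp: g_def)
  have mi: "real m / real i > 0" "g m / g i > 0" using i g by auto
  have "\<beta> * log 2 (real m / real i) + a * log 2 (g m / g i) \<le> real (bit_number \<alpha> \<beta> m i)"
    unfolding bit_number_def a_def g_def by linarith
  then have "2 powr (\<beta> * log 2 (real m / real i) + a * log 2 (g m / g i)) \<le> 2 powr real (bit_number \<alpha> \<beta> m i)"
    by simp
  also have "2 powr (\<beta> * log 2 (real m / real i) + a * log 2 (g m / g i)) =
      (real m / real i) powr \<beta> * (g m / g i) powr a"
  proof -
    have "2 powr (r * log 2 x) = x powr r" if "x > 0" for r x :: real
    proof -
      have "2 powr (log 2 x * r) = (2 powr log 2 x) powr r" by (simp only: powr_powr)
      then show ?thesis using that by (simp add: mult.commute)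
    qed
    from this[OF mi(1)] this[OF mi(2)] show ?thesis by (simp only: powr_add)
  qed
  finally have "(real m / real i) powr \<beta> * (g m / g i) powr a \<le> 2 ^ bit_number \<alpha> \<beta> m i"
    by (simp add: powr_realpow)
  then have "lam i / 2 ^ bit_number \<alpha> \<beta> m i \<le>
      (C * real i powr (- \<beta>) * g i powr (- \<alpha>)) / ((real m / real i) powr \<beta> * (g m / g i) powr a)"
  proof -
    have "0 < (real m / real i) powr \<beta>" "0 < (g m / g i) powr a" using mi i by auto
    moreover have "lam i \<le> C * real i powr (- \<beta>) * g i powr (- \<alpha>)" using lam by (simp only: g_def)
    ultimately show ?thesis
      using lam_pos[OF i(1)] C \<open>_ \<le> 2 ^ bit_number \<alpha> \<beta> m i\<close> by (intro frac_le mult_pos_pos) auto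
  qed
  also have "\<dots> = C * (real m powr (- \<beta>) * (g i powr (a - \<alpha>) * g m powr (- a)))"
  proof -
    have "real i powr \<beta> > 0" "real m powr \<beta> > 0" "g i powr \<alpha> > 0" "g i powr a > 0" "g m powr a > 0"
      using i g by auto
    then show ?thesis by (simp add: powr_divide powr_minus powr_diff divide_simps)
  qed
  also have "\<dots> \<le> C * (real m powr (- \<beta>) * (g m powr (a - \<alpha>) * g m powr (- a)))"
    using g a C by (intro mult_left_mono mult_right_mono powr_mono2) auto
  also have "g m powr (a - \<alpha>) * g m powr (- a) = g m powr (- \<alpha>)"
    by (simp only: powr_add[symmetric]) simp
  finally show ?thesis by (simp add: g_def)
qed

lemma quantisation_sum_le:
  "\<exists>C>0. \<forall>l\<ge>1. (\<Sum>i=1..2 ^ l. lam i / 2 ^ bit_number \<alpha> \<beta> (2 ^ l) i) \<le> C * level_error \<alpha> \<beta> l"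
proof -
  obtain C where C: "C > 0" "\<And>i. i \<ge> 1 \<Longrightarrow> lam i \<le> C * real i powr (- \<beta>) * log 2 (real (i + 1)) powr (- \<alpha>)"
    using lam_le by blast
  show ?thesis
  proof (intro exI[of _ "C * 2 powr \<bar>\<alpha>\<bar>"] conjI allI impI)
    fix l :: nat assume l: "1 \<le> l"
    let ?b = "real (2 ^ l) powr (- \<beta>) * log 2 (real (2 ^ l + 1)) powr (- \<alpha>)"
    have "(\<Sum>i=1..2 ^ l. lam i / 2 ^ bit_number \<alpha> \<beta> (2 ^ l) i) \<le> (\<Sum>i=1..2 ^ l :: nat. C * ?b)"
      by (intro sum_mono bit_number_weight_le C) auto
    also have "\<dots> = C * (2 ^ l * real (2 ^ l) powr (- \<beta>)) * log 2 (real (2 ^ l + 1)) powr (- \<alpha>)" by simp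
    also have "2 ^ l * real (2 ^ l) powr (- \<beta>) = 2 powr ((1 - \<beta>) * real l)"
    proof -
      have "2 ^ l * real (2 ^ l) powr (- \<beta>) = 2 powr real l * (2 powr real l) powr (- \<beta>)"
        by (simp add: powr_realpow)
      also have "\<dots> = 2 powr (real l + real l * (- \<beta>))" by (simp only: powr_powr powr_add)
      also have "real l + real l * (- \<beta>) = (1 - \<beta>) * real l" by (simp add: algebra_simps)
      finally show ?thesis .
    qed
    also have "C * 2 powr ((1 - \<beta>) * real l) * log 2 (real (2 ^ l + 1)) powr (- \<alpha>) \<le>
        C * 2 powr ((1 - \<beta>) * real l) * (2 powr \<bar>\<alpha>\<bar> * real l powr (- \<alpha>))"
      using log_dyadic_powr_le[OF l, of "- \<alpha>"] C(1) by (intro mult_left_mono) auto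
    finally show "(\<Sum>i=1..2 ^ l. lam i / 2 ^ bit_number \<alpha> \<beta> (2 ^ l) i) \<le> C * 2 powr \<bar>\<alpha>\<bar> * level_error \<alpha> \<beta> l"
      by (simp add: level_error_def mult_ac)
  qed (use C in auto)
qed

end

section \<open>Mean square error of the random bit approximation\<close>

lemma norm_add_square_le:
  fixes a b :: "'a::real_normed_vector"
  shows "(norm (a + b))\<^sup>2 \<le> 2 * (norm a)\<^sup>2 + 2 * (norm b)\<^sup>2"
proof -
  have "(norm (a + b))\<^sup>2 \<le> (norm a + norm b)\<^sup>2" by (intro power_mono norm_triangle_ineq) simp
  also have "\<dots> \<le> 2 * (norm a)\<^sup>2 + 2 * (norm b)\<^sup>2"
    using sum_squares_bound[of "norm a" "norm b"] by (simp add: power2_sum)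
  finally show ?thesis .
qed

lemma nn_integral_norm_add_square_le:
  fixes U V :: "'w \<Rightarrow> 'h::{real_normed_vector, second_countable_topology}"
  assumes [measurable]: "U \<in> borel_measurable M" "V \<in> borel_measurable M"
    and "(\<integral>\<^sup>+\<omega>. ennreal ((norm (U \<omega>))\<^sup>2) \<partial>M) \<le> ennreal a" "(\<integral>\<^sup>+\<omega>. ennreal ((norm (V \<omega>))\<^sup>2) \<partial>M) \<le> ennreal b"
    and ab: "0 \<le> a" "0 \<le> b"
  shows "(\<integral>\<^sup>+\<omega>. ennreal ((norm (U \<omega> + V \<omega>))\<^sup>2) \<partial>M) \<le> ennreal (2 * a + 2 * b)"
proof -
  have "(\<integral>\<^sup>+\<omega>. ennreal ((norm (U \<omega> + V \<omega>))\<^sup>2) \<partial>M) \<le>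
      (\<integral>\<^sup>+\<omega>. 2 * ennreal ((norm (U \<omega>))\<^sup>2) + 2 * ennreal ((norm (V \<omega>))\<^sup>2) \<partial>M)"
  proof (intro nn_integral_mono)
    fix \<omega>
    have "ennreal ((norm (U \<omega> + V \<omega>))\<^sup>2) \<le> ennreal (2 * (norm (U \<omega>))\<^sup>2 + 2 * (norm (V \<omega>))\<^sup>2)"
      by (intro ennreal_leI norm_add_square_le)
    also have "\<dots> = 2 * ennreal ((norm (U \<omega>))\<^sup>2) + 2 * ennreal ((norm (V \<omega>))\<^sup>2)"
      by (subst ennreal_plus) (auto simp: ennreal_mult)
    finally show "ennreal ((norm (U \<omega> + V \<omega>))\<^sup>2) \<le> \<dots>" .
  qed
  also have "\<dots> = 2 * (\<integral>\<^sup>+\<omega>. ennreal ((norm (U \<omega>))\<^sup>2) \<partial>M) + 2 * (\<integral>\<^sup>+\<omega>. ennreal ((norm (V \<omega>))\<^sup>2) \<partial>M)"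
    by (simp add: nn_integral_add nn_integral_cmult)
  also have "\<dots> \<le> 2 * ennreal a + 2 * ennreal b" by (intro add_mono mult_left_mono assms) auto
  also have "\<dots> = ennreal (2 * a + 2 * b)" using ab by (subst ennreal_plus) (auto simp: ennreal_mult)
  finally show ?thesis .
qed

locale gaussian_expansion = prob_space M + eigenvalue_decay lam \<alpha> \<beta>
  for M :: "'w measure" and lam :: "nat \<Rightarrow> real" and \<alpha> \<beta> :: real +
  fixes X :: "'w \<Rightarrow> 'h::{real_inner, polish_space}" and Y :: "nat \<Rightarrow> 'w \<Rightarrow> real" and e :: "nat \<Rightarrow> 'h"
  assumes X_measurable [measurable]: "X \<in> borel_measurable M"
    and KL: "karhunen_loeve M X lam Y e"
begin

lemma Y_measurable [measurable]: "i \<ge> 1 \<Longrightarrow> Y i \<in> borel_measurable M"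
  and Y_distributed: "i \<ge> 1 \<Longrightarrow> distributed M lborel (Y i) std_normal_density"
  using KL by (auto simp: karhunen_loeve_def distributed_def)

lemma norm_sum_e_square:
  assumes "finite A" "A \<subseteq> {1..}"
  shows "(norm (\<Sum>i\<in>A. c i *\<^sub>R e i))\<^sup>2 = (\<Sum>i\<in>A. (c i)\<^sup>2)"
proof -
  have orth: "e i \<bullet> e j = (if i = j then 1 else 0)" if "i \<in> A" "j \<in> A" for i j
  proof -
    have "i \<ge> 1" "j \<ge> 1" using that assms(2) by auto
    moreover have "\<forall>i\<ge>1. \<forall>j\<ge>1. e i \<bullet> e j = (if i = j then 1 else 0)"
      using KL unfolding karhunen_loeve_def by (elim conjE)
    ultimately show ?thesis by blast
  qed
  have "(norm (\<Sum>i\<in>A. c i *\<^sub>R e i))\<^sup>2 = (\<Sum>i\<in>A. (norm (c i *\<^sub>R e i))\<^sup>2)"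
    using orth by (intro norm_sum_Pythagorean assms) (auto simp: pairwise_def orthogonal_def)
  also have "\<dots> = (\<Sum>i\<in>A. (c i)\<^sup>2)"
    using orth by (intro sum.cong) (auto simp: norm_eq_sqrt_inner)
  finally show ?thesis .
qed

text \<open>Orthonormality reduces the mean square of the sum to second moments of the coefficients.\<close>

lemma nn_integral_norm_sum_e_square:
  assumes A: "finite A" "A \<subseteq> {1..}"
    and [measurable]: "\<And>i. i \<in> A \<Longrightarrow> Z i \<in> borel_measurable M"
    and le: "\<And>i. i \<in> A \<Longrightarrow> (\<integral>\<^sup>+\<omega>. ennreal ((Z i \<omega>)\<^sup>2) \<partial>M) \<le> ennreal (b i)"
    and b: "\<And>i. i \<in> A \<Longrightarrow> 0 \<le> b i"
  shows "(\<integral>\<^sup>+\<omega>. ennreal ((norm (\<Sum>i\<in>A. (sqrt (lam i) * Z i \<omega>) *\<^sub>R e i))\<^sup>2) \<partial>M) \<le> ennreal (\<Sum>i\<in>A. lam i * b i)"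
proof -
  have pos: "lam i \<ge> 0" if "i \<in> A" for i using lam_pos[of i] A that by (auto simp: less_imp_le)
  have "(\<integral>\<^sup>+\<omega>. ennreal ((norm (\<Sum>i\<in>A. (sqrt (lam i) * Z i \<omega>) *\<^sub>R e i))\<^sup>2) \<partial>M) =
      (\<integral>\<^sup>+\<omega>. (\<Sum>i\<in>A. ennreal (lam i) * ennreal ((Z i \<omega>)\<^sup>2)) \<partial>M)"
    unfolding norm_sum_e_square[OF A] using pos
    by (intro nn_integral_cong) (simp add: power_mult_distrib sum_ennreal[symmetric] ennreal_mult
        cong: sum.cong)
  also have "\<dots> = (\<Sum>i\<in>A. ennreal (lam i) * (\<integral>\<^sup>+\<omega>. ennreal ((Z i \<omega>)\<^sup>2) \<partial>M))"
    by (subst nn_integral_sum) (auto simp: nn_integral_cmult intro!: sum.cong)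
  also have "\<dots> \<le> (\<Sum>i\<in>A. ennreal (lam i) * ennreal (b i))"
    by (intro sum_mono mult_left_mono le) auto
  also have "\<dots> = ennreal (\<Sum>i\<in>A. lam i * b i)"
    using pos b by (subst sum_ennreal[symmetric]) (auto simp: ennreal_mult intro!: sum.cong)
  finally show ?thesis .
qed

lemma Y_second_moment:
  assumes "i \<ge> 1" shows "(\<integral>\<^sup>+\<omega>. ennreal ((Y i \<omega>)\<^sup>2) \<partial>M) = ennreal 1"
proof -
  have "has_bochner_integral lborel (\<lambda>x. std_normal_density x * (x - 0) ^ (2 * 1)) (fact (2 * 1) / ((2 / 1\<^sup>2) ^ 1 * fact 1))"
    by (rule normal_moment_even) simp
  then have *: "has_bochner_integral lborel (\<lambda>x. std_normal_density x * x\<^sup>2) 1"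
    by (simp add: fact_numeral)
  have "(\<integral>\<^sup>+\<omega>. ennreal ((Y i \<omega>)\<^sup>2) \<partial>M) = (\<integral>\<^sup>+x. ennreal (std_normal_density x) * ennreal (x\<^sup>2) \<partial>lborel)"
    by (rule distributed_nn_integral[OF Y_distributed[OF assms], symmetric]) simp
  also have "\<dots> = (\<integral>\<^sup>+x. ennreal (std_normal_density x * x\<^sup>2) \<partial>lborel)"
    by (intro nn_integral_cong ennreal_mult[symmetric]) auto
  also have "\<dots> = ennreal (\<integral>x. std_normal_density x * x\<^sup>2 \<partial>lborel)"
    using * by (intro nn_integral_eq_integral) (auto simp: has_bochner_integral_iff)
  also have "(\<integral>x. std_normal_density x * x\<^sup>2 \<partial>lborel) = 1" using * by (simp add: has_bochner_integral_iff)
  finally show ?thesis .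
qed

definition partial_sum :: "nat \<Rightarrow> 'w \<Rightarrow> 'h" where
  "partial_sum n \<omega> = (\<Sum>i=1..n. (sqrt (lam i) * Y i \<omega>) *\<^sub>R e i)"

lemma partial_sum_measurable [measurable]: "partial_sum n \<in> borel_measurable M"
  unfolding partial_sum_def[abs_def]
  by (intro borel_measurable_sum borel_measurable_scaleR borel_measurable_times Y_measurable) auto

text \<open>Compare with a larger partial sum, of index \<open>n\<close>: the difference of the two partial sums has mean square
  \<open>\<Sum>i\<in>{m<..n}. lam i\<close>, and the remainder vanishes for \<open>n \<rightarrow> \<infinity>\<close> by the mean square convergence of the
  expansion.  The factor \<open>2\<close> comes from \<open>norm_add_square_le\<close>.\<close>

lemma truncation_error_le:
  assumes B: "\<And>n. (\<Sum>i\<in>{m<..n}. lam i) \<le> B"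
  shows "(\<integral>\<^sup>+\<omega>. ennreal ((norm (X \<omega> - partial_sum m \<omega>))\<^sup>2) \<partial>M) \<le> ennreal (2 * B)"
proof -
  define a where "a n = (\<integral>\<^sup>+\<omega>. ennreal ((norm (X \<omega> - partial_sum n \<omega>))\<^sup>2) \<partial>M)" for n
  have a0: "a \<longlonglongrightarrow> 0" using KL unfolding karhunen_loeve_def a_def partial_sum_def by (elim conjE)
  have B0: "B \<ge> 0" using B[of 0] by simp
  have le: "a m \<le> 2 * a n + ennreal (2 * B)" if n: "n \<ge> m" for n
  proof (cases "a n < \<top>")
    case True
    define r where "r = enn2real (a n)"
    have r: "a n = ennreal r" "r \<ge> 0" using True by (auto simp: r_def)
    have diff: "partial_sum n \<omega> - partial_sum m \<omega> = (\<Sum>i\<in>{m<..n}. (sqrt (lam i) * Y i \<omega>) *\<^sub>R e i)" for \<omega>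
    proof -
      have "{1..n} = {1..m} \<union> {m<..n}" using n by auto
      then have "partial_sum n \<omega> = partial_sum m \<omega> + (\<Sum>i\<in>{m<..n}. (sqrt (lam i) * Y i \<omega>) *\<^sub>R e i)"
        unfolding partial_sum_def by (simp only:) (rule sum.union_disjoint, auto)
      then show ?thesis by simp
    qed
    have "(\<integral>\<^sup>+\<omega>. ennreal ((norm (partial_sum n \<omega> - partial_sum m \<omega>))\<^sup>2) \<partial>M) \<le> ennreal (\<Sum>i\<in>{m<..n}. lam i * 1)"
      unfolding diff by (rule nn_integral_norm_sum_e_square) (auto simp: Y_second_moment)
    also have "\<dots> \<le> ennreal B" using B[of n] by (intro ennreal_leI) simp
    finally have d: "(\<integral>\<^sup>+\<omega>. ennreal ((norm (partial_sum n \<omega> - partial_sum m \<omega>))\<^sup>2) \<partial>M) \<le> ennreal B" .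
    have "a m = (\<integral>\<^sup>+\<omega>. ennreal ((norm ((X \<omega> - partial_sum n \<omega>) + (partial_sum n \<omega> - partial_sum m \<omega>)))\<^sup>2) \<partial>M)"
      by (simp add: a_def)
    also have "\<dots> \<le> ennreal (2 * r + 2 * B)"
      by (rule nn_integral_norm_add_square_le) (use r B0 d in \<open>auto simp: a_def\<close>)
    also have "\<dots> = 2 * a n + ennreal (2 * B)" using r B0 by (simp add: ennreal_plus ennreal_mult)
    finally show ?thesis .
  qed (simp add: not_less top_unique ennreal_mult_top)
  have "(\<lambda>n. 2 * a n + ennreal (2 * B)) \<longlonglongrightarrow> 2 * 0 + ennreal (2 * B)"
    by (intro tendsto_add tendsto_const ennreal_tendsto_cmult a0) simp
  then have "a m \<le> 2 * 0 + ennreal (2 * B)"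
    by (rule LIMSEQ_le_const) (use le in blast)
  then show ?thesis by (simp add: a_def)
qed

definition approx :: "nat \<Rightarrow> 'h \<Rightarrow> 'h" where
  "approx l = bit_approx lam e (2 ^ l) (bit_number \<alpha> \<beta> (2 ^ l))"

lemma approx_measurable [measurable]: "approx l \<in> borel_measurable borel"
  unfolding approx_def bit_approx_def[abs_def] coordinate_def by measurable

text \<open>Almost surely the coordinates of \<open>X\<close> are the variables \<open>Y i\<close>, so that the coefficients of the
  difference are the rounding errors of standard normal variables.\<close>

lemma quantisation_error_le:
  "(\<integral>\<^sup>+\<omega>. ennreal ((norm (partial_sum (2 ^ l) \<omega> - approx l (X \<omega>)))\<^sup>2) \<partial>M) \<le>
     ennreal (quantisation_constant * (\<Sum>i=1..2 ^ l. lam i / 2 ^ bit_number \<alpha> \<beta> (2 ^ l) i))"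
proof -
  let ?p = "bit_number \<alpha> \<beta> (2 ^ l)"
  let ?Z = "\<lambda>i \<omega>. Y i \<omega> - bit_normal (?p i) (Y i \<omega>)"
  have "AE \<omega> in M. \<forall>i\<in>{1..2 ^ l}. coordinate lam e (X \<omega>) i = Y i \<omega>"
    by (intro AE_finite_allI karhunen_loeve_coordinate[OF prob_space_axioms X_measurable KL]) auto
  then have "AE \<omega> in M. partial_sum (2 ^ l) \<omega> - approx l (X \<omega>) = (\<Sum>i=1..2 ^ l. (sqrt (lam i) * ?Z i \<omega>) *\<^sub>R e i)"
  proof eventually_elim
    case (elim \<omega>)
    then show ?case
      unfolding partial_sum_def approx_def bit_approx_def sum_subtractf[symmetric]
      by (intro sum.cong) (auto simp: scaleR_diff_left right_diff_distrib)
  qed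
  then have "(\<integral>\<^sup>+\<omega>. ennreal ((norm (partial_sum (2 ^ l) \<omega> - approx l (X \<omega>)))\<^sup>2) \<partial>M) =
      (\<integral>\<^sup>+\<omega>. ennreal ((norm (\<Sum>i=1..2 ^ l. (sqrt (lam i) * ?Z i \<omega>) *\<^sub>R e i))\<^sup>2) \<partial>M)"
    by (intro nn_integral_cong_AE) (auto elim: eventually_mono)
  also have "\<dots> \<le> ennreal (\<Sum>i=1..2 ^ l. lam i * (quantisation_constant / 2 ^ ?p i))"
  proof (rule nn_integral_norm_sum_e_square)
    fix i assume "i \<in> {1..2 ^ l :: nat}"
    then have i: "i \<ge> 1" by simp
    note [measurable] = Y_measurable[OF i]
    show "?Z i \<in> borel_measurable M" by measurable
    show "(\<integral>\<^sup>+\<omega>. ennreal ((?Z i \<omega>)\<^sup>2) \<partial>M) \<le> ennreal (quantisation_constant / 2 ^ ?p i)"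
      by (rule bit_normal_error[OF prob_space_axioms Y_distributed[OF i]])
  qed (use quantisation_constant_pos in auto)
  also have "(\<Sum>i=1..2 ^ l. lam i * (quantisation_constant / 2 ^ ?p i)) =
      quantisation_constant * (\<Sum>i=1..2 ^ l. lam i / 2 ^ ?p i)"
    by (simp add: sum_distrib_left mult.commute)
  finally show ?thesis .
qed

lemma approximation_error:
  "\<exists>C>0. \<forall>l\<ge>1. (\<integral>\<^sup>+\<omega>. ennreal ((norm (X \<omega> - approx l (X \<omega>)))\<^sup>2) \<partial>M) \<le> ennreal (C * level_error \<alpha> \<beta> l)"
proof -
  obtain C1 where C1: "C1 > 0" "\<And>l n. l \<ge> 1 \<Longrightarrow> (\<Sum>i\<in>{2 ^ l<..n}. lam i) \<le> C1 * level_error \<alpha> \<beta> l"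
    using tail_sum_le by blast
  obtain C2 where C2: "C2 > 0" "\<And>l. l \<ge> 1 \<Longrightarrow>
      (\<Sum>i=1..2 ^ l. lam i / 2 ^ bit_number \<alpha> \<beta> (2 ^ l) i) \<le> C2 * level_error \<alpha> \<beta> l"
    using quantisation_sum_le by blast
  define C where "C = 4 * C1 + 2 * (quantisation_constant * C2)"
  show ?thesis
  proof (intro exI[of _ C] conjI allI impI)
    show "C > 0" using C1 C2 quantisation_constant_pos by (simp add: C_def add_pos_pos)
    fix l :: nat assume l: "1 \<le> l"
    have q: "(\<integral>\<^sup>+\<omega>. ennreal ((norm (partial_sum (2 ^ l) \<omega> - approx l (X \<omega>)))\<^sup>2) \<partial>M) \<le>
        ennreal (quantisation_constant * (C2 * level_error \<alpha> \<beta> l))"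
      using C2(2)[OF l] quantisation_constant_pos
      by (intro order_trans[OF quantisation_error_le] ennreal_leI mult_left_mono) auto
    have "(\<integral>\<^sup>+\<omega>. ennreal ((norm ((X \<omega> - partial_sum (2 ^ l) \<omega>) + (partial_sum (2 ^ l) \<omega> - approx l (X \<omega>))))\<^sup>2) \<partial>M) \<le>
        ennreal (2 * (2 * (C1 * level_error \<alpha> \<beta> l)) + 2 * (quantisation_constant * (C2 * level_error \<alpha> \<beta> l)))"
      using level_error_pos[OF l, of \<alpha> \<beta>] C1 C2 quantisation_constant_pos
      by (intro nn_integral_norm_add_square_le truncation_error_le[OF C1(2)[OF l]] q) auto
    then show "(\<integral>\<^sup>+\<omega>. ennreal ((norm (X \<omega> - approx l (X \<omega>)))\<^sup>2) \<partial>M) \<le> ennreal (C * level_error \<alpha> \<beta> l)"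
      by (simp add: C_def algebra_simps)
  qed
qed

lemma X_second_moment: "(\<integral>\<^sup>+\<omega>. ennreal ((norm (X \<omega>))\<^sup>2) \<partial>M) < \<top>"
proof -
  obtain C1 where C1: "C1 > 0" "\<And>l n. l \<ge> 1 \<Longrightarrow> (\<Sum>i\<in>{2 ^ l<..n}. lam i) \<le> C1 * level_error \<alpha> \<beta> l"
    using tail_sum_le by blast
  let ?B = "C1 * level_error \<alpha> \<beta> 1"
  have 1: "(\<integral>\<^sup>+\<omega>. ennreal ((norm (X \<omega> - partial_sum (2 ^ 1) \<omega>))\<^sup>2) \<partial>M) \<le> ennreal (2 * ?B)"
    by (intro truncation_error_le C1) simp
  have 2: "(\<integral>\<^sup>+\<omega>. ennreal ((norm (partial_sum (2 ^ 1) \<omega>))\<^sup>2) \<partial>M) \<le> ennreal (\<Sum>i\<in>{1..2 ^ 1}. lam i * 1)"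
    unfolding partial_sum_def by (rule nn_integral_norm_sum_e_square) (auto simp: Y_second_moment)
  have nn: "0 \<le> (\<Sum>i\<in>{1..2 ^ 1 :: nat}. lam i * 1)" by (intro sum_nonneg) (auto intro!: less_imp_le[OF lam_pos])
  have "(\<integral>\<^sup>+\<omega>. ennreal ((norm ((X \<omega> - partial_sum (2 ^ 1) \<omega>) + partial_sum (2 ^ 1) \<omega>))\<^sup>2) \<partial>M) \<le>
      ennreal (2 * (2 * ?B) + 2 * (\<Sum>i\<in>{1..2 ^ 1}. lam i * 1))"
    using level_error_pos[of 1 \<alpha> \<beta>] C1(1) nn
    by (intro nn_integral_norm_add_square_le 1 2) (auto simp del: One_nat_def)
  then show ?thesis by (simp add: le_less_trans)
qed

end

section \<open>Error of the multilevel algorithm\<close>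

lemma square_integrable_of_nn_integral:
  fixes Z :: "'a \<Rightarrow> real"
  assumes [measurable]: "Z \<in> borel_measurable M"
    and le: "(\<integral>\<^sup>+\<omega>. ennreal ((Z \<omega>)\<^sup>2) \<partial>M) \<le> ennreal v" and v: "v \<ge> 0"
  shows "integrable M (\<lambda>\<omega>. (Z \<omega>)\<^sup>2)" and "(\<integral>\<omega>. (Z \<omega>)\<^sup>2 \<partial>M) \<le> v"
proof -
  show int: "integrable M (\<lambda>\<omega>. (Z \<omega>)\<^sup>2)"
    using le by (intro integrableI_nonneg) (auto simp: le_less_trans)
  have "ennreal (\<integral>\<omega>. (Z \<omega>)\<^sup>2 \<partial>M) = (\<integral>\<^sup>+\<omega>. ennreal ((Z \<omega>)\<^sup>2) \<partial>M)"
    by (rule nn_integral_eq_integral[OF int, symmetric]) auto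
  then have "ennreal (\<integral>\<omega>. (Z \<omega>)\<^sup>2 \<partial>M) \<le> ennreal v" using le by (simp only:)
  then show "(\<integral>\<omega>. (Z \<omega>)\<^sup>2 \<partial>M) \<le> v" by (simp only: ennreal_le_iff[OF v])
qed

context prob_space begin

text \<open>The variance of a sum of independent variables, stated for centred variables.\<close>

lemma expectation_square_sum_indep:
  fixes Z :: "'i \<Rightarrow> 'a \<Rightarrow> real"
  assumes "finite I" and "indep_vars (\<lambda>_. borel) Z I"
    and "\<And>i. i \<in> I \<Longrightarrow> integrable M (\<lambda>\<omega>. (Z i \<omega>)\<^sup>2)" and "\<And>i. i \<in> I \<Longrightarrow> expectation (Z i) = 0"
  shows "integrable M (\<lambda>\<omega>. (\<Sum>i\<in>I. Z i \<omega>)\<^sup>2) \<and>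
    expectation (\<lambda>\<omega>. (\<Sum>i\<in>I. Z i \<omega>)\<^sup>2) = (\<Sum>i\<in>I. expectation (\<lambda>\<omega>. (Z i \<omega>)\<^sup>2))"
  using assms
proof (induction I rule: finite_induct)
  case (insert i I)
  let ?S = "\<lambda>\<omega>. \<Sum>i\<in>I. Z i \<omega>"
  have rv [measurable]: "Z j \<in> borel_measurable M" if "j \<in> insert i I" for j
    using insert.prems(1) that by (auto simp: indep_vars_def)
  have Zi: "integrable M (Z j)" if "j \<in> insert i I" for j
    using square_integrable_imp_integrable[OF rv[OF that] insert.prems(2)[OF that]] .
  have IH: "integrable M (\<lambda>\<omega>. (?S \<omega>)\<^sup>2)"
    "expectation (\<lambda>\<omega>. (?S \<omega>)\<^sup>2) = (\<Sum>i\<in>I. expectation (\<lambda>\<omega>. (Z i \<omega>)\<^sup>2))"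
    using insert.IH insert.prems indep_vars_subset[OF insert.prems(1), of I] by auto
  have iv: "indep_var borel (Z i) borel ?S"
    by (rule indep_vars_sum[OF insert.hyps insert.prems(1)])
  have S: "integrable M ?S" using Zi by (intro Bochner_Integration.integrable_sum) auto
  have prod: "integrable M (\<lambda>\<omega>. Z i \<omega> * ?S \<omega>)" "expectation (\<lambda>\<omega>. Z i \<omega> * ?S \<omega>) = 0"
    using indep_var_integrable[OF iv Zi S] indep_var_lebesgue_integral[OF iv Zi S] insert.prems(3)[of i]
    by auto
  have eq: "(\<Sum>j\<in>insert i I. Z j \<omega>)\<^sup>2 = (Z i \<omega>)\<^sup>2 + (?S \<omega>)\<^sup>2 + 2 * (Z i \<omega> * ?S \<omega>)" for \<omega>
    using insert.hyps by (simp add: power2_sum)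
  show ?case unfolding eq using insert.prems(2)[of i] IH prod insert.hyps by auto
qed simp

lemma expectation_square_le:
  fixes Z :: "'a \<Rightarrow> real"
  assumes [measurable]: "Z \<in> borel_measurable M" and "integrable M (\<lambda>\<omega>. (Z \<omega>)\<^sup>2)"
  shows "(expectation Z)\<^sup>2 \<le> expectation (\<lambda>\<omega>. (Z \<omega>)\<^sup>2)"
  using variance_eq[OF square_integrable_imp_integrable[OF assms] assms(2)] variance_positive[of Z] by simp

end

lemma Lip1_abs_diff_le:
  assumes "f \<in> Lip1" shows "\<bar>f x - f y\<bar> \<le> norm (x - y)"
  using lipschitz_onD[of 1 UNIV f x y] assms by (simp add: Lip1_def dist_norm)

lemma Lip1_square_diff_le:
  assumes "f \<in> Lip1" shows "(f x - f y)\<^sup>2 \<le> (norm (x - y))\<^sup>2"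
  using power_mono[OF Lip1_abs_diff_le[OF assms] abs_ge_zero, of x y 2] by simp

lemma Lip1_measurable: "f \<in> Lip1 \<Longrightarrow> f \<in> borel_measurable borel"
  unfolding Lip1_def by (intro borel_measurable_continuous_onI lipschitz_on_continuous_on) auto

context gaussian_expansion begin

abbreviation level :: "('h \<Rightarrow> real) \<Rightarrow> nat \<Rightarrow> 'h \<Rightarrow> real" where
  "level f l \<equiv> level_value lam e (bit_number \<alpha> \<beta>) l f"

lemma level_eq: "level f l x = f (approx l x) - (if l = 1 then 0 else f (approx (l - 1) x))"
  by (simp add: level_value_def approx_def)

lemma level_measurable [measurable]: "f \<in> Lip1 \<Longrightarrow> level f l \<in> borel_measurable borel"
  unfolding level_eq[abs_def] using Lip1_measurable[of f, measurable] by measurable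

text \<open>For \<open>l \<ge> 2\<close> the difference of two consecutive approximations is of the order of the error of
  the coarser one, which is comparable to that of the finer one.  For \<open>l = 1\<close> there is no difference;
  subtracting \<open>f 0\<close> makes the estimate uniform over all Lipschitz functions and
  does not affect the variance.\<close>

lemma level_second_moment:
  "\<exists>C>0. \<forall>f\<in>Lip1. \<forall>l\<ge>1.
     (\<integral>\<^sup>+\<omega>. ennreal ((level f l (X \<omega>) - (if l = 1 then f 0 else 0))\<^sup>2) \<partial>M) \<le> ennreal (C * level_error \<alpha> \<beta> l)"
proof -
  obtain C where C: "C > 0" "\<And>l. l \<ge> 1 \<Longrightarrow>
      (\<integral>\<^sup>+\<omega>. ennreal ((norm (X \<omega> - approx l (X \<omega>)))\<^sup>2) \<partial>M) \<le> ennreal (C * level_error \<alpha> \<beta> l)"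
    using approximation_error by blast
  have C': "(\<integral>\<^sup>+\<omega>. ennreal ((norm (approx l (X \<omega>) - X \<omega>))\<^sup>2) \<partial>M) \<le> ennreal (C * level_error \<alpha> \<beta> l)"
    if "l \<ge> 1" for l using C(2)[OF that] by (simp add: norm_minus_commute)
  define s where "s = enn2real (\<integral>\<^sup>+\<omega>. ennreal ((norm (X \<omega>))\<^sup>2) \<partial>M)"
  have s: "s \<ge> 0" "(\<integral>\<^sup>+\<omega>. ennreal ((norm (X \<omega>))\<^sup>2) \<partial>M) \<le> ennreal s"
    using X_second_moment by (simp_all add: s_def)
  define c where "c = 2 powr (\<beta> - 1) * 2 powr \<bar>\<alpha>\<bar>"
  define A where "A = 2 * s / level_error \<alpha> \<beta> 1 + 2 * C + 2 * C * c"
  have A: "A \<ge> 2 * s / level_error \<alpha> \<beta> 1 + 2 * C" "A \<ge> 2 * C + 2 * C * c" "A > 0"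
    using C(1) s(1) level_error_pos[of 1 \<alpha> \<beta>] by (auto simp: A_def c_def add_nonneg_pos add_pos_nonneg)
  show ?thesis
  proof (intro exI[of _ A] conjI ballI allI impI A(3))
    fix f :: "'h \<Rightarrow> real" and l :: nat assume f: "f \<in> Lip1" and l: "1 \<le> l"
    define D where "D x = approx l x - (if l = 1 then 0 else approx (l - 1) x)" for x
    have "\<bar>level f l x - (if l = 1 then f 0 else 0)\<bar> \<le> norm (D x)" for x
      using Lip1_abs_diff_le[OF f, of "approx l x"] by (auto simp: level_eq D_def) (metis diff_zero)
    then have "(level f l x - (if l = 1 then f 0 else 0))\<^sup>2 \<le> (norm (D x))\<^sup>2" for x
      using power_mono[of "\<bar>level f l x - (if l = 1 then f 0 else 0)\<bar>" "norm (D x)" 2] by simp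
    then have "(\<integral>\<^sup>+\<omega>. ennreal ((level f l (X \<omega>) - (if l = 1 then f 0 else 0))\<^sup>2) \<partial>M) \<le>
        (\<integral>\<^sup>+\<omega>. ennreal ((norm (D (X \<omega>)))\<^sup>2) \<partial>M)"
      by (intro nn_integral_mono ennreal_leI)
    also have "\<dots> \<le> ennreal (A * level_error \<alpha> \<beta> l)"
    proof (cases "l = 1")
      case True
      have "(\<integral>\<^sup>+\<omega>. ennreal ((norm (D (X \<omega>)))\<^sup>2) \<partial>M) =
          (\<integral>\<^sup>+\<omega>. ennreal ((norm (X \<omega> + (approx l (X \<omega>) - X \<omega>)))\<^sup>2) \<partial>M)"
        using True by (simp add: D_def)
      also have "\<dots> \<le> ennreal (2 * s + 2 * (C * level_error \<alpha> \<beta> l))"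
        using s C(1) level_error_pos[OF l, of \<alpha> \<beta>] by (intro nn_integral_norm_add_square_le C' l) auto
      also have "2 * s + 2 * (C * level_error \<alpha> \<beta> l) = (2 * s / level_error \<alpha> \<beta> 1 + 2 * C) * level_error \<alpha> \<beta> l"
        using level_error_pos[of 1 \<alpha> \<beta>] True by (simp add: field_simps)
      also have "\<dots> \<le> A * level_error \<alpha> \<beta> l"
        using A(1) level_error_pos[OF l, of \<alpha> \<beta>] by (intro mult_right_mono) auto
      finally show ?thesis by (simp add: ennreal_leI)
    next
      case False
      then have l1: "l - 1 \<ge> 1" "l - 1 + 1 = l" using l by auto
      have "(\<integral>\<^sup>+\<omega>. ennreal ((norm (D (X \<omega>)))\<^sup>2) \<partial>M) =
          (\<integral>\<^sup>+\<omega>. ennreal ((norm ((approx l (X \<omega>) - X \<omega>) + (X \<omega> - approx (l - 1) (X \<omega>))))\<^sup>2) \<partial>M)"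
        using False by (simp add: D_def)
      also have "\<dots> \<le> ennreal (2 * (C * level_error \<alpha> \<beta> l) + 2 * (C * level_error \<alpha> \<beta> (l - 1)))"
        using C(1) level_error_pos[OF l, of \<alpha> \<beta>] level_error_pos[OF l1(1), of \<alpha> \<beta>]
        by (intro nn_integral_norm_add_square_le C' C(2) l l1(1)) auto
      also have "2 * (C * level_error \<alpha> \<beta> l) + 2 * (C * level_error \<alpha> \<beta> (l - 1)) \<le>
          2 * (C * level_error \<alpha> \<beta> l) + 2 * (C * (c * level_error \<alpha> \<beta> l))"
      proof -
        have "real (l - 1) powr (- \<alpha>) \<le> 2 powr \<bar>\<alpha>\<bar> * real l powr (- \<alpha>)"
          using powr_shift_le(2)[OF l1(1), of "- \<alpha>" 1] l1(2) by simp
        moreover have "2 powr ((1 - \<beta>) * real (l - 1)) = 2 powr (\<beta> - 1) * 2 powr ((1 - \<beta>) * real l)"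
          using l by (simp add: powr_add[symmetric] of_nat_diff algebra_simps)
        ultimately have "level_error \<alpha> \<beta> (l - 1) \<le> 2 powr (\<beta> - 1) * 2 powr ((1 - \<beta>) * real l) * (2 powr \<bar>\<alpha>\<bar> * real l powr (- \<alpha>))"
          unfolding level_error_def by (simp only:) (intro mult_left_mono, auto)
        then have "level_error \<alpha> \<beta> (l - 1) \<le> c * level_error \<alpha> \<beta> l"
          by (simp add: level_error_def c_def mult_ac)
        then show ?thesis using C(1) by simp
      qed
      also have "\<dots> = (2 * C + 2 * C * c) * level_error \<alpha> \<beta> l" by (simp add: algebra_simps)
      also have "\<dots> \<le> A * level_error \<alpha> \<beta> l"
        using A(2) level_error_pos[OF l, of \<alpha> \<beta>] by (intro mult_right_mono) auto
      finally show ?thesis by (simp add: ennreal_leI)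
    qed
    finally show "(\<integral>\<^sup>+\<omega>. ennreal ((level f l (X \<omega>) - (if l = 1 then f 0 else 0))\<^sup>2) \<partial>M) \<le> ennreal (A * level_error \<alpha> \<beta> l)" .
  qed
qed

lemma Lip1_integrable:
  assumes f: "f \<in> Lip1" shows "integrable M (\<lambda>\<omega>. f (X \<omega>))"
proof -
  note [measurable] = Lip1_measurable[OF f]
  have "(\<integral>\<^sup>+\<omega>. ennreal ((f (X \<omega>) - f 0)\<^sup>2) \<partial>M) \<le> (\<integral>\<^sup>+\<omega>. ennreal ((norm (X \<omega>))\<^sup>2) \<partial>M)"
    using Lip1_square_diff_le[OF f, of _ 0]
    by (intro nn_integral_mono ennreal_leI) simp
  also have "\<dots> \<le> ennreal (enn2real (\<integral>\<^sup>+\<omega>. ennreal ((norm (X \<omega>))\<^sup>2) \<partial>M))"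
    using X_second_moment by simp
  finally have "integrable M (\<lambda>\<omega>. (f (X \<omega>) - f 0)\<^sup>2)"
    by (rule square_integrable_of_nn_integral(1)[rotated]) auto
  then have "integrable M (\<lambda>\<omega>. f (X \<omega>) - f 0)" by (rule square_integrable_imp_integrable[rotated]) measurable
  then have "integrable M (\<lambda>\<omega>. (f (X \<omega>) - f 0) + f 0)" by (rule Bochner_Integration.integrable_add) simp
  then show ?thesis by simp
qed

lemma bias_square_le:
  assumes f: "f \<in> Lip1" and v: "v \<ge> 0"
    and le: "(\<integral>\<^sup>+\<omega>. ennreal ((norm (X \<omega> - approx l (X \<omega>)))\<^sup>2) \<partial>M) \<le> ennreal v"
  shows "integrable M (\<lambda>\<omega>. f (approx l (X \<omega>)))"
    and "((\<integral>\<omega>. f (X \<omega>) \<partial>M) - (\<integral>\<omega>. f (approx l (X \<omega>)) \<partial>M))\<^sup>2 \<le> v"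
proof -
  note [measurable] = Lip1_measurable[OF f]
  let ?D = "\<lambda>\<omega>. f (X \<omega>) - f (approx l (X \<omega>))"
  have "(\<integral>\<^sup>+\<omega>. ennreal ((?D \<omega>)\<^sup>2) \<partial>M) \<le> (\<integral>\<^sup>+\<omega>. ennreal ((norm (X \<omega> - approx l (X \<omega>)))\<^sup>2) \<partial>M)"
    by (intro nn_integral_mono ennreal_leI Lip1_square_diff_le f)
  also note le
  finally have le_v: "(\<integral>\<^sup>+\<omega>. ennreal ((?D \<omega>)\<^sup>2) \<partial>M) \<le> ennreal v" .
  have measD: "?D \<in> borel_measurable M" by measurable
  note D = square_integrable_of_nn_integral[OF measD le_v v]
  have intD: "integrable M ?D" by (rule square_integrable_imp_integrable[OF measD D(1)])
  have "integrable M (\<lambda>\<omega>. f (X \<omega>) - ?D \<omega>)" by (rule Bochner_Integration.integrable_diff[OF Lip1_integrable[OF f] intD])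
  then show int: "integrable M (\<lambda>\<omega>. f (approx l (X \<omega>)))" by simp
  have "((\<integral>\<omega>. f (X \<omega>) \<partial>M) - (\<integral>\<omega>. f (approx l (X \<omega>)) \<partial>M)) = expectation ?D"
    by (rule Bochner_Integration.integral_diff[symmetric, OF Lip1_integrable[OF f] int])
  then show "((\<integral>\<omega>. f (X \<omega>) \<partial>M) - (\<integral>\<omega>. f (approx l (X \<omega>)) \<partial>M))\<^sup>2 \<le> v"
    using expectation_square_le[OF measD D(1)] D(2) by (simp only:)
qed

text \<open>The expectation of the algorithm telescopes to that of \<open>f\<close> at the finest approximation, hence
  the error is the sum of the bias and of a centred sum of independent variables; the sum over
  the samples of level \<open>l\<close> has variance at most \<open>N l * (v l / (N l)\<^sup>2) = v l / N l\<close>.\<close>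

lemma multilevel_error_le:
  assumes copies: "independent_copies M X P Xc" and f: "f \<in> Lip1"
    and L: "L \<ge> 1" and N: "\<And>l. l \<in> {1..L} \<Longrightarrow> N l \<ge> 1"
    and v: "\<And>l. l \<in> {1..L} \<Longrightarrow> v l \<ge> 0"
      "\<And>l. l \<in> {1..L} \<Longrightarrow> (\<integral>\<^sup>+\<omega>. ennreal ((level f l (X \<omega>) - (if l = 1 then f 0 else 0))\<^sup>2) \<partial>M) \<le> ennreal (v l)"
    and w: "w \<ge> 0" "\<And>l. l \<in> {1..L} \<Longrightarrow> (\<integral>\<^sup>+\<omega>. ennreal ((norm (X \<omega> - approx l (X \<omega>)))\<^sup>2) \<partial>M) < \<top>"
      "(\<integral>\<^sup>+\<omega>. ennreal ((norm (X \<omega> - approx L (X \<omega>)))\<^sup>2) \<partial>M) \<le> ennreal w"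
  shows "(\<integral>\<^sup>+\<omega>. ennreal (\<bar>(\<integral>\<omega>. f (X \<omega>) \<partial>M) - multilevel lam e (bit_number \<alpha> \<beta>) L N Xc f \<omega>\<bar>\<^sup>2) \<partial>P)
    \<le> ennreal (2 * w + 2 * (\<Sum>l=1..L. v l / real (N l)))"
proof -
  interpret P: prob_space P using copies by (simp add: independent_copies_def)
  note [measurable] = level_measurable[OF f] Lip1_measurable[OF f]
  define I where "I = Sigma {1..L} (\<lambda>l. {1..N l})"
  \<comment> \<open>the constant that is subtracted on level 1 to bound second moments uniformly in \<open>f\<close>\<close>
  define \<kappa> where "\<kappa> l = (if l = (1::nat) then f 0 else 0)" for l
  define \<mu> where "\<mu> l = (\<integral>\<omega>. level f l (X \<omega>) - \<kappa> l \<partial>M)" for l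
  define Z where "Z = (\<lambda>(l, j) \<omega>. (level f l (Xc l j \<omega>) - \<kappa> l - \<mu> l) / real (N l))"
  have Xc [measurable]: "Xc l j \<in> borel_measurable P" if "l \<ge> 1" "j \<ge> 1" for l j
    using copies that by (auto simp: independent_copies_def P.indep_vars_def)
  have Xd: "distr P borel (Xc l j) = distr M borel X" if "l \<ge> 1" "j \<ge> 1" for l j
    using copies that by (auto simp: independent_copies_def)
  have transfer: "(\<integral>\<^sup>+\<omega>. g (Xc l j \<omega>) \<partial>P) = (\<integral>\<^sup>+\<omega>. g (X \<omega>) \<partial>M)"
    if "l \<ge> 1" "j \<ge> 1" and [measurable]: "g \<in> borel_measurable borel" for l j and g :: "'h \<Rightarrow> ennreal"
    using nn_integral_distr[OF Xc[OF that(1,2)], of g] nn_integral_distr[OF X_measurable, of g] Xd[OF that(1,2)]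
    by simp
  have transfer': "(\<integral>\<omega>. g (Xc l j \<omega>) \<partial>P) = (\<integral>\<omega>. g (X \<omega>) \<partial>M)"
    if "l \<ge> 1" "j \<ge> 1" and [measurable]: "g \<in> borel_measurable borel" for l j and g :: "'h \<Rightarrow> real"
    using integral_distr[OF Xc[OF that(1,2)], of g] integral_distr[OF X_measurable, of g] Xd[OF that(1,2)]
    by simp
  have finI: "finite I" by (simp add: I_def)
  have I: "l \<in> {1..L}" "l \<ge> 1" "j \<ge> 1" "N l \<ge> 1" if "(l, j) \<in> I" for l j
    using that N[of l] by (auto simp: I_def)
  have u: "integrable M (\<lambda>\<omega>. (level f l (X \<omega>) - \<kappa> l)\<^sup>2)" "(\<integral>\<omega>. (level f l (X \<omega>) - \<kappa> l)\<^sup>2 \<partial>M) \<le> v l"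
    if "l \<in> {1..L}" for l
    unfolding \<kappa>_def
    by (rule square_integrable_of_nn_integral[OF _ v(2)[OF that] v(1)[OF that]]; measurable)+
  have u1: "integrable M (\<lambda>\<omega>. level f l (X \<omega>) - \<kappa> l)" if "l \<in> {1..L}" for l
    using u(1)[OF that] by (rule square_integrable_imp_integrable[rotated]) measurable
  have ind: "P.indep_vars (\<lambda>_. borel) Z I"
  proof -
    have "P.indep_vars (\<lambda>_. borel) (\<lambda>(l, j). Xc l j) ({1..} \<times> {1..})"
      using copies by (simp add: independent_copies_def)
    then have "P.indep_vars (\<lambda>_. borel) (\<lambda>(l, j). Xc l j) I"
      by (rule P.indep_vars_subset) (auto simp: I_def)
    from P.indep_vars_compose2[OF this, of "\<lambda>z x. (level f (fst z) x - \<kappa> (fst z) - \<mu> (fst z)) / real (N (fst z))" "\<lambda>_. borel"]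
    show ?thesis by (simp add: Z_def case_prod_beta')
  qed
  have Z: "integrable P (\<lambda>\<omega>. (Z z \<omega>)\<^sup>2) \<and> P.expectation (Z z) = 0 \<and>
      P.expectation (\<lambda>\<omega>. (Z z \<omega>)\<^sup>2) \<le> v (fst z) / (real (N (fst z)))\<^sup>2" if "z \<in> I" for z
  proof -
    obtain l j where z: "z = (l, j)" by (cases z)
    note lj = I[OF that[unfolded z]]
    note [measurable] = Xc[OF lj(2,3)]
    let ?U = "\<lambda>\<omega>. level f l (Xc l j \<omega>) - \<kappa> l"
    have "(\<integral>\<^sup>+\<omega>. ennreal ((?U \<omega>)\<^sup>2) \<partial>P) = (\<integral>\<^sup>+\<omega>. ennreal ((level f l (X \<omega>) - \<kappa> l)\<^sup>2) \<partial>M)"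
      by (rule transfer[OF lj(2,3)]) measurable
    also have "\<dots> \<le> ennreal (v l)" using v(2)[OF lj(1)] by (simp add: \<kappa>_def)
    finally have le_v: "(\<integral>\<^sup>+\<omega>. ennreal ((?U \<omega>)\<^sup>2) \<partial>P) \<le> ennreal (v l)" .
    have measU: "?U \<in> borel_measurable P" by measurable
    note U2 = square_integrable_of_nn_integral[OF measU le_v v(1)[OF lj(1)]]
    have U1: "integrable P ?U" by (rule P.square_integrable_imp_integrable[OF measU U2(1)])
    have EU: "P.expectation ?U = \<mu> l" unfolding \<mu>_def by (rule transfer'[OF lj(2,3)]) measurable
    have sq: "(Z z \<omega>)\<^sup>2 = ((?U \<omega>)\<^sup>2 - 2 * \<mu> l * ?U \<omega> + (\<mu> l)\<^sup>2) / (real (N l))\<^sup>2" for \<omega>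
      by (simp add: Z_def z power_divide power2_diff)
    have "P.expectation (\<lambda>\<omega>. (Z z \<omega>)\<^sup>2) = (P.expectation (\<lambda>\<omega>. (?U \<omega>)\<^sup>2) - 2 * \<mu> l * \<mu> l + (\<mu> l)\<^sup>2) / (real (N l))\<^sup>2"
    proof -
      have "P.expectation (\<lambda>\<omega>. (?U \<omega>)\<^sup>2 - 2 * \<mu> l * ?U \<omega> + (\<mu> l)\<^sup>2) =
          P.expectation (\<lambda>\<omega>. (?U \<omega>)\<^sup>2) - 2 * \<mu> l * P.expectation ?U + (\<mu> l)\<^sup>2"
      proof -
        have c: "integrable P (\<lambda>\<omega>. 2 * \<mu> l * ?U \<omega>)" by (rule integrable_mult_right) (rule U1)
        have d: "integrable P (\<lambda>\<omega>. (?U \<omega>)\<^sup>2 - 2 * \<mu> l * ?U \<omega>)" by (rule Bochner_Integration.integrable_diff[OF U2(1) c])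
        have "integrable P (\<lambda>\<omega>. (\<mu> l)\<^sup>2)" by simp
        from Bochner_Integration.integral_add[OF d this] Bochner_Integration.integral_diff[OF U2(1) c]
        show ?thesis by (simp only: integral_mult_right_zero) (simp add: P.prob_space)
      qed
      then show ?thesis unfolding sq by (simp only: integral_divide_zero EU)
    qed
    also have "\<dots> \<le> v l / (real (N l))\<^sup>2"
    proof (rule divide_right_mono)
      have "2 * \<mu> l * \<mu> l = 2 * (\<mu> l)\<^sup>2" by (simp add: power2_eq_square)
      then show "P.expectation (\<lambda>\<omega>. (?U \<omega>)\<^sup>2) - 2 * \<mu> l * \<mu> l + (\<mu> l)\<^sup>2 \<le> v l"
        using U2(2) zero_le_power2[of "\<mu> l"] by linarith
    qed simp
    finally have "P.expectation (\<lambda>\<omega>. (Z z \<omega>)\<^sup>2) \<le> v (fst z) / (real (N (fst z)))\<^sup>2" by (simp add: z)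
    moreover have "integrable P (\<lambda>\<omega>. (Z z \<omega>)\<^sup>2)" unfolding sq
      by (intro integrable_divide_zero Bochner_Integration.integrable_add Bochner_Integration.integrable_diff
          integrable_mult_right U2(1) U1) simp
    moreover have "P.expectation (Z z) = 0"
    proof -
      have "Z z = (\<lambda>\<omega>. (?U \<omega> - \<mu> l) / real (N l))" by (simp add: Z_def z)
      then show ?thesis using U1 EU by (simp add: P.prob_space)
    qed
    ultimately show ?thesis by blast
  qed
  let ?S = "\<lambda>\<omega>. \<Sum>z\<in>I. Z z \<omega>"
  have S: "integrable P (\<lambda>\<omega>. (?S \<omega>)\<^sup>2)" "P.expectation (\<lambda>\<omega>. (?S \<omega>)\<^sup>2) = (\<Sum>z\<in>I. P.expectation (\<lambda>\<omega>. (Z z \<omega>)\<^sup>2))"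
    using P.expectation_square_sum_indep[OF finI ind] Z by auto
  note S(2)
  also have "(\<Sum>z\<in>I. P.expectation (\<lambda>\<omega>. (Z z \<omega>)\<^sup>2)) \<le> (\<Sum>z\<in>I. v (fst z) / (real (N (fst z)))\<^sup>2)"
    using Z by (intro sum_mono) blast
  also have "\<dots> = (\<Sum>l=1..L. \<Sum>j=1..N l. v l / (real (N l))\<^sup>2)"
    unfolding I_def by (subst sum.Sigma) (auto simp: case_prod_beta')
  also have "\<dots> = (\<Sum>l=1..L. v l / real (N l))"
    using N by (intro sum.cong) (auto simp: power2_eq_square)
  finally have ES: "P.expectation (\<lambda>\<omega>. (?S \<omega>)\<^sup>2) \<le> (\<Sum>l=1..L. v l / real (N l))" .
  define b where "b = (\<integral>\<omega>. f (X \<omega>) \<partial>M) - (\<integral>\<omega>. f (approx L (X \<omega>)) \<partial>M)"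
  have b2: "b\<^sup>2 \<le> w" unfolding b_def by (rule bias_square_le(2)[OF f w(1,3)])
  have intf: "integrable M (\<lambda>\<omega>. f (approx l (X \<omega>)))" if "l \<in> {1..L}" for l
  proof (rule bias_square_le(1)[OF f])
    show "(\<integral>\<^sup>+\<omega>. ennreal ((norm (X \<omega> - approx l (X \<omega>)))\<^sup>2) \<partial>M) \<le>
        ennreal (enn2real (\<integral>\<^sup>+\<omega>. ennreal ((norm (X \<omega> - approx l (X \<omega>)))\<^sup>2) \<partial>M))"
      using w(2)[OF that] by simp
  qed simp
  have mean: "(\<Sum>l=1..L. \<mu> l + \<kappa> l) = (\<integral>\<omega>. f (approx L (X \<omega>)) \<partial>M)"
  proof -
    \<comment> \<open>the value \<open>0\<close> at \<open>l = 0\<close> accounts for level 1, which has no coarse approximation\<close>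
    define m where "m l = (if l = 0 then 0 else (\<integral>\<omega>. f (approx l (X \<omega>)) \<partial>M))" for l :: nat
    have "\<mu> l + \<kappa> l = m l - m (l - 1)" if l: "l \<in> {1..L}" for l
    proof -
      have "\<mu> l + \<kappa> l = (\<integral>\<omega>. (level f l (X \<omega>) - \<kappa> l) + \<kappa> l \<partial>M)"
        unfolding \<mu>_def using u1[OF l] by (subst Bochner_Integration.integral_add) (auto simp: prob_space)
      also have "\<dots> = (\<integral>\<omega>. f (approx l (X \<omega>)) - (if l = 1 then 0 else f (approx (l - 1) (X \<omega>))) \<partial>M)"
        by (simp add: level_eq)
      also have "\<dots> = m l - m (l - 1)"
      proof (cases "l = 1")
        case False
        then have "l - 1 \<in> {1..L}" using l by auto
        from Bochner_Integration.integral_diff[OF intf[OF l] intf[OF this]]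
        show ?thesis using False l by (simp add: m_def)
      qed (simp add: m_def)
      finally show ?thesis .
    qed
    then have "(\<Sum>l=1..L. \<mu> l + \<kappa> l) = (\<Sum>l=1..L. m l - m (l - 1))" by (intro sum.cong) auto
    also have "\<dots> = m L - m 0"
      by (induction L) auto
    finally show ?thesis using L by (simp add: m_def)
  qed
  have eq: "(\<integral>\<omega>. f (X \<omega>) \<partial>M) - multilevel lam e (bit_number \<alpha> \<beta>) L N Xc f \<omega> = b + (- ?S \<omega>)" for \<omega>
  proof -
    have "multilevel lam e (bit_number \<alpha> \<beta>) L N Xc f \<omega> = (\<Sum>l=1..L. (\<Sum>j=1..N l. level f l (Xc l j \<omega>)) / real (N l))"
      by (rule multilevel_eq[OF L])
    also have "\<dots> = (\<Sum>l=1..L. (\<Sum>j=1..N l. Z (l, j) \<omega>) + (\<mu> l + \<kappa> l))"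
    proof (intro sum.cong refl)
      fix l assume "l \<in> {1..L}"
      then have "real (N l) > 0" using N[of l] by simp
      then show "(\<Sum>j=1..N l. level f l (Xc l j \<omega>)) / real (N l) = (\<Sum>j=1..N l. Z (l, j) \<omega>) + (\<mu> l + \<kappa> l)"
        by (simp add: Z_def sum_divide_distrib[symmetric] sum_subtractf field_simps)
    qed
    also have "\<dots> = (\<Sum>l=1..L. \<Sum>j=1..N l. Z (l, j) \<omega>) + (\<Sum>l=1..L. \<mu> l + \<kappa> l)" by (rule sum.distrib)
    also have "(\<Sum>l=1..L. \<Sum>j=1..N l. Z (l, j) \<omega>) = ?S \<omega>"
      unfolding I_def by (subst sum.Sigma) (auto simp: case_prod_beta')
    finally show ?thesis unfolding mean b_def by simp
  qed
  have [measurable]: "?S \<in> borel_measurable P"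
    using ind by (intro borel_measurable_sum) (auto simp: P.indep_vars_def)
  have "(\<integral>\<^sup>+\<omega>. ennreal ((norm (b + (- ?S \<omega>)))\<^sup>2) \<partial>P) \<le> ennreal (2 * w + 2 * (\<Sum>l=1..L. v l / real (N l)))"
  proof (rule nn_integral_norm_add_square_le)
    show "(\<integral>\<^sup>+\<omega>. ennreal ((norm b)\<^sup>2) \<partial>P) \<le> ennreal w"
      using b2 by (simp add: P.emeasure_space_1 ennreal_leI)
    have "(\<integral>\<^sup>+\<omega>. ennreal ((norm (- ?S \<omega>))\<^sup>2) \<partial>P) = ennreal (P.expectation (\<lambda>\<omega>. (?S \<omega>)\<^sup>2))"
      using S(1) by (simp add: nn_integral_eq_integral)
    then show "(\<integral>\<^sup>+\<omega>. ennreal ((norm (- ?S \<omega>))\<^sup>2) \<partial>P) \<le> ennreal (\<Sum>l=1..L. v l / real (N l))"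
      using ES by (simp add: ennreal_leI)
    show "0 \<le> (\<Sum>l=1..L. v l / real (N l))" using v(1) by (intro sum_nonneg) auto
  qed (use w in auto)
  then show ?thesis unfolding eq by simp
qed

end

text \<open>With the chosen sample sizes the summands of the variance bound are at most a constant times
  those of the level sum, divided by \<open>K_eps\<close>.\<close>

lemma multilevel_error:
  fixes M :: "'w measure" and X :: "'w \<Rightarrow> 'h::{real_inner, polish_space}"
  assumes "gaussian_expansion M lam \<alpha> \<beta> X Y e" and copies: "independent_copies M X P Xc"
  shows "preceq_on accuracies
    (\<lambda>\<epsilon>. worst_case_error P
      (multilevel lam e (bit_number \<alpha> \<beta>) (L_eps \<alpha> \<beta> \<epsilon>) (N_eps \<alpha> \<beta> \<epsilon>) Xc)
      (\<lambda>f. \<integral>\<omega>. f (X \<omega>) \<partial>M) Lip1)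
    (\<lambda>\<epsilon>. ennreal \<epsilon>)"
proof -
  interpret gaussian_expansion M lam \<alpha> \<beta> X Y e by fact
  let ?N = "N_eps \<alpha> \<beta>" and ?L = "L_eps \<alpha> \<beta>" and ?\<delta> = "level_error \<alpha> \<beta>"
  let ?G = "\<lambda>\<epsilon>. level_sum (1 - \<beta> / 2) (- \<alpha> / 2) (?L \<epsilon>)"
  obtain A where A: "A > 0" "\<And>l. l \<ge> 1 \<Longrightarrow>
      (\<integral>\<^sup>+\<omega>. ennreal ((norm (X \<omega> - approx l (X \<omega>)))\<^sup>2) \<partial>M) \<le> ennreal (A * ?\<delta> l)"
    using approximation_error by blast
  obtain V where V: "V > 0" "\<And>f l. f \<in> Lip1 \<Longrightarrow> l \<ge> 1 \<Longrightarrow>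
     (\<integral>\<^sup>+\<omega>. ennreal ((level f l (X \<omega>) - (if l = 1 then f 0 else 0))\<^sup>2) \<partial>M) \<le> ennreal (V * ?\<delta> l)"
    using level_second_moment by blast
  obtain B where B: "B > 0" "\<And>\<epsilon>. \<epsilon> \<in> accuracies \<Longrightarrow> ?\<delta> (?L \<epsilon>) \<le> B * \<epsilon>\<^sup>2"
    using bias_comparable[OF beta, of \<alpha>] unfolding comparable_on_def level_error_def by blast
  obtain G where G: "G > 0" "\<And>\<epsilon>. \<epsilon> \<in> accuracies \<Longrightarrow> ?G \<epsilon> \<le> G * (\<epsilon>\<^sup>2 * K_eps \<alpha> \<beta> \<epsilon>)"
    using level_sum_comparable[OF beta, of \<alpha>] unfolding comparable_on_def by blast
  define C where "C = 2 * (A * B) + 2 * (V * G)"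
  have C: "C > 0" using A B V G by (simp add: C_def add_pos_pos)
  show ?thesis unfolding preceq_on_def
  proof (intro exI[of _ "sqrt C"] conjI ballI)
    show "sqrt C > 0" using C by simp
    fix \<epsilon> :: real assume e: "\<epsilon> \<in> accuracies"
    then have e0: "\<epsilon> > 0" by simp
    have K: "K_eps \<alpha> \<beta> \<epsilon> > 0" by (rule K_eps_pos[OF e])
    have L: "?L \<epsilon> \<ge> 1" by (rule L_eps_bounds(3)[OF beta e])
    have \<delta>: "?\<delta> l > 0" if "l \<in> {1..?L \<epsilon>}" for l by (rule level_error_pos) (use that in simp)
    have "(\<Sum>l=1..?L \<epsilon>. V * ?\<delta> l / real (?N \<epsilon> l)) \<le> V * ?G \<epsilon> / K_eps \<alpha> \<beta> \<epsilon>"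
    proof -
      have "(\<Sum>l=1..?L \<epsilon>. V * ?\<delta> l / real (?N \<epsilon> l)) \<le>
          (\<Sum>l=1..?L \<epsilon>. V * (2 powr ((1 - \<beta> / 2) * real l) * real l powr (- \<alpha> / 2)) / K_eps \<alpha> \<beta> \<epsilon>)"
      proof (rule sum_mono)
        fix l assume l: "l \<in> {1..?L \<epsilon>}"
        let ?x = "2 powr (- real l * \<beta> / 2) * real l powr (- \<alpha> / 2)"
        have xpos: "?x > 0" using l by simp
        have deq: "?\<delta> l = ?x * (2 powr ((1 - \<beta> / 2) * real l) * real l powr (- \<alpha> / 2))"
        proof -
          have 1: "2 powr ((1 - \<beta>) * real l) = 2 powr (- real l * \<beta> / 2) * 2 powr ((1 - \<beta> / 2) * real l)"
            unfolding powr_add[symmetric]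
            by (rule arg_cong[where f = "\<lambda>t. 2 powr t"]) (simp add: field_simps)
          have 2: "real l powr (- \<alpha>) = real l powr (- \<alpha> / 2) * real l powr (- \<alpha> / 2)"
            by (simp add: powr_add[symmetric])
          show ?thesis unfolding level_error_def 1 2 by (simp only: mult_ac)
        qed
        have "V * ?\<delta> l / real (?N \<epsilon> l) \<le> V * ?\<delta> l / (?x * K_eps \<alpha> \<beta> \<epsilon>)"
        proof (rule divide_left_mono)
          show le: "?x * K_eps \<alpha> \<beta> \<epsilon> \<le> real (?N \<epsilon> l)" by (rule N_eps_bounds(1)[OF e])
          show "0 \<le> V * ?\<delta> l" using V(1) \<delta>[OF l] by simp
          have pos: "0 < ?x * K_eps \<alpha> \<beta> \<epsilon>" by (rule mult_pos_pos[OF xpos K])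
          show "0 < real (?N \<epsilon> l) * (?x * K_eps \<alpha> \<beta> \<epsilon>)"
            by (rule mult_pos_pos[OF less_le_trans[OF pos le] pos])
        qed
        also have "V * ?\<delta> l / (?x * K_eps \<alpha> \<beta> \<epsilon>) =
            V * (2 powr ((1 - \<beta> / 2) * real l) * real l powr (- \<alpha> / 2)) / K_eps \<alpha> \<beta> \<epsilon>"
          unfolding deq mult.left_commute[of V ?x]
          by (rule mult_divide_mult_cancel_left[OF less_imp_neq[OF xpos, symmetric]])
        finally show "V * ?\<delta> l / real (?N \<epsilon> l) \<le>
            V * (2 powr ((1 - \<beta> / 2) * real l) * real l powr (- \<alpha> / 2)) / K_eps \<alpha> \<beta> \<epsilon>" .
      qed
      also have "\<dots> = V * ?G \<epsilon> / K_eps \<alpha> \<beta> \<epsilon>"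
        by (simp add: level_sum_def sum_distrib_left sum_divide_distrib)
      finally show ?thesis .
    qed
    also have "\<dots> \<le> V * (G * (\<epsilon>\<^sup>2 * K_eps \<alpha> \<beta> \<epsilon>)) / K_eps \<alpha> \<beta> \<epsilon>"
      using G(2)[OF e] V(1) K by (intro divide_right_mono mult_left_mono) auto
    also have "\<dots> = V * G * \<epsilon>\<^sup>2" using K by simp
    finally have var: "(\<Sum>l=1..?L \<epsilon>. V * ?\<delta> l / real (?N \<epsilon> l)) \<le> V * G * \<epsilon>\<^sup>2" .
    have bias: "A * ?\<delta> (?L \<epsilon>) \<le> A * B * \<epsilon>\<^sup>2" using B(2)[OF e] A(1) by simp
    have err: "(\<integral>\<^sup>+\<omega>. ennreal (\<bar>(\<integral>\<omega>. f (X \<omega>) \<partial>M) - multilevel lam e (bit_number \<alpha> \<beta>) (?L \<epsilon>) (?N \<epsilon>) Xc f \<omega>\<bar>\<^sup>2) \<partial>P)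
        \<le> ennreal (C * \<epsilon>\<^sup>2)" if f: "f \<in> Lip1" for f
    proof -
      have "(\<integral>\<^sup>+\<omega>. ennreal (\<bar>(\<integral>\<omega>. f (X \<omega>) \<partial>M) - multilevel lam e (bit_number \<alpha> \<beta>) (?L \<epsilon>) (?N \<epsilon>) Xc f \<omega>\<bar>\<^sup>2) \<partial>P)
          \<le> ennreal (2 * (A * ?\<delta> (?L \<epsilon>)) + 2 * (\<Sum>l=1..?L \<epsilon>. V * ?\<delta> l / real (?N \<epsilon> l)))"
      proof (rule multilevel_error_le[OF copies f L])
        fix l assume l: "l \<in> {1..?L \<epsilon>}"
        then have l1: "l \<ge> 1" by simp
        show "?N \<epsilon> l \<ge> 1" by (rule N_eps_bounds(3)[OF e l1])
        show "0 \<le> V * ?\<delta> l" using V(1) \<delta>[OF l] by simp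
        show "(\<integral>\<^sup>+\<omega>. ennreal ((level f l (X \<omega>) - (if l = 1 then f 0 else 0))\<^sup>2) \<partial>M) \<le> ennreal (V * ?\<delta> l)"
          by (rule V(2)[OF f l1])
        show "(\<integral>\<^sup>+\<omega>. ennreal ((norm (X \<omega> - approx l (X \<omega>)))\<^sup>2) \<partial>M) < \<top>"
          by (rule le_less_trans[OF A(2)[OF l1] ennreal_less_top])
      next
        show "0 \<le> A * ?\<delta> (?L \<epsilon>)" using A(1) level_error_pos[OF L, of \<alpha> \<beta>] by simp
      qed (rule A(2)[OF L])
      also have "\<dots> \<le> ennreal (C * \<epsilon>\<^sup>2)"
        using var bias by (intro ennreal_leI) (simp add: C_def algebra_simps)
      finally show ?thesis .
    qed
    have "ennsqrt I \<le> ennreal (sqrt C) * ennreal \<epsilon>" if "I \<le> ennreal (C * \<epsilon>\<^sup>2)" for I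
    proof -
      have "I \<noteq> \<top>" using that by (auto simp: top_unique)
      moreover have "enn2real I \<le> C * \<epsilon>\<^sup>2" using that C by (simp add: enn2real_leI)
      then have "sqrt (enn2real I) \<le> sqrt (C * \<epsilon>\<^sup>2)" by (rule real_sqrt_le_mono)
      then have "sqrt (enn2real I) \<le> sqrt C * \<epsilon>" using e0 by (simp add: real_sqrt_mult)
      ultimately show ?thesis using C e0 by (simp add: ennsqrt_def ennreal_leI flip: ennreal_mult)
    qed
    then show "worst_case_error P (multilevel lam e (bit_number \<alpha> \<beta>) (?L \<epsilon>) (?N \<epsilon>) Xc) (\<lambda>f. \<integral>\<omega>. f (X \<omega>) \<partial>M) Lip1
        \<le> ennreal (sqrt C) * ennreal \<epsilon>"
      unfolding worst_case_error_def using err by (intro SUP_least) blast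
  qed
qed

section \<open>Cost of the program\<close>

text \<open>Bounds that hold for all outcomes of the random bits: the number of instructions does not
  depend on them, and the cost of an evaluation is bounded by the dimension of the subspace.\<close>

definition cost_between ::
  "(nat \<Rightarrow> 'h::real_vector) \<Rightarrow> ('h \<Rightarrow> real) \<Rightarrow> ('h, 'a) prog \<Rightarrow> nat \<Rightarrow> nat \<Rightarrow> bool" where
  "cost_between e f A a b \<longleftrightarrow> (\<forall>(x, c)\<in>set_pmf (run e f A). of_nat a \<le> c \<and> c \<le> of_nat b)"

lemma cost_between_weaken:
  assumes "cost_between e f A a b" and "a' \<le> a" "b \<le> b'"
  shows "cost_between e f A a' b'"
proof -
  have "(of_nat a' :: ennreal) \<le> of_nat a" "(of_nat b :: ennreal) \<le> of_nat b'"
    using assms(2,3) by (simp_all only: of_nat_mono)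
  then show ?thesis
    using assms(1) unfolding cost_between_def by (blast intro: order_trans)
qed

lemma cost_between_Return: "cost_between e f (Return x) 0 0"
  by (simp add: cost_between_def)

lemma run_bind_prog:
  assumes "(y, c) \<in> set_pmf (run e f (bind_prog A g))"
  shows "\<exists>x c1 c2. (x, c1) \<in> set_pmf (run e f A) \<and> (y, c2) \<in> set_pmf (run e f (g x)) \<and> c = c1 + c2"
  using assms
proof (induction A arbitrary: c)
  case (Return x)
  then show ?case by force
next
  case (Step I k)
  from Step.prems obtain r c' where r: "r \<in> set_pmf (instr_result f I)"
    and c': "(y, c') \<in> set_pmf (run e f (bind_prog (k r) g))" "c = instr_cost e I + c'"
    by auto
  from Step.IH[OF _ c'(1)] obtain x c1 c2 where
    1: "(x, c1) \<in> set_pmf (run e f (k r))" "(y, c2) \<in> set_pmf (run e f (g x))" "c' = c1 + c2" by auto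
  then have "(x, instr_cost e I + c1) \<in> set_pmf (run e f (Step I k))" using r by force
  then show ?case using 1 c'(2) by (metis add.assoc)
qed

lemma cost_between_bind:
  assumes "cost_between e f A a b" "\<And>x. cost_between e f (g x) a' b'"
  shows "cost_between e f (bind_prog A g) (a + a') (b + b')"
  unfolding cost_between_def
proof (intro ballI, clarify)
  fix y c assume "(y, c) \<in> set_pmf (run e f (bind_prog A g))"
  from run_bind_prog[OF this] obtain x c1 c2 where
    1: "(x, c1) \<in> set_pmf (run e f A)" "(y, c2) \<in> set_pmf (run e f (g x))" "c = c1 + c2" by blast
  then have "of_nat a \<le> c1" "c1 \<le> of_nat b" "of_nat a' \<le> c2" "c2 \<le> of_nat b'"
    using assms unfolding cost_between_def by blast+
  then show "of_nat (a + a') \<le> c \<and> c \<le> of_nat (b + b')" using 1 by (auto intro: add_mono)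
qed

lemma cost_between_exec:
  "instr_cost e I = 1 \<Longrightarrow> cost_between e f (exec I) 1 1"
  by (auto simp: cost_between_def exec_def)

text \<open>The cost may be smaller than \<open>m\<close> if coefficients vanish, hence only an upper bound.\<close>

lemma eval_cost_sum_le:
  assumes "m \<ge> 1" shows "eval_cost e (\<Sum>i=1..m. c i *\<^sub>R e i) \<le> of_nat m"
proof -
  have "(\<Sum>i=1..m. c i *\<^sub>R e i) \<in> span (e ` {1..m})"
  proof (rule span_sum)
    fix i assume "i \<in> {1..m}"
    then have "e i \<in> e ` {1..m}" by (rule imageI)
    then show "c i *\<^sub>R e i \<in> span (e ` {1..m})" by (intro span_scale span_base)
  qed
  moreover have "subspace_H e m = span (e ` {1..m})"
    unfolding subspace_H_def by (rule if_not_P) (use assms in linarith)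
  ultimately have "m \<in> {n. (\<Sum>i=1..m. c i *\<^sub>R e i) \<in> subspace_H e n}"
    by (simp only: mem_Collect_eq)
  then show ?thesis unfolding eval_cost_def by (rule INF_lower)
qed

lemma cost_between_evaluate:
  assumes "m \<ge> 1" shows "cost_between e f (exec (Evaluate (\<Sum>i=1..m. c i *\<^sub>R e i))) 0 m"
proof -
  have run: "set_pmf (run e f (exec (Evaluate x))) = {(f x, eval_cost e x)}" for x
    by (simp add: exec_def)
  have *: "cost_between e f (exec (Evaluate x)) 0 m" if "eval_cost e x \<le> of_nat m" for x
    using that unfolding cost_between_def run by simp
  show ?thesis by (rule *[OF eval_cost_sum_le[OF assms]])
qed

lemma cost_between_array_prog:
  assumes "\<And>i. i \<in> {1..n} \<Longrightarrow> cost_between e f (g i) (a i) (b i)"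
  shows "cost_between e f (array_prog n g) (\<Sum>i=1..n. a i) (\<Sum>i=1..n. b i)"
  using assms
proof (induction n)
  case (Suc n)
  have "cost_between e f (array_prog (Suc n) g) ((\<Sum>i=1..n. a i) + (a (Suc n) + 0)) ((\<Sum>i=1..n. b i) + (b (Suc n) + 0))"
    unfolding array_prog.simps
    by (intro cost_between_bind Suc.IH Suc.prems cost_between_Return) auto
  then show ?case by simp
qed (simp add: cost_between_Return)

lemma cost_between_sum_prog:
  assumes "\<And>i. i \<in> {1..n} \<Longrightarrow> cost_between e f (g i) (a i) (b i)"
  shows "cost_between e f (sum_prog n g) (\<Sum>i=1..n. a i + 1) (\<Sum>i=1..n. b i + 1)"
  using assms
proof (induction n)
  case (Suc n)
  have "cost_between e f (sum_prog (Suc n) g) ((\<Sum>i=1..n. a i + 1) + (a (Suc n) + 1)) ((\<Sum>i=1..n. b i + 1) + (b (Suc n) + 1))"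
    unfolding sum_prog.simps
    by (intro cost_between_bind Suc.IH Suc.prems cost_between_exec) auto
  then show ?case by simp
qed (simp add: cost_between_Return)

lemma cost_between_uniform_grid_prog: "cost_between e f (uniform_grid_prog p) (3 * p) (3 * p)"
proof (induction p)
  case (Suc p)
  have "cost_between e f (uniform_grid_prog (Suc p)) (3 * p + (1 + (1 + 1))) (3 * p + (1 + (1 + 1)))"
    unfolding uniform_grid_prog.simps by (intro cost_between_bind Suc.IH cost_between_exec) auto
  then show ?case by (rule cost_between_weaken) simp_all
qed (simp add: cost_between_Return)

lemma cost_between_bit_round_prog: "cost_between e f (bit_round_prog p u) 5 5"
proof -
  have "cost_between e f (bit_round_prog p u) (1 + (1 + (1 + (1 + 1)))) (1 + (1 + (1 + (1 + 1))))"
    unfolding bit_round_prog_def by (intro cost_between_bind cost_between_exec) auto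
  then show ?thesis by (rule cost_between_weaken) simp_all
qed

lemma cost_between_evaluate_prog:
  assumes "m \<ge> 1" shows "cost_between e f (evaluate_prog lam e m u) (3 * m) (4 * m)"
proof -
  have coeff: "cost_between e f (coefficient_prog a v) 3 3" for a v
  proof -
    have "cost_between e f (coefficient_prog a v) (1 + (1 + 1)) (1 + (1 + 1))"
      unfolding coefficient_prog_def by (intro cost_between_bind cost_between_exec) auto
    then show ?thesis by (rule cost_between_weaken) simp_all
  qed
  have "cost_between e f (evaluate_prog lam e m u) ((\<Sum>i=1..m. 3) + 0) ((\<Sum>i=1..m. 3) + m)"
    unfolding evaluate_prog_def
    by (intro cost_between_bind cost_between_array_prog coeff cost_between_evaluate assms)
  then show ?thesis by (simp add: mult.commute)
qed

text \<open>The computation of the coefficients alone exceeds the lower bound.  For the upper bound,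
  each random bit takes three instructions, and the remaining instructions and
  evaluations are linear in the number of coordinates.\<close>

lemma cost_between_level_prog:
  assumes "l \<ge> 1"
  shows "cost_between e f (level_prog lam e p l) (2 ^ l) (3 * (\<Sum>i=1..2 ^ l. p (2 ^ l) i) + 14 * 2 ^ l)"
proof -
  let ?m = "(2::nat) ^ l" and ?k = "(2::nat) ^ (l - 1)"
  have mk: "?m \<ge> 1" "?k \<ge> 1" "?k \<le> ?m" by simp_all
  let ?s = "\<Sum>i=1..?m. 3 * p ?m i"
  have "cost_between e f (level_prog lam e p l) (?s + (3 * ?m + 0))
      (?s + (4 * ?m + ((\<Sum>i=1..?k. 5) + (4 * ?k + 1))))"
    unfolding level_prog_def
  proof (intro cost_between_bind cost_between_array_prog cost_between_uniform_grid_prog cost_between_evaluate_prog mk)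
    fix u y
    show "cost_between e f (if l = 1 then Return y
      else bind_prog (array_prog ?k (\<lambda>i. bit_round_prog (p ?k i) (u i)))
        (\<lambda>v. bind_prog (evaluate_prog lam e ?k v) (\<lambda>z. exec (Subtract y z)))) 0
      ((\<Sum>i=1..?k. 5) + (4 * ?k + 1))"
    proof (cases "l = 1")
      case True
      then show ?thesis by (auto intro: cost_between_weaken[OF cost_between_Return])
    next
      case False
      have "cost_between e f (bind_prog (array_prog ?k (\<lambda>i. bit_round_prog (p ?k i) (u i)))
        (\<lambda>v. bind_prog (evaluate_prog lam e ?k v) (\<lambda>z. exec (Subtract y z))))
          ((\<Sum>i=1..?k. 5) + (3 * ?k + 1)) ((\<Sum>i=1..?k. 5) + (4 * ?k + 1))"
        by (intro cost_between_bind cost_between_array_prog cost_between_bit_round_prog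
            cost_between_evaluate_prog cost_between_exec mk) auto
      then show ?thesis using False by (auto intro: cost_between_weaken)
    qed
  qed
  then show ?thesis
  proof (rule cost_between_weaken)
    show "?s + (4 * ?m + ((\<Sum>i=1..?k. 5) + (4 * ?k + 1))) \<le> 3 * (\<Sum>i=1..?m. p ?m i) + 14 * ?m"
      using mk unfolding sum_distrib_left[symmetric] sum_constant card_atLeastAtMost of_nat_id diff_Suc_1 by linarith
  qed simp
qed

lemma cost_between_multilevel_prog:
  assumes "\<And>l. l \<in> {1..L} \<Longrightarrow> N l \<ge> 1"
    and "\<And>l. l \<in> {1..L} \<Longrightarrow> 3 * (\<Sum>i=1..2 ^ l. p (2 ^ l) i) + 17 * 2 ^ l \<le> D * 2 ^ l"
  shows "cost_between e f (multilevel_prog lam e p L N) (\<Sum>l=1..L. N l * 2 ^ l) (D * (\<Sum>l=1..L. N l * 2 ^ l))"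
proof -
  let ?b = "\<lambda>l. 3 * (\<Sum>i=1..2 ^ l. p (2 ^ l) i) + 14 * 2 ^ l"
  have "cost_between e f (multilevel_prog lam e p L N)
      (\<Sum>l=1..L. ((\<Sum>j=1..N l. 2 ^ l + 1) + 1) + 1) (\<Sum>l=1..L. ((\<Sum>j=1..N l. ?b l + 1) + 1) + 1)"
    unfolding multilevel_prog_def
    by (intro cost_between_sum_prog cost_between_bind cost_between_level_prog cost_between_exec) auto
  then show ?thesis
  proof (rule cost_between_weaken)
    show "(\<Sum>l=1..L. N l * 2 ^ l) \<le> (\<Sum>l=1..L. ((\<Sum>j=1..N l. 2 ^ l + 1) + 1) + 1)"
      by (intro sum_mono) simp
    have "(\<Sum>l=1..L. ((\<Sum>j=1..N l. ?b l + 1) + 1) + 1) \<le> (\<Sum>l=1..L. D * (N l * 2 ^ l))"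
    proof (intro sum_mono)
      fix l assume l: "l \<in> {1..L}"
      have "((\<Sum>j=1..N l. ?b l + 1) + 1) + 1 \<le> N l * (?b l + 3)"
        using assms(1)[OF l] by (simp add: algebra_simps)
      also have "\<dots> \<le> N l * (D * 2 ^ l)"
      proof (rule mult_left_mono)
        have "(1::nat) \<le> 2 ^ l" by simp
        then show "?b l + 3 \<le> D * 2 ^ l" using assms(2)[OF l] by linarith
      qed simp
      finally show "((\<Sum>j=1..N l. ?b l + 1) + 1) + 1 \<le> D * (N l * 2 ^ l)" by (simp add: mult_ac)
    qed
    then show "(\<Sum>l=1..L. ((\<Sum>j=1..N l. ?b l + 1) + 1) + 1) \<le> D * (\<Sum>l=1..L. N l * 2 ^ l)"
      by (simp only: sum_distrib_left[of D])
  qed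
qed

lemma worst_case_cost_between:
  assumes "\<And>f. f \<in> F \<Longrightarrow> cost_between e f A a b" "F \<noteq> {}"
  shows "of_nat a \<le> worst_case_cost e A F" "worst_case_cost e A F \<le> of_nat b"
proof -
  have 1: "of_nat a \<le> (\<integral>\<^sup>+c. c \<partial>measure_pmf (cost_law e f A)) \<and>
      (\<integral>\<^sup>+c. c \<partial>measure_pmf (cost_law e f A)) \<le> of_nat b" if "f \<in> F" for f
  proof
    have AE: "AE c in measure_pmf (cost_law e f A). of_nat a \<le> c \<and> c \<le> of_nat b"
      using assms(1)[OF that] by (auto simp: AE_measure_pmf_iff cost_law_def cost_between_def)
    have "(\<integral>\<^sup>+c. of_nat a \<partial>measure_pmf (cost_law e f A)) \<le> (\<integral>\<^sup>+c. c \<partial>measure_pmf (cost_law e f A))"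
      using AE by (intro nn_integral_mono_AE) auto
    then show "of_nat a \<le> (\<integral>\<^sup>+c. c \<partial>measure_pmf (cost_law e f A))" by simp
    have "(\<integral>\<^sup>+c. c \<partial>measure_pmf (cost_law e f A)) \<le> (\<integral>\<^sup>+c. of_nat b \<partial>measure_pmf (cost_law e f A))"
      using AE by (intro nn_integral_mono_AE) auto
    then show "(\<integral>\<^sup>+c. c \<partial>measure_pmf (cost_law e f A)) \<le> of_nat b" by simp
  qed
  show "of_nat a \<le> worst_case_cost e A F" "worst_case_cost e A F \<le> of_nat b"
    unfolding worst_case_cost_def using 1 assms(2) by (auto intro: SUP_upper2 SUP_least)
qed

section \<open>Number of random bits\<close>

text \<open>The elementary part of Stirling's formula.\<close>

lemma sum_ln_ge: "real m * ln (real m) - real m \<le> (\<Sum>i=1..m. ln (real i))"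
proof (induction m)
  case (Suc m)
  have "real m * (ln (real (Suc m)) - ln (real m)) \<le> 1"
  proof (cases "m = 0")
    case False
    then have "real (Suc m) / real m = 1 + 1 / real m" by (simp add: field_simps)
    then have "ln (real (Suc m)) - ln (real m) = ln (1 + 1 / real m)"
      using False ln_div[of "real (Suc m)" "real m"] by simp
    also have "\<dots> \<le> 1 / real m" by (intro ln_add_one_self_le_self) simp
    finally show ?thesis using False by (simp add: field_simps)
  qed simp
  then show ?case using Suc by (simp add: algebra_simps)
qed simp

text \<open>The ratio of the logarithms is at most \<open>2 m / i\<close>, so both terms of the bit number are controlled
  by \<open>ln (m / i)\<close>.\<close>

lemma bit_number_le:
  assumes \<beta>: "\<beta> > 0" and i: "1 \<le> i" "i \<le> m"
  shows "real (bit_number \<alpha> \<beta> m i) \<le>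
    2 + max \<alpha> 0 + (\<beta> + max \<alpha> 0) / ln 2 * (ln (real m) - ln (real i))"
proof -
  let ?a = "max \<alpha> 0"
  define t where "t = log 2 (real m / real i)"
  \<comment> \<open>the argument of the second logarithm in the bit number\<close>
  define R where "R = log 2 (real (m + 1)) / log 2 (real (i + 1))"
  have t: "t \<ge> 0" using i by (simp add: t_def)
  have ln2: "ln 2 \<ge> (1 / 2 :: real)" using ln2_ge_two_thirds by linarith
  have lni: "ln (real (i + 1)) \<ge> 1 / 2"
  proof -
    have "ln 2 \<le> ln (real (i + 1))" using i by (intro ln_mono) auto
    then show ?thesis using ln2 by linarith
  qed
  have R: "0 < R" "R \<le> 2 * (real m / real i)"
  proof -
    show "0 < R" using i by (simp add: R_def)
    have Req: "R = ln (real (m + 1)) / ln (real (i + 1))" by (simp add: R_def log_def)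
    have "real (m + 1) / real (i + 1) = 1 + (real m - real i) / real (i + 1)" by (simp add: field_simps)
    then have "ln (real (m + 1)) - ln (real (i + 1)) = ln (1 + (real m - real i) / real (i + 1))"
      using ln_div[of "real (m + 1)" "real (i + 1)"] by simp
    also have "\<dots> \<le> (real m - real i) / real (i + 1)" using i by (intro ln_add_one_self_le_self) auto
    also have "\<dots> \<le> (real m - real i) / real i" using i by (intro divide_left_mono) auto
    finally have 1: "ln (real (m + 1)) \<le> ln (real (i + 1)) + (real m - real i) / real i" by simp
    have "(real m - real i) / real i * 1 \<le> (real m - real i) / real i * (2 * ln (real (i + 1)))"
      using lni i by (intro mult_left_mono) auto
    with 1 have "ln (real (m + 1)) \<le> (1 + 2 * ((real m - real i) / real i)) * ln (real (i + 1))"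
      by (simp add: algebra_simps)
    also have "1 + 2 * ((real m - real i) / real i) \<le> 2 * (real m / real i)" using i by (simp add: field_simps)
    finally have "ln (real (m + 1)) \<le> 2 * (real m / real i) * ln (real (i + 1))"
      using lni by (simp add: mult_right_mono)
    then show "R \<le> 2 * (real m / real i)" unfolding Req using lni by (subst pos_divide_le_eq) linarith+
  qed
  have "log 2 R \<le> log 2 (2 * (real m / real i))" using R by (intro log_mono) auto
  also have "\<dots> = 1 + t" using i unfolding t_def by (subst log_mult) auto
  finally have "?a * log 2 R \<le> ?a * (1 + t)" by (intro mult_left_mono) auto
  moreover have "real (bit_number \<alpha> \<beta> m i) \<le> max (\<beta> * t + ?a * log 2 R) 1 + 1"
    unfolding bit_number_def t_def R_def by linarith
  moreover have "0 \<le> \<beta> * t" "0 \<le> ?a * (1 + t)" using t \<beta> by auto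
  ultimately have "real (bit_number \<alpha> \<beta> m i) \<le> (\<beta> * t + ?a * (1 + t)) + 2" by linarith
  also have "\<dots> = 2 + ?a + (\<beta> + ?a) * t" by (simp add: algebra_simps)
  also have "t = (ln (real m) - ln (real i)) / ln 2" using i by (simp add: t_def log_def ln_div)
  finally show ?thesis by simp
qed

text \<open>On average a coordinate needs boundedly many bits, because the mean of \<open>ln (m / i)\<close> over
  \<open>i = 1, \<dots>, m\<close> is at most \<open>1\<close>.\<close>

lemma sum_bit_number_le:
  assumes \<beta>: "\<beta> > 0"
  shows "\<exists>D::nat. \<forall>m. (\<Sum>i=1..m. bit_number \<alpha> \<beta> m i) \<le> D * m"
proof -
  define c where "c = (\<beta> + max \<alpha> 0) / ln 2"
  have c: "c \<ge> 0" using \<beta> by (simp add: c_def)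
  define D where "D = nat \<lceil>2 + max \<alpha> 0 + c\<rceil>"
  have "(\<Sum>i=1..m. bit_number \<alpha> \<beta> m i) \<le> D * m" for m
  proof -
    have "real (\<Sum>i=1..m. bit_number \<alpha> \<beta> m i) \<le> (\<Sum>i=1..m. 2 + max \<alpha> 0 + c * (ln (real m) - ln (real i)))"
      unfolding of_nat_sum c_def by (intro sum_mono bit_number_le \<beta>) auto
    also have "\<dots> = real m * (2 + max \<alpha> 0) + c * (real m * ln (real m) - (\<Sum>i=1..m. ln (real i)))"
      by (simp add: sum.distrib sum_distrib_left[symmetric] sum_subtractf)
    also have "\<dots> \<le> real m * (2 + max \<alpha> 0) + c * real m"
      using sum_ln_ge[of m] c by (intro add_left_mono mult_left_mono) auto
    also have "\<dots> = (2 + max \<alpha> 0 + c) * real m" by (simp add: algebra_simps)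
    also have "\<dots> \<le> real D * real m" unfolding D_def by (intro mult_right_mono real_nat_ceiling_ge) simp
    finally show ?thesis by (simp only: of_nat_mult[symmetric] of_nat_le_iff)
  qed
  then show ?thesis by blast
qed

section \<open>Total cost\<close>

text \<open>Before rounding up the sample sizes, the sum equals \<open>K_eps\<close> times the level sum; rounding adds at
  most \<open>2 ^ l\<close> on level \<open>l\<close>.\<close>

lemma total_cost_bounds:
  fixes \<alpha> \<beta> \<epsilon> :: real
  assumes "\<beta> > 1" "\<epsilon> \<in> accuracies"
  defines "L \<equiv> L_eps \<alpha> \<beta> \<epsilon>"
  shows "K_eps \<alpha> \<beta> \<epsilon> * level_sum (1 - \<beta> / 2) (- \<alpha> / 2) L \<le> real (\<Sum>l=1..L. N_eps \<alpha> \<beta> \<epsilon> l * 2 ^ l)"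
    and "real (\<Sum>l=1..L. N_eps \<alpha> \<beta> \<epsilon> l * 2 ^ l) \<le> K_eps \<alpha> \<beta> \<epsilon> * level_sum (1 - \<beta> / 2) (- \<alpha> / 2) L + 2 * 2 ^ L"
proof -
  let ?x = "\<lambda>l. 2 powr (- real l * \<beta> / 2) * real l powr (- \<alpha> / 2) * K_eps \<alpha> \<beta> \<epsilon>"
  have eq: "K_eps \<alpha> \<beta> \<epsilon> * level_sum (1 - \<beta> / 2) (- \<alpha> / 2) L = (\<Sum>l=1..L. ?x l * 2 ^ l)"
  proof -
    have "2 powr ((1 - \<beta> / 2) * real l) = 2 powr (- real l * \<beta> / 2) * 2 ^ l" for l
    proof -
      have "(1 - \<beta> / 2) * real l = - real l * \<beta> / 2 + real l" by (simp add: field_simps)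
      then show ?thesis by (simp only: powr_add powr_realpow[of 2, simplified])
    qed
    then show ?thesis by (simp add: level_sum_def sum_distrib_left mult_ac)
  qed
  show "K_eps \<alpha> \<beta> \<epsilon> * level_sum (1 - \<beta> / 2) (- \<alpha> / 2) L \<le> real (\<Sum>l=1..L. N_eps \<alpha> \<beta> \<epsilon> l * 2 ^ l)"
    unfolding eq using N_eps_bounds(1)[OF assms(2)]
    by (simp only: of_nat_sum of_nat_mult of_nat_power of_nat_numeral) (intro sum_mono mult_right_mono, auto)
  have geo: "(\<Sum>l=1..n. (2::real) ^ l) \<le> 2 * 2 ^ n" for n :: nat
    by (induction n) auto
  have "real (\<Sum>l=1..L. N_eps \<alpha> \<beta> \<epsilon> l * 2 ^ l) \<le> (\<Sum>l=1..L. (?x l + 1) * 2 ^ l)"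
    using N_eps_bounds(2)[OF assms(2)]
    by (simp only: of_nat_sum of_nat_mult of_nat_power of_nat_numeral) (intro sum_mono mult_right_mono, auto)
  also have "\<dots> = (\<Sum>l=1..L. ?x l * 2 ^ l) + (\<Sum>l=1..L. 2 ^ l)"
    by (simp add: distrib_right sum.distrib)
  also have "\<dots> \<le> K_eps \<alpha> \<beta> \<epsilon> * level_sum (1 - \<beta> / 2) (- \<alpha> / 2) L + 2 * 2 ^ L"
    unfolding eq using geo[of L] by simp
  finally show "real (\<Sum>l=1..L. N_eps \<alpha> \<beta> \<epsilon> l * 2 ^ l) \<le> K_eps \<alpha> \<beta> \<epsilon> * level_sum (1 - \<beta> / 2) (- \<alpha> / 2) L + 2 * 2 ^ L" .
qed

lemma total_cost_comparable:
  assumes "\<beta> > 1"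
  shows "\<exists>C>0. \<forall>\<epsilon>\<in>accuracies.
    real (\<Sum>l=1..L_eps \<alpha> \<beta> \<epsilon>. N_eps \<alpha> \<beta> \<epsilon> l * 2 ^ l) \<le> C * cost_order \<alpha> \<beta> \<epsilon> \<and>
    cost_order \<alpha> \<beta> \<epsilon> \<le> C * real (\<Sum>l=1..L_eps \<alpha> \<beta> \<epsilon>. N_eps \<alpha> \<beta> \<epsilon> l * 2 ^ l)"
proof -
  let ?G = "\<lambda>\<epsilon>. level_sum (1 - \<beta> / 2) (- \<alpha> / 2) (L_eps \<alpha> \<beta> \<epsilon>)"
  obtain A where A: "A > 0" "\<And>\<epsilon>. \<epsilon> \<in> accuracies \<Longrightarrow>
      ?G \<epsilon> \<le> A * (\<epsilon>\<^sup>2 * K_eps \<alpha> \<beta> \<epsilon>) \<and> \<epsilon>\<^sup>2 * K_eps \<alpha> \<beta> \<epsilon> \<le> A * ?G \<epsilon>"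
    using level_sum_comparable[OF assms, of \<alpha>] unfolding comparable_on_def by blast
  obtain B where B: "B > 0" "\<And>\<epsilon>. \<epsilon> \<in> accuracies \<Longrightarrow> 2 ^ L_eps \<alpha> \<beta> \<epsilon> \<le> B * cost_order \<alpha> \<beta> \<epsilon>"
    using two_power_L_eps_le[OF assms, of \<alpha>] by blast
  show ?thesis
  proof (intro exI[of _ "A + 2 * B"] conjI ballI)
    fix \<epsilon> :: real assume e: "\<epsilon> \<in> accuracies"
    have K: "K_eps \<alpha> \<beta> \<epsilon> > 0" by (rule K_eps_pos[OF e])
    have co: "cost_order \<alpha> \<beta> \<epsilon> = K_eps \<alpha> \<beta> \<epsilon> * (\<epsilon>\<^sup>2 * K_eps \<alpha> \<beta> \<epsilon>)"
      by (simp add: cost_order_eq[OF assms e] power2_eq_square)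
    let ?T = "real (\<Sum>l=1..L_eps \<alpha> \<beta> \<epsilon>. N_eps \<alpha> \<beta> \<epsilon> l * 2 ^ l)"
    note T = total_cost_bounds[OF assms e, of \<alpha>]
    have "K_eps \<alpha> \<beta> \<epsilon> * ?G \<epsilon> \<le> K_eps \<alpha> \<beta> \<epsilon> * (A * (\<epsilon>\<^sup>2 * K_eps \<alpha> \<beta> \<epsilon>))"
      using A(2)[OF e] K by (intro mult_left_mono) auto
    then have "K_eps \<alpha> \<beta> \<epsilon> * ?G \<epsilon> \<le> A * cost_order \<alpha> \<beta> \<epsilon>" unfolding co by (simp add: mult_ac)
    then show "?T \<le> (A + 2 * B) * cost_order \<alpha> \<beta> \<epsilon>"
      using T(2) B(2)[OF e] by (simp add: distrib_right)
    have "cost_order \<alpha> \<beta> \<epsilon> \<le> K_eps \<alpha> \<beta> \<epsilon> * (A * ?G \<epsilon>)"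
      unfolding co using A(2)[OF e] K by (intro mult_left_mono) auto
    also have "\<dots> = A * (K_eps \<alpha> \<beta> \<epsilon> * ?G \<epsilon>)" by simp
    also have "\<dots> \<le> A * ?T" using T(1) A(1) by (intro mult_left_mono) auto
    also have "\<dots> \<le> (A + 2 * B) * ?T" using B(1) by (intro mult_right_mono of_nat_0_le_iff) simp
    finally show "cost_order \<alpha> \<beta> \<epsilon> \<le> (A + 2 * B) * ?T" .
  qed (use A B in auto)
qed

lemma multilevel_cost:
  fixes e :: "nat \<Rightarrow> 'h::real_normed_vector"
  assumes "\<beta> > 1"
  shows "order_equiv_on accuracies
    (\<lambda>\<epsilon>. worst_case_cost e (multilevel_prog lam e (bit_number \<alpha> \<beta>) (L_eps \<alpha> \<beta> \<epsilon>) (N_eps \<alpha> \<beta> \<epsilon>)) Lip1)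
    (\<lambda>\<epsilon>. ennreal (cost_order \<alpha> \<beta> \<epsilon>))"
proof -
  have "\<beta> > 0" using assms by simp
  from sum_bit_number_le[OF this, of \<alpha>] obtain D0 where
    D0: "\<And>m. (\<Sum>i=1..m. bit_number \<alpha> \<beta> m i) \<le> D0 * m" by blast
  define D where "D = 3 * D0 + 17"
  obtain C where C: "C > 0" "\<And>\<epsilon>. \<epsilon> \<in> accuracies \<Longrightarrow>
    real (\<Sum>l=1..L_eps \<alpha> \<beta> \<epsilon>. N_eps \<alpha> \<beta> \<epsilon> l * 2 ^ l) \<le> C * cost_order \<alpha> \<beta> \<epsilon> \<and>
    cost_order \<alpha> \<beta> \<epsilon> \<le> C * real (\<Sum>l=1..L_eps \<alpha> \<beta> \<epsilon>. N_eps \<alpha> \<beta> \<epsilon> l * 2 ^ l)"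
    using total_cost_comparable[OF assms, of \<alpha>] by blast
  let ?T = "\<lambda>\<epsilon>. \<Sum>l=1..L_eps \<alpha> \<beta> \<epsilon>. N_eps \<alpha> \<beta> \<epsilon> l * 2 ^ l"
  let ?W = "\<lambda>\<epsilon>. worst_case_cost e (multilevel_prog lam e (bit_number \<alpha> \<beta>) (L_eps \<alpha> \<beta> \<epsilon>) (N_eps \<alpha> \<beta> \<epsilon>)) Lip1"
  have "(\<lambda>_::'h. 0::real) \<in> Lip1" by (simp add: Lip1_def lipschitz_on_def)
  then have ne: "(Lip1 :: ('h \<Rightarrow> real) set) \<noteq> {}" by blast
  have W: "of_nat (?T \<epsilon>) \<le> ?W \<epsilon>" "?W \<epsilon> \<le> of_nat (D * ?T \<epsilon>)" if e: "\<epsilon> \<in> accuracies" for \<epsilon>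
  proof -
    have "cost_between e f (multilevel_prog lam e (bit_number \<alpha> \<beta>) (L_eps \<alpha> \<beta> \<epsilon>) (N_eps \<alpha> \<beta> \<epsilon>)) (?T \<epsilon>) (D * ?T \<epsilon>)" for f
    proof (rule cost_between_multilevel_prog)
      show "N_eps \<alpha> \<beta> \<epsilon> l \<ge> 1" if "l \<in> {1..L_eps \<alpha> \<beta> \<epsilon>}" for l
        using N_eps_bounds(3)[OF e] that by simp
      show "3 * (\<Sum>i=1..2 ^ l. bit_number \<alpha> \<beta> (2 ^ l) i) + 17 * 2 ^ l \<le> D * 2 ^ l" for l
        using D0[of "2 ^ l"] by (simp add: D_def algebra_simps)
    qed
    then show "of_nat (?T \<epsilon>) \<le> ?W \<epsilon>" "?W \<epsilon> \<le> of_nat (D * ?T \<epsilon>)"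
      using worst_case_cost_between[OF _ ne] by blast+
  qed
  have D: "D > 0" by (simp add: D_def)
  show ?thesis
    unfolding order_equiv_on_def preceq_on_def
  proof (intro conjI exI ballI)
    show "0 < real D * C" using D C by simp
    show "C > 0" by (rule C)
    fix \<epsilon> :: real assume e: "\<epsilon> \<in> accuracies"
    have co: "0 \<le> cost_order \<alpha> \<beta> \<epsilon>" by (simp add: cost_order_eq[OF assms e])
    have "?W \<epsilon> \<le> ennreal (real (D * ?T \<epsilon>))" using W(2)[OF e] by (simp only: ennreal_of_nat_eq_real_of_nat)
    also have "\<dots> \<le> ennreal (real D * C * cost_order \<alpha> \<beta> \<epsilon>)"
    proof (rule ennreal_leI)
      have "real D * real (?T \<epsilon>) \<le> real D * (C * cost_order \<alpha> \<beta> \<epsilon>)" using C(2)[OF e] by (intro mult_left_mono) auto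
      then show "real (D * ?T \<epsilon>) \<le> real D * C * cost_order \<alpha> \<beta> \<epsilon>" by (simp only: of_nat_mult mult.assoc)
    qed
    also have "\<dots> = ennreal (real D * C) * ennreal (cost_order \<alpha> \<beta> \<epsilon>)"
      using C co by (intro ennreal_mult) auto
    finally show "?W \<epsilon> \<le> ennreal (real D * C) * ennreal (cost_order \<alpha> \<beta> \<epsilon>)" .
    have "ennreal (cost_order \<alpha> \<beta> \<epsilon>) \<le> ennreal (C * real (?T \<epsilon>))" using C(2)[OF e] by (intro ennreal_leI) blast
    also have "\<dots> = ennreal C * ennreal (real (?T \<epsilon>))"
      using C(1) by (intro ennreal_mult less_imp_le of_nat_0_le_iff)
    also have "\<dots> \<le> ennreal C * ?W \<epsilon>"
      using W(1)[OF e] by (intro mult_left_mono) (simp_all only: ennreal_of_nat_eq_real_of_nat zero_le)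
    finally show "ennreal (cost_order \<alpha> \<beta> \<epsilon>) \<le> ennreal C * ?W \<epsilon>" .
  qed
qed

section \<open>Error and cost\<close>

theorem theorem5:
  fixes M :: "'w measure" and P :: "'v measure"
    and X :: "'w \<Rightarrow> 'h::{real_inner, polish_space}"
    and lam :: "nat \<Rightarrow> real" and Y :: "nat \<Rightarrow> 'w \<Rightarrow> real" and e :: "nat \<Rightarrow> 'h"
    and Xc :: "nat \<Rightarrow> nat \<Rightarrow> 'v \<Rightarrow> 'h"
    and \<alpha> \<beta> :: real
  assumes "prob_space M"
    and "centered_gaussian M X"
    and "infinite_dimensional_set (measure_support (distr M borel X))"
    and "karhunen_loeve M X lam Y e"
    and "\<beta> > 1"
    and "\<exists>c>0. (\<lambda>i. lam i * real i powr \<beta> * ln (real i) powr \<alpha>) \<longlonglongrightarrow> c"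
    and "independent_copies M X P Xc"
  shows
    "preceq_on {0<..exp (- 2)}
           (\<lambda>\<epsilon>. worst_case_error P
              (multilevel lam e (bit_number \<alpha> \<beta>) (L_eps \<alpha> \<beta> \<epsilon>) (N_eps \<alpha> \<beta> \<epsilon>) Xc)
              (\<lambda>f. \<integral>\<omega>. f (X \<omega>) \<partial>M) Lip1)
           (\<lambda>\<epsilon>. ennreal \<epsilon>) \<and>
     order_equiv_on {0<..exp (- 2)}
           (\<lambda>\<epsilon>. worst_case_cost e
              (multilevel_prog lam e (bit_number \<alpha> \<beta>) (L_eps \<alpha> \<beta> \<epsilon>) (N_eps \<alpha> \<beta> \<epsilon>))
              Lip1)
           (\<lambda>\<epsilon>. ennreal (cost_order \<alpha> \<beta> \<epsilon>))"
proof
  have "eigenvalue_decay lam \<alpha> \<beta>"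
    using assms(4-6) by (auto simp: karhunen_loeve_def eigenvalue_decay_def)
  moreover have "X \<in> borel_measurable M" using assms(2) by (simp add: centered_gaussian_def)
  ultimately have *: "gaussian_expansion M lam \<alpha> \<beta> X Y e"
    using assms(1,4) by (simp add: gaussian_expansion_def gaussian_expansion_axioms_def)
  show "preceq_on accuracies
      (\<lambda>\<epsilon>. worst_case_error P
        (multilevel lam e (bit_number \<alpha> \<beta>) (L_eps \<alpha> \<beta> \<epsilon>) (N_eps \<alpha> \<beta> \<epsilon>) Xc)
        (\<lambda>f. \<integral>\<omega>. f (X \<omega>) \<partial>M) Lip1)
      (\<lambda>\<epsilon>. ennreal \<epsilon>)"
    by (rule multilevel_error[OF * assms(7)])
  show "order_equiv_on accuracies
      (\<lambda>\<epsilon>. worst_case_cost e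
        (multilevel_prog lam e (bit_number \<alpha> \<beta>) (L_eps \<alpha> \<beta> \<epsilon>) (N_eps \<alpha> \<beta> \<epsilon>)) Lip1)
      (\<lambda>\<epsilon>. ennreal (cost_order \<alpha> \<beta> \<epsilon>))"
    by (rule multilevel_cost[OF assms(5)])
qed

end
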